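(* Let $\mathbb{K}\in\{\mathbb{R},\mathbb{C}\}$, let $0\to\mathfrak{n}\to\widehat{\mathfrak{g}}\xrightarrow{q}\mathfrak{g}\to 0$ be an extension of Lie algebras over $\mathbb{K}$, and let $V$ be a $\mathfrak{g}$-module, also regarded as a $\widehat{\mathfrak{g}}$-module via $x.v:=q(x).v$. Let $p\in\mathbb{N}_0$, let $\sigma_0,\sigma_1:\mathfrak{g}\to\widehat{\mathfrak{g}}$ be linear sections of $q$, and let $f\in\mathrm{Sym}^p(\mathfrak{n},V)^{\widehat{\mathfrak{g}}}$. Then $$p\cdot d_{\mathfrak{g}}\big(\Delta_f(\sigma_0,\sigma_1)\big)=\Delta_f(\sigma_1)-\Delta_f(\sigma_0)\in C^{2p}(\mathfrak{g},V).$$ In particular, $[\Delta_f(\sigma_0)]=[\Delta_f(\sigma_1)]$ in $H^{2p}(\mathfrak{g},V)$. Hence the map $[\Delta(\sigma)]:\mathrm{Sym}^p(\mathfrak{n},V)^{\widehat{\mathfrak{g}}}\to H^{2p}(\mathfrak{g},V)$, $f\mapsto[\Delta_f(\sigma)]$, is independent of the choice of the linear section $\sigma$ of $q$ and is, in fact, Lecomte's generalized Chern--Weil homomorphism $C_p:\mathrm{Sym}^p(\mathfrak{n},V)^{\widehat{\mathfrak{g}}}\to H^{2p}(\mathfrak{g},V)$, $f\mapsto\frac{1}{p!}[f_\sigma]$.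
   Context: All vector spaces are over $\mathbb{K}$. $C^p(\mathfrak{g},W)=\mathrm{Alt}^p(\mathfrak{g},W)$ denotes the space of alternating $p$-linear maps $\mathfrak{g}^p\to W$. The Chevalley--Eilenberg differential $d_{\mathfrak{g}}:C^p(\mathfrak{g},V)\to C^{p+1}(\mathfrak{g},V)$ is $$d_{\mathfrak{g}}\omega(x_0,\ldots,x_p)=\sum_{j=0}^p(-1)^jx_j.\omega(x_0,\ldots,\widehat{x}_j,\ldots,x_p)+\sum_{i<j}(-1)^{i+j}\omega([x_i,x_j],x_0,\ldots,\widehat{x}_i,\ldots,\widehat{x}_j,\ldots,x_p),$$ and $H^p(\mathfrak{g},V)=\ker(d_{\mathfrak{g}}|_{C^p})/d_{\mathfrak{g}}(C^{p-1}(\mathfrak{g},V))$ (with zero coboundaries for $p=0$). Wedge product: for a bilinear map $m:V_1\times V_2\to V_3$, $\alpha\in\mathrm{Alt}^p(\mathfrak{g},V_1)$, $\beta\in\mathrm{Alt}^q(\mathfrak{g},V_2)$, $$(\alpha\wedge_m\beta)(x_1,\ldots,x_{p+q})=\frac{1}{p!q!}\sum_{\tau\in S_{p+q}}\mathrm{sgn}(\tau)\,m\big(\alpha(x_{\tau(1)},\ldots,x_{\tau(p)}),\beta(x_{\tau(p+1)},\ldots,x_{\tau(p+q)})\big).$$ $\wedge_{\otimes_s}$ is the wedge product for the multiplication $S^a(\mathfrak{n})\times S^b(\mathfrak{n})\to S^{a+b}(\mathfrak{n})$, $(x,y)\mapsto x\otimes_s y$, of the symmetric algebra (so $S^1(\mathfrak{n})=\mathfrak{n}$,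 and the empty product is $1\in S^0(\mathfrak{n})=\mathbb{K}$). For a symmetric $p$-linear map $f:\mathfrak{n}^p\to V$, $\tilde f:S^p(\mathfrak{n})\to V$ is the linear map with $\tilde f(y_1\otimes_s\cdots\otimes_s y_p)=f(y_1,\ldots,y_p)$. $\mathrm{Sym}^p(\mathfrak{n},V)^{\widehat{\mathfrak{g}}}$ is the set of symmetric $p$-linear $f:\mathfrak{n}^p\to V$ with $x.f(y_1,\ldots,y_p)=\sum_{i=1}^p f(y_1,\ldots,[\sigma(x),y_i],\ldots,y_p)$ for all $x\in\mathfrak{g}$ and $y_1,\ldots,y_p\in\mathfrak{n}$, where the condition is required for each linear section $\sigma$ of $q$ under consideration: for $\sigma_0$ and $\sigma_1$ in the formula and in the equality of classes, so that independence of the section means that $[\Delta_f(\sigma_0)]=[\Delta_f(\sigma_1)]$ whenever $f$ satisfies the condition for both $\sigma_0$ and $\sigma_1$. For a linear section $\sigma$ of $q$, its curvature is $R_\sigma\in C^2(\mathfrak{g},\mathfrak{n})$, $R_\sigma(x,y)=[\sigma(x),\sigma(y)]-\sigma([x,y])$, and $$\Delta_f(\sigma)=f_\sigma:=\tilde f\circ(\underbrace{R_\sigma\wedge_{\otimes_s}\cdots\wedge_{\otimes_s}R_\sigma}_{p})\in C^{2p}(\mathfrak{g},V);$$ this cochain is a cocycle for $f\in\mathrm{Sym}^p(\mathfrak{n},V)^{\widehat{\mathfrak{g}}}$. For two linear sections $\sigma_0,\sigma_1$ put $\sigma_t=(1-t)\sigma_0+t\sigma_1$ and $R_t=R_{\sigma_t}$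 for $t\in[0,1]$, and $\alpha_1=\sigma_1-\sigma_0\in C^1(\mathfrak{g},\mathfrak{n})$. Then, for $p\ge1$, $$\Delta_f(\sigma_0,\sigma_1):=\int_0^1\tilde f\circ(\alpha_1\wedge_{\otimes_s}\underbrace{R_t\wedge_{\otimes_s}\cdots\wedge_{\otimes_s}R_t}_{p-1})\,dt\in C^{2p-1}(\mathfrak{g},V)$$ (the integrand is polynomial in $t$; integration is pointwise on arguments from $\mathfrak{g}$). For $p=0$, $\Delta_f(\sigma_0,\sigma_1)$ is understood to be $0$.
   Formalization: Since Δ_f(σ) = f_σ, the literal claim that f ↦ [Δ_f(σ)] equals C_p : f ↦ (1/p!)[f_σ] fails for p ≥ 2 (e.g. a Heisenberg extension of ℝ⁴); what is proved is C_p(f) = (1/p!)[Δ_f(σ)], equivalently [Δ_f(σ)] = p!·C_p(f), for every σ. *)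

theory Defs
  imports
    "HOL-Analysis.Analysis"
    "HOL-Library.Poly_Mapping"
    "HOL-Combinatorics.Permutations"
    "HOL-Algebra.QuotRing"
    "HOL-Algebra.Algebraic_Closure_Type"
begin

section \<open>Lie algebras, modules and extensions\<close>

text \<open>
  The addition of a vector space is that of its type; the action of the scalars and the further
  operations are fields of a record. The ground field is a type of class
  \<^class>\<open>real_normed_field\<close>: \<^typ>\<open>real\<close> and \<^typ>\<open>complex\<close> are instances, and
  by the Gelfand-Mazur theorem every other instance is isomorphic to one of these two.
\<close>

record ('k, 'a) lie_alg =
  lscale :: "'k \<Rightarrow> 'a \<Rightarrow> 'a"
  lbr :: "'a \<Rightarrow> 'a \<Rightarrow> 'a"

record ('k, 'g, 'v) lie_mod =
  mscale :: "'k \<Rightarrow> 'v \<Rightarrow> 'v"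
  mact :: "'g \<Rightarrow> 'v \<Rightarrow> 'v"

record ('k, 'n, 'h, 'g) lie_ext =
  ker_alg :: "('k, 'n) lie_alg"
  tot_alg :: "('k, 'h) lie_alg"
  quo_alg :: "('k, 'g) lie_alg"
  incl :: "'n \<Rightarrow> 'h"
  proj :: "'h \<Rightarrow> 'g"

definition lie_algebra :: "('k::field, 'a::ab_group_add) lie_alg \<Rightarrow> bool" where
  "lie_algebra L \<longleftrightarrow>
     vector_space (lscale L) \<and>
     (\<forall>x. Vector_Spaces.linear (lscale L) (lscale L) (\<lambda>y. lbr L x y)) \<and>
     (\<forall>y. Vector_Spaces.linear (lscale L) (lscale L) (\<lambda>x. lbr L x y)) \<and>
     (\<forall>x. lbr L x x = 0) \<and>
     (\<forall>x y z. lbr L x (lbr L y z) + lbr L y (lbr L z x) + lbr L z (lbr L x y) = 0)"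

definition lie_hom ::
  "('k::field, 'a::ab_group_add) lie_alg \<Rightarrow> ('k, 'b::ab_group_add) lie_alg \<Rightarrow> ('a \<Rightarrow> 'b) \<Rightarrow> bool" where
  "lie_hom L M h \<longleftrightarrow>
     Vector_Spaces.linear (lscale L) (lscale M) h \<and> (\<forall>x y. h (lbr L x y) = lbr M (h x) (h y))"

definition lie_module ::
  "('k::field, 'g::ab_group_add) lie_alg \<Rightarrow> ('k, 'g, 'v::ab_group_add) lie_mod \<Rightarrow> bool" where
  "lie_module L V \<longleftrightarrow>
     vector_space (mscale V) \<and>
     (\<forall>x. Vector_Spaces.linear (mscale V) (mscale V) (\<lambda>v. mact V x v)) \<and>
     (\<forall>v. Vector_Spaces.linear (lscale L) (mscale V) (\<lambda>x. mact V x v)) \<and>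
     (\<forall>x y v. mact V (lbr L x y) v = mact V x (mact V y v) - mact V y (mact V x v))"

definition lie_extension ::
  "('k::field, 'n::ab_group_add, 'h::ab_group_add, 'g::ab_group_add) lie_ext \<Rightarrow> bool" where
  "lie_extension E \<longleftrightarrow>
     lie_algebra (ker_alg E) \<and> lie_algebra (tot_alg E) \<and> lie_algebra (quo_alg E) \<and>
     lie_hom (ker_alg E) (tot_alg E) (incl E) \<and> lie_hom (tot_alg E) (quo_alg E) (proj E) \<and>
     inj (incl E) \<and> surj (proj E) \<and> range (incl E) = {h. proj E h = 0}"

definition linear_section ::
  "('k::field, 'n::ab_group_add, 'h::ab_group_add, 'g::ab_group_add) lie_ext \<Rightarrow> ('g \<Rightarrow> 'h) \<Rightarrow> bool" where
  "linear_section E \<sigma> \<longleftrightarrow>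
     Vector_Spaces.linear (lscale (quo_alg E)) (lscale (tot_alg E)) \<sigma> \<and> (\<forall>x. proj E (\<sigma> x) = x)"

section \<open>Multilinear maps and Lie algebra cohomology\<close>

text \<open>
  A \<open>p\<close>-linear map is a function on lists that is \<open>0\<close> on the lists whose length is not \<open>p\<close>, so
  that equality of \<open>p\<close>-linear maps is equality of functions.
\<close>

definition multilinear_maps ::
  "('k::field \<Rightarrow> 'a::ab_group_add \<Rightarrow> 'a) \<Rightarrow> ('k \<Rightarrow> 'b::ab_group_add \<Rightarrow> 'b) \<Rightarrow> nat \<Rightarrow> ('a list \<Rightarrow> 'b) set" where
  "multilinear_maps s1 s2 p =
     {f. (\<forall>xs. length xs \<noteq> p \<longrightarrow> f xs = 0) \<and>
         (\<forall>xs i. length xs = p \<and> i < p \<longrightarrow> Vector_Spaces.linear s1 s2 (\<lambda>x. f (xs[i := x])))}"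

definition alt_maps ::
  "('k::field \<Rightarrow> 'a::ab_group_add \<Rightarrow> 'a) \<Rightarrow> ('k \<Rightarrow> 'b::ab_group_add \<Rightarrow> 'b) \<Rightarrow> nat \<Rightarrow> ('a list \<Rightarrow> 'b) set" where
  "alt_maps s1 s2 p =
     {f \<in> multilinear_maps s1 s2 p. \<forall>xs. length xs = p \<and> \<not> distinct xs \<longrightarrow> f xs = 0}"

definition sym_maps ::
  "('k::field \<Rightarrow> 'a::ab_group_add \<Rightarrow> 'a) \<Rightarrow> ('k \<Rightarrow> 'b::ab_group_add \<Rightarrow> 'b) \<Rightarrow> nat \<Rightarrow> ('a list \<Rightarrow> 'b) set" where
  "sym_maps s1 s2 p =
     {f \<in> multilinear_maps s1 s2 p.
        \<forall>xs \<tau>. length xs = p \<and> \<tau> permutes {..<p} \<longrightarrow> f (permute_list \<tau> xs) = f xs}"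

abbreviation cochains ::
  "('k::field, 'g::ab_group_add) lie_alg \<Rightarrow> ('k, 'g, 'v::ab_group_add) lie_mod \<Rightarrow> nat \<Rightarrow> ('g list \<Rightarrow> 'v) set" where
  "cochains L V p \<equiv> alt_maps (lscale L) (mscale V) p"

text \<open>
  The degree is read off the argument: on a list of length \<open>p + 1\<close> this is the value of the
  differential of a \<open>p\<close>-cochain. \<^term>\<open>nths xs (- {i, j})\<close> is \<open>xs\<close> without its
  entries \<open>i\<close> and \<open>j\<close>.
\<close>

definition ce_diff ::
  "('k::field, 'g::ab_group_add) lie_alg \<Rightarrow> ('k, 'g, 'v::ab_group_add) lie_mod \<Rightarrow>
     ('g list \<Rightarrow> 'v) \<Rightarrow> ('g list \<Rightarrow> 'v)" where
  "ce_diff L V \<omega> = (\<lambda>xs.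
     (\<Sum>j<length xs. mscale V ((-1) ^ j) (mact V (xs ! j) (\<omega> (nths xs (- {j}))))) +
     (\<Sum>(i, j)\<in>{(i, j). i < j \<and> j < length xs}.
        mscale V ((-1) ^ (i + j)) (\<omega> (lbr L (xs ! i) (xs ! j) # nths xs (- {i, j})))))"

definition cocycles ::
  "('k::field, 'g::ab_group_add) lie_alg \<Rightarrow> ('k, 'g, 'v::ab_group_add) lie_mod \<Rightarrow> nat \<Rightarrow> ('g list \<Rightarrow> 'v) set" where
  "cocycles L V p = {\<omega> \<in> cochains L V p. ce_diff L V \<omega> = (\<lambda>xs. 0)}"

definition coboundaries ::
  "('k::field, 'g::ab_group_add) lie_alg \<Rightarrow> ('k, 'g, 'v::ab_group_add) lie_mod \<Rightarrow> nat \<Rightarrow> ('g list \<Rightarrow> 'v) set" where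
  "coboundaries L V p = (if p = 0 then {\<lambda>xs. 0} else ce_diff L V ` cochains L V (p - 1))"

definition coh_rel ::
  "('k::field, 'g::ab_group_add) lie_alg \<Rightarrow> ('k, 'g, 'v::ab_group_add) lie_mod \<Rightarrow> nat \<Rightarrow>
     (('g list \<Rightarrow> 'v) \<times> ('g list \<Rightarrow> 'v)) set" where
  "coh_rel L V p = {(\<omega>, \<eta>). \<omega> \<in> cocycles L V p \<and> \<eta> \<in> cocycles L V p \<and>
     (\<lambda>xs. \<omega> xs - \<eta> xs) \<in> coboundaries L V p}"

definition cohomology ::
  "('k::field, 'g::ab_group_add) lie_alg \<Rightarrow> ('k, 'g, 'v::ab_group_add) lie_mod \<Rightarrow> nat \<Rightarrow> ('g list \<Rightarrow> 'v) set set" where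
  "cohomology L V p = cocycles L V p // coh_rel L V p"

definition coh_class ::
  "('k::field, 'g::ab_group_add) lie_alg \<Rightarrow> ('k, 'g, 'v::ab_group_add) lie_mod \<Rightarrow> nat \<Rightarrow>
     ('g list \<Rightarrow> 'v) \<Rightarrow> ('g list \<Rightarrow> 'v) set" where
  "coh_class L V p \<omega> = coh_rel L V p `` {\<omega>}"

definition coh_add ::
  "('k::field, 'g::ab_group_add) lie_alg \<Rightarrow> ('k, 'g, 'v::ab_group_add) lie_mod \<Rightarrow> nat \<Rightarrow>
     ('g list \<Rightarrow> 'v) set \<Rightarrow> ('g list \<Rightarrow> 'v) set \<Rightarrow> ('g list \<Rightarrow> 'v) set" where
  "coh_add L V p A B = (\<Union>\<omega>\<in>A. \<Union>\<eta>\<in>B. coh_class L V p (\<lambda>xs. \<omega> xs + \<eta> xs))"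

definition coh_scale ::
  "('k::field, 'g::ab_group_add) lie_alg \<Rightarrow> ('k, 'g, 'v::ab_group_add) lie_mod \<Rightarrow> nat \<Rightarrow>
     'k \<Rightarrow> ('g list \<Rightarrow> 'v) set \<Rightarrow> ('g list \<Rightarrow> 'v) set" where
  "coh_scale L V p c A = (\<Union>\<omega>\<in>A. coh_class L V p (\<lambda>xs. mscale V c (\<omega> xs)))"

section \<open>The symmetric algebra\<close>

text \<open>
  The symmetric algebra of \<open>(N, s)\<close> is the quotient of the polynomial ring with one variable
  \<open>X\<^sub>y\<close> for each vector \<open>y\<close> (finitely supported functions on the monomials, that is, on the
  multisets of vectors, with the convolution product) by the relations that make
  \<open>y \<mapsto> X\<^sub>y\<close> linear.
\<close>

definition sym_var :: "'n \<Rightarrow> ('n multiset \<Rightarrow>\<^sub>0 'k::field)" where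
  "sym_var y = Poly_Mapping.single {#y#} 1"

definition sym_const :: "'k \<Rightarrow> ('n multiset \<Rightarrow>\<^sub>0 'k::field)" where
  "sym_const c = Poly_Mapping.single {#} c"

definition sym_ideal ::
  "('k::field \<Rightarrow> 'n::ab_group_add \<Rightarrow> 'n) \<Rightarrow> ('n multiset \<Rightarrow>\<^sub>0 'k) set" where
  "sym_ideal s = genideal ring_of_type_algebra
     ({sym_var (y + z) - sym_var y - sym_var z | y z. True} \<union>
      {sym_var (s c y) - sym_const c * sym_var y | c y. True})"

definition sym_alg ::
  "('k::field \<Rightarrow> 'n::ab_group_add \<Rightarrow> 'n) \<Rightarrow> ('n multiset \<Rightarrow>\<^sub>0 'k) set ring" where
  "sym_alg s = FactRing ring_of_type_algebra (sym_ideal s)"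

definition sym_proj ::
  "('k::field \<Rightarrow> 'n::ab_group_add \<Rightarrow> 'n) \<Rightarrow> ('n multiset \<Rightarrow>\<^sub>0 'k) \<Rightarrow> ('n multiset \<Rightarrow>\<^sub>0 'k) set" where
  "sym_proj s P = a_r_coset ring_of_type_algebra (sym_ideal s) P"

definition sym_gen ::
  "('k::field \<Rightarrow> 'n::ab_group_add \<Rightarrow> 'n) \<Rightarrow> 'n \<Rightarrow> ('n multiset \<Rightarrow>\<^sub>0 'k) set" where
  "sym_gen s y = sym_proj s (sym_var y)"

definition sym_scale ::
  "('k::field \<Rightarrow> 'n::ab_group_add \<Rightarrow> 'n) \<Rightarrow> 'k \<Rightarrow> ('n multiset \<Rightarrow>\<^sub>0 'k) set \<Rightarrow> ('n multiset \<Rightarrow>\<^sub>0 'k) set" where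
  "sym_scale s c A = sym_proj s (sym_const c) \<otimes>\<^bsub>sym_alg s\<^esub> A"

definition sym_prod ::
  "('k::field \<Rightarrow> 'n::ab_group_add \<Rightarrow> 'n) \<Rightarrow> 'n list \<Rightarrow> ('n multiset \<Rightarrow>\<^sub>0 'k) set" where
  "sym_prod s ys = foldr (\<lambda>y A. sym_gen s y \<otimes>\<^bsub>sym_alg s\<^esub> A) ys \<one>\<^bsub>sym_alg s\<^esub>"

definition sym_power ::
  "('k::field \<Rightarrow> 'n::ab_group_add \<Rightarrow> 'n) \<Rightarrow> nat \<Rightarrow> ('n multiset \<Rightarrow>\<^sub>0 'k) set set" where
  "sym_power s p = sym_proj s ` {P. \<forall>m\<in>Poly_Mapping.keys P. size m = p}"

definition sym_lift ::
  "('k::field \<Rightarrow> 'n::ab_group_add \<Rightarrow> 'n) \<Rightarrow> ('k \<Rightarrow> 'v::ab_group_add \<Rightarrow> 'v) \<Rightarrow> nat \<Rightarrow>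
     ('n list \<Rightarrow> 'v) \<Rightarrow> ('n multiset \<Rightarrow>\<^sub>0 'k) set \<Rightarrow> 'v" where
  "sym_lift s sv p f = (THE F.
     F \<in> extensional (sym_power s p) \<and>
     (\<forall>A\<in>sym_power s p. \<forall>B\<in>sym_power s p. F (A \<oplus>\<^bsub>sym_alg s\<^esub> B) = F A + F B) \<and>
     (\<forall>c. \<forall>A\<in>sym_power s p. F (sym_scale s c A) = sv c (F A)) \<and>
     (\<forall>ys. length ys = p \<longrightarrow> F (sym_prod s ys) = f ys))"

text \<open>
  Cochains with values in the symmetric algebra, too, are functions on lists that vanish on the
  lists of the wrong length.
\<close>

definition sym_wedge ::
  "('k::field \<Rightarrow> 'n::ab_group_add \<Rightarrow> 'n) \<Rightarrow> nat \<Rightarrow> nat \<Rightarrow>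
     ('g list \<Rightarrow> ('n multiset \<Rightarrow>\<^sub>0 'k) set) \<Rightarrow> ('g list \<Rightarrow> ('n multiset \<Rightarrow>\<^sub>0 'k) set) \<Rightarrow>
     'g list \<Rightarrow> ('n multiset \<Rightarrow>\<^sub>0 'k) set" where
  "sym_wedge s p q \<alpha> \<beta> = (\<lambda>xs.
     if length xs = p + q then
       sym_scale s (1 / (of_nat (fact p) * of_nat (fact q)))
         (finsum (sym_alg s)
           (\<lambda>\<tau>. sym_scale s (of_int (sign \<tau>))
              (\<alpha> (take p (permute_list \<tau> xs)) \<otimes>\<^bsub>sym_alg s\<^esub> \<beta> (drop p (permute_list \<tau> xs))))
           {\<tau>. \<tau> permutes {..<p + q}})
     else \<zero>\<^bsub>sym_alg s\<^esub>)"

text \<open>Meant for a 2-cochain \<open>R\<close>: the degrees \<open>2\<close> and \<open>2 * p\<close> are fixed in the recursion.\<close>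

primrec sym_wedge_power ::
  "('k::field \<Rightarrow> 'n::ab_group_add \<Rightarrow> 'n) \<Rightarrow> ('g list \<Rightarrow> ('n multiset \<Rightarrow>\<^sub>0 'k) set) \<Rightarrow> nat \<Rightarrow>
     'g list \<Rightarrow> ('n multiset \<Rightarrow>\<^sub>0 'k) set" where
  "sym_wedge_power s R 0 = (\<lambda>xs. if xs = [] then \<one>\<^bsub>sym_alg s\<^esub> else \<zero>\<^bsub>sym_alg s\<^esub>)"
| "sym_wedge_power s R (Suc p) = sym_wedge s 2 (2 * p) R (sym_wedge_power s R p)"

section \<open>Curvature, characteristic cochains and their transgression\<close>

text \<open>
  \<^term>\<open>the_inv (incl E)\<close> identifies the ideal \<^term>\<open>range (incl E)\<close> with the kernel of the
  extension; it is only applied to elements of that ideal.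
\<close>

definition curvature ::
  "('k::field, 'n::ab_group_add, 'h::ab_group_add, 'g::ab_group_add) lie_ext \<Rightarrow>
     ('g \<Rightarrow> 'h) \<Rightarrow> 'g list \<Rightarrow> 'n" where
  "curvature E \<sigma> = (\<lambda>xs. if length xs = 2 then
     the_inv (incl E) (lbr (tot_alg E) (\<sigma> (xs ! 0)) (\<sigma> (xs ! 1)) - \<sigma> (lbr (quo_alg E) (xs ! 0) (xs ! 1)))
     else 0)"

definition section_diff ::
  "('k::field, 'n::ab_group_add, 'h::ab_group_add, 'g::ab_group_add) lie_ext \<Rightarrow>
     ('g \<Rightarrow> 'h) \<Rightarrow> ('g \<Rightarrow> 'h) \<Rightarrow> 'g list \<Rightarrow> 'n" where
  "section_diff E \<sigma>0 \<sigma>1 = (\<lambda>xs. if length xs = 1 then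
     the_inv (incl E) (\<sigma>1 (xs ! 0) - \<sigma>0 (xs ! 0)) else 0)"

definition section_path ::
  "('k::real_normed_field, 'n::ab_group_add, 'h::ab_group_add, 'g::ab_group_add) lie_ext \<Rightarrow>
     ('g \<Rightarrow> 'h) \<Rightarrow> ('g \<Rightarrow> 'h) \<Rightarrow> real \<Rightarrow> 'g \<Rightarrow> 'h" where
  "section_path E \<sigma>0 \<sigma>1 t = (\<lambda>x.
     lscale (tot_alg E) (of_real (1 - t)) (\<sigma>0 x) + lscale (tot_alg E) (of_real t) (\<sigma>1 x))"

text \<open>
  The symmetric maps that are equivariant with respect to the section \<open>\<sigma>\<close>. The action of
  \<open>\<sigma> x\<close> on the module is that of \<open>x\<close>, since \<open>\<sigma>\<close> is a section.
\<close>

definition sym_inv ::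
  "('k::field, 'n::ab_group_add, 'h::ab_group_add, 'g::ab_group_add) lie_ext \<Rightarrow>
     ('k, 'g, 'v::ab_group_add) lie_mod \<Rightarrow> nat \<Rightarrow> ('g \<Rightarrow> 'h) \<Rightarrow> ('n list \<Rightarrow> 'v) set" where
  "sym_inv E V p \<sigma> =
     {f \<in> sym_maps (lscale (ker_alg E)) (mscale V) p.
        \<forall>x ys. length ys = p \<longrightarrow>
          mact V x (f ys) =
            (\<Sum>i<p. f (ys[i := the_inv (incl E) (lbr (tot_alg E) (\<sigma> x) (incl E (ys ! i)))]))}"

definition chern_cochain ::
  "('k::field, 'n::ab_group_add, 'h::ab_group_add, 'g::ab_group_add) lie_ext \<Rightarrow>
     ('k, 'g, 'v::ab_group_add) lie_mod \<Rightarrow> nat \<Rightarrow> ('n list \<Rightarrow> 'v) \<Rightarrow> ('g \<Rightarrow> 'h) \<Rightarrow> 'g list \<Rightarrow> 'v" where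
  "chern_cochain E V p f \<sigma> = (let s = lscale (ker_alg E) in
     sym_lift s (mscale V) p f \<circ> sym_wedge_power s (sym_gen s \<circ> curvature E \<sigma>) p)"

text \<open>
  The integral over \<open>[0, 1]\<close> of a curve in a vector space without topology, in the weak sense:
  every linear functional may be applied under the integral sign. For a curve that is polynomial
  in the parameter it exists, and it is unique because the linear functionals separate points.
\<close>

definition integral01 ::
  "('k::real_normed_field \<Rightarrow> 'v::ab_group_add \<Rightarrow> 'v) \<Rightarrow> (real \<Rightarrow> 'v) \<Rightarrow> 'v" where
  "integral01 sv \<gamma> = (THE v. \<forall>l :: 'v \<Rightarrow> 'k. Vector_Spaces.linear sv (*) l \<longrightarrow>
     ((\<lambda>t. l (\<gamma> t)) has_integral l v) {0..1})"

definition transgression ::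
  "('k::real_normed_field, 'n::ab_group_add, 'h::ab_group_add, 'g::ab_group_add) lie_ext \<Rightarrow>
     ('k, 'g, 'v::ab_group_add) lie_mod \<Rightarrow> nat \<Rightarrow> ('n list \<Rightarrow> 'v) \<Rightarrow>
     ('g \<Rightarrow> 'h) \<Rightarrow> ('g \<Rightarrow> 'h) \<Rightarrow> 'g list \<Rightarrow> 'v" where
  "transgression E V p f \<sigma>0 \<sigma>1 = (\<lambda>xs. if p = 0 then 0 else
     (let s = lscale (ker_alg E) in
       integral01 (mscale V) (\<lambda>t. sym_lift s (mscale V) p f
         (sym_wedge s 1 (2 * (p - 1)) (sym_gen s \<circ> section_diff E \<sigma>0 \<sigma>1)
           (sym_wedge_power s (sym_gen s \<circ> curvature E (section_path E \<sigma>0 \<sigma>1 t)) (p - 1)) xs))))"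

definition chern_class ::
  "('k::field, 'n::ab_group_add, 'h::ab_group_add, 'g::ab_group_add) lie_ext \<Rightarrow>
     ('k, 'g, 'v::ab_group_add) lie_mod \<Rightarrow> nat \<Rightarrow> ('g \<Rightarrow> 'h) \<Rightarrow> ('n list \<Rightarrow> 'v) \<Rightarrow> ('g list \<Rightarrow> 'v) set" where
  "chern_class E V p \<sigma> f = coh_class (quo_alg E) V (2 * p) (chern_cochain E V p f \<sigma>)"

text \<open>
  Lecomte's generalized Chern-Weil homomorphism \<open>C\<^sub>p\<close>, computed with an arbitrarily chosen
  linear section for which \<open>f\<close> is equivariant.
\<close>

definition chern_weil ::
  "('k::field, 'n::ab_group_add, 'h::ab_group_add, 'g::ab_group_add) lie_ext \<Rightarrow>
     ('k, 'g, 'v::ab_group_add) lie_mod \<Rightarrow> nat \<Rightarrow> ('n list \<Rightarrow> 'v) \<Rightarrow> ('g list \<Rightarrow> 'v) set" where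
  "chern_weil E V p f =
     (let \<sigma> = (SOME \<sigma>. linear_section E \<sigma> \<and> f \<in> sym_inv E V p \<sigma>) in
       coh_scale (quo_alg E) V (2 * p) (1 / of_nat (fact p)) (chern_class E V p \<sigma> f))"

end

theory Submission
  imports Defs
begin

text \<open>
  Every cochain in question is an alternating sum \<open>\<Sum>\<^sub>\<tau> sgn \<tau> F (x \<circ> \<tau>)\<close> of a multilinear map \<open>F\<close> that
  is not alternating itself, such as \<open>f (R (x\<^sub>1, x\<^sub>2), R (x\<^sub>3, x\<^sub>4), \<dots>)\<close>. On
  such sums the differential acts by a Leibniz rule: the equivariance of \<open>f\<close> distributes the
  action over the blocks, a block \<open>R\<close> contributes the cyclic sum of the Bianchi identity, that
  is \<open>0\<close>, and the block \<open>\<sigma>\<^sub>1 - \<sigma>\<^sub>0\<close> contributes its covariant derivative, which is the derivative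
  in \<open>t\<close> of the curvature of \<open>\<sigma>\<^sub>t\<close>. Hence \<open>p\<close> times the differential of the integrand of the
  transgression is the derivative in \<open>t\<close> of the characteristic cochain of \<open>\<sigma>\<^sub>t\<close>, and
  integration over \<open>[0, 1]\<close> gives the formula.
\<close>

section \<open>Alternating sums over lists\<close>

text \<open>The powers of two carry the bookkeeping. Each wedge factor \<open>R\<close> brings 1/2!,
  while the other factorials of the wedge products cancel against repeated antisymmetrisation. With
  p = m + 1, the characteristic cochain is thus 1/2^p times the alternating sum of
  \<open>f (R, ..., R)\<close>, and the integrand of the transgression is 1/2^m times that of
  \<open>f (\<alpha>, R, ..., R)\<close>. The differential sums brackets over unordered pairs, an
  alternating sum over ordered ones; hence the Leibniz rule computes twice the differential, and
  this 2 closes the gap between 2^m and 2^p. The factor p comes from symmetry: differentiating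
  \<open>f (R, ..., R)\<close> in t gives p equal terms. Two obstacles shape the rest. The Leibniz
  rule at time t needs \<open>f\<close> equivariant for \<sigma>_t, while equivariance is given only
  at both ends; it extends because it is an affine condition on the section. And V carries no
  topology, so curves are differentiated formally, as polynomials in t, and the fundamental theorem
  of calculus is tested on linear functionals.\<close>

definition signed :: "bool \<Rightarrow> 'b::ab_group_add \<Rightarrow> 'b" where
  "signed b v = (if b then v else - v)"

text \<open>Signs are truth values, since the values of these sums lie in an abelian group without
  scalars. \<open>True\<close> is plus, so the product of two signs is their equality, and
  \<open>evenperm\<close> and \<open>even\<close> serve as signs directly.\<close>

lemma signed_simps [simp]:
  "signed True v = v" "signed False v = - v" "signed b 0 = 0"
  "signed a (signed b v) = signed (a = b) v"
  by (auto simp: signed_def)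

lemma signed_add: "signed b (v + w) = signed b v + signed b w"
  and signed_diff: "signed b (v - w) = signed b v - signed b w"
  and signed_minus: "signed b (- v) = - signed b v"
  by (auto simp: signed_def)

lemma signed_sum: "signed b (sum g A) = (\<Sum>x\<in>A. signed b (g x))"
  by (auto simp: signed_def sum_negf)

text \<open>There is no factor 1/n!, so antisymmetrising twice multiplies by n!; the factorials in
  the wedge product are calibrated to this.\<close>

definition alt_sum :: "('a list \<Rightarrow> 'b::ab_group_add) \<Rightarrow> 'a list \<Rightarrow> 'b" where
  "alt_sum F xs = (\<Sum>\<tau> | \<tau> permutes {..<length xs}. signed (evenperm \<tau>) (F (permute_list \<tau> xs)))"

lemma alt_sum_cong:
  assumes "\<And>ys. length ys = length xs \<Longrightarrow> F ys = G ys"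
  shows "alt_sum F xs = alt_sum G xs"
  unfolding alt_sum_def by (intro sum.cong refl) (simp add: assms)

lemma alt_sum_add: "alt_sum (\<lambda>ys. F ys + G ys) xs = alt_sum F xs + alt_sum G xs"
  by (simp add: alt_sum_def signed_add sum.distrib)

lemma alt_sum_minus: "alt_sum (\<lambda>ys. - F ys) xs = - alt_sum F xs"
  by (simp add: alt_sum_def signed_minus sum_negf)

lemma alt_sum_diff: "alt_sum (\<lambda>ys. F ys - G ys) xs = alt_sum F xs - alt_sum G xs"
  by (simp add: alt_sum_def signed_diff sum_subtractf)

lemma alt_sum_zero [simp]: "alt_sum (\<lambda>ys. 0) xs = 0"
  by (simp add: alt_sum_def)

lemma alt_sum_sum: "alt_sum (\<lambda>ys. \<Sum>i\<in>A. F i ys) xs = (\<Sum>i\<in>A. alt_sum (F i) xs)"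
  unfolding alt_sum_def signed_sum by (rule sum.swap)

lemma alt_sum_signed: "alt_sum (\<lambda>ys. signed b (F ys)) xs = signed b (alt_sum F xs)"
  by (auto simp: signed_def alt_sum_minus)

lemma alt_sum_Nil [simp]: "alt_sum F [] = F []"
proof -
  have "{\<tau>. \<tau> permutes {..<(0::nat)}} = {id}" by auto
  then show ?thesis by (simp add: alt_sum_def)
qed

lemma additive_signed:
  assumes "\<And>v w. T (v + w) = T v + T w"
  shows "T (signed b v) = signed b (T v)"
proof -
  have "T 0 = 0" using assms[of 0 0] by simp
  then have "T (- v) = - T v" using assms[of v "- v"] by (simp add: eq_neg_iff_add_eq_0 add.commute)
  then show ?thesis by (simp add: signed_def)
qed

lemma additive_sum:
  fixes T :: "'a::ab_group_add \<Rightarrow> 'b::ab_group_add"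
  assumes "\<And>v w. T (v + w) = T v + T w"
  shows "T (sum g A) = (\<Sum>x\<in>A. T (g x))"
proof -
  have "T 0 = 0" using assms[of 0 0] by simp
  then show ?thesis by (induct A rule: infinite_finite_induct) (simp_all add: assms)
qed

lemma additive_alt_sum:
  assumes "\<And>v w. T (v + w) = T v + T w"
  shows "T (alt_sum F xs) = alt_sum (\<lambda>ys. T (F ys)) xs"
  unfolding alt_sum_def additive_sum[of T, OF assms] additive_signed[of T, OF assms] ..

lemma permutes_lessThan_permutation: "\<tau> permutes {..<n::nat} \<Longrightarrow> permutation \<tau>"
  by (rule permutes_imp_permutation[rotated]) auto

text \<open>Right translation of the permutations permutes the slots of \<open>F\<close>; left
  translation, in \<open>alt_sum_permute_list\<close>, permutes the arguments.\<close>

lemma alt_sum_compose: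
  assumes \<rho>: "\<rho> permutes {..<length xs}"
  shows "alt_sum (\<lambda>ys. F (permute_list \<rho> ys)) xs = signed (evenperm \<rho>) (alt_sum F xs)"
proof -
  have "alt_sum F xs = (\<Sum>\<tau> | \<tau> permutes {..<length xs}. signed (evenperm (\<tau> \<circ> \<rho>)) (F (permute_list (\<tau> \<circ> \<rho>) xs)))"
    unfolding alt_sum_def by (rule sum_permutations_compose_right[OF \<rho>])
  also have "\<dots> = (\<Sum>\<tau> | \<tau> permutes {..<length xs}. signed (evenperm \<rho>) (signed (evenperm \<tau>) (F (permute_list \<rho> (permute_list \<tau> xs)))))"
    using \<rho> by (intro sum.cong refl)
      (auto simp: permute_list_compose evenperm_comp permutes_lessThan_permutation intro!: arg_cong2[of _ _ _ _ signed])
  finally have "alt_sum F xs = signed (evenperm \<rho>) (alt_sum (\<lambda>ys. F (permute_list \<rho> ys)) xs)"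
    by (simp only: alt_sum_def signed_sum)
  then show ?thesis by simp
qed

lemma alt_sum_permute_list:
  assumes \<rho>: "\<rho> permutes {..<length xs}"
  shows "alt_sum F (permute_list \<rho> xs) = signed (evenperm \<rho>) (alt_sum F xs)"
proof -
  have "alt_sum F xs = (\<Sum>\<tau> | \<tau> permutes {..<length xs}. signed (evenperm (\<rho> \<circ> \<tau>)) (F (permute_list (\<rho> \<circ> \<tau>) xs)))"
    unfolding alt_sum_def by (rule setum_permutations_compose_left[OF \<rho>])
  also have "\<dots> = (\<Sum>\<tau> | \<tau> permutes {..<length xs}. signed (evenperm \<rho>) (signed (evenperm \<tau>) (F (permute_list \<tau> (permute_list \<rho> xs)))))"
    using \<rho> by (intro sum.cong refl)
      (auto simp: permute_list_compose evenperm_comp permutes_lessThan_permutation)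
  finally have "alt_sum F xs = signed (evenperm \<rho>) (alt_sum F (permute_list \<rho> xs))"
    by (simp only: alt_sum_def signed_sum length_permute_list)
  then show ?thesis by simp
qed

section \<open>Laplace expansions along a slot and along an argument\<close>

definition del :: "nat \<Rightarrow> 'a list \<Rightarrow> 'a list" where
  "del j xs = take j xs @ drop (Suc j) xs"

definition ins :: "nat \<Rightarrow> 'a \<Rightarrow> 'a list \<Rightarrow> 'a list" where
  "ins j x xs = take j xs @ x # drop j xs"

lemma length_del: "j < length xs \<Longrightarrow> length (del j xs) = length xs - 1"
  by (simp add: del_def)

lemma length_ins [simp]: "length (ins j x xs) = Suc (length xs)"
  by (simp add: ins_def)

text \<open>Composition with \<open>cyc j\<close> moves entry \<open>j\<close> of a list to the front, and \<open>up q\<close> below permutes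
  the tail by \<open>q\<close>; every permutation is uniquely \<open>cyc j \<circ> up q\<close>.\<close>

definition cyc :: "nat \<Rightarrow> nat \<Rightarrow> nat" where
  "cyc j i = (if i = 0 then j else if i \<le> j then i - 1 else i)"

lemma cyc_0: "cyc 0 = id"
  by (auto simp: cyc_def)

lemma cyc_Suc: "cyc (Suc j) = Transposition.transpose j (Suc j) \<circ> cyc j"
proof
  fix i show "cyc (Suc j) i = (Transposition.transpose j (Suc j) \<circ> cyc j) i"
    by (cases "i = 0 \<or> i = Suc j") (auto simp: cyc_def Transposition.transpose_def)
qed

lemma cyc_permutes: "j < n \<Longrightarrow> cyc j permutes {..<n}"
proof (induction j)
  case (Suc j)
  then show ?case unfolding cyc_Suc by (intro permutes_compose permutes_swap_id) auto
qed (simp add: cyc_0 permutes_id)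

lemma evenperm_cyc: "evenperm (cyc j) \<longleftrightarrow> even j"
proof (induction j)
  case (Suc j)
  have "permutation (cyc j)"
    using cyc_permutes[of j "Suc j"] permutes_lessThan_permutation by blast
  then show ?case unfolding cyc_Suc
    by (subst evenperm_comp) (auto simp: Suc permutation_swap_id evenperm_swap)
qed (simp add: cyc_0)

lemma permute_list_cyc:
  assumes "j < length xs"
  shows "permute_list (cyc j) xs = xs ! j # del j xs"
proof (rule nth_equalityI)
  fix i assume "i < length (permute_list (cyc j) xs)"
  then show "permute_list (cyc j) xs ! i = (xs ! j # del j xs) ! i"
    using assms by (cases i)
      (auto simp: permute_list_def del_def cyc_def nth_append min_def)
qed (use assms in \<open>simp add: length_del\<close>)

definition up :: "(nat \<Rightarrow> nat) \<Rightarrow> nat \<Rightarrow> nat" where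
  "up q i = (case i of 0 \<Rightarrow> 0 | Suc k \<Rightarrow> Suc (q k))"

text \<open>Seen as \<open>q\<close> transported along \<open>Suc\<close>, \<open>up q\<close>
  inherits its sign and its domain from \<open>q\<close>.\<close>

lemma up_eq_map_permutation:
  assumes "q permutes {..<n}"
  shows "up q = map_permutation {..<n} Suc q"
proof
  fix i
  show "up q i = map_permutation {..<n} Suc q i"
  proof (cases "i \<in> Suc ` {..<n}")
    case True
    then obtain k where k: "i = Suc k" "k < n" by auto
    then show ?thesis by (simp add: up_def map_permutation_apply)
  next
    case False
    then have "map_permutation {..<n} Suc q i = i"
      by (simp add: map_permutation_def restrict_id_def)
    with False show ?thesis
      using permutes_not_in[OF assms] by (cases i) (auto simp: up_def)
  qed
qed

lemma up_permutes:
  assumes "q permutes {..<n}"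
  shows "up q permutes {..<Suc n}"
proof -
  have "up q permutes Suc ` {..<n}"
    unfolding up_eq_map_permutation[OF assms]
    by (rule map_permutation_permutes[OF _ assms]) (auto intro: bij_betw_imageI)
  then show ?thesis by (rule permutes_subset) auto
qed

lemma evenperm_up: "q permutes {..<n} \<Longrightarrow> evenperm (up q) = evenperm q"
  by (simp add: up_eq_map_permutation evenperm_map_permutation)

lemma up_inv:
  assumes "q permutes {..<n}"
  shows "Hilbert_Choice.inv (up q) = up (Hilbert_Choice.inv q)"
proof (rule inv_unique_comp)
  show "up q \<circ> up (Hilbert_Choice.inv q) = id" "up (Hilbert_Choice.inv q) \<circ> up q = id"
    using permutes_inverses[OF assms] by (auto simp: fun_eq_iff up_def split: nat.split)
qed

lemma permute_list_up: "permute_list (up q) (x # xs) = x # permute_list q xs"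
  by (simp add: permute_list_def up_def upt_conv_Cons map_Suc_upt[symmetric] o_def del: upt_Suc)

text \<open>The composite sends 0 to \<open>j\<close>, which recovers \<open>j\<close> and then
  \<open>q\<close>; surjectivity follows by counting, since (n + 1) * n! = (n + 1)!.\<close>

lemma bij_betw_cyc_up:
  "bij_betw (\<lambda>(j, q). cyc j \<circ> up q) ({..<Suc n} \<times> {q. q permutes {..<n}}) {\<tau>. \<tau> permutes {..<Suc n}}"
proof -
  let ?D = "{..<Suc n} \<times> {q. q permutes {..<n}}"
  let ?f = "\<lambda>(j, q). cyc j \<circ> up q"
  have inj: "inj_on ?f ?D"
  proof (rule inj_onI, clarsimp)
    fix j q j' q'
    assume j: "j < Suc n" and eq: "cyc j \<circ> up q = cyc j' \<circ> up q'"
    from fun_cong[OF eq, of 0] have jj: "j = j'" by (simp add: up_def cyc_def)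
    have "inj (cyc j)" using cyc_permutes[OF j] by (rule permutes_inj)
    with eq jj have *: "up q = up q'" by (auto simp: fun_eq_iff dest: injD)
    have "q k = q' k" for k using fun_cong[OF *, of "Suc k"] by (simp add: up_def)
    with jj show "j = j' \<and> q = q'" by auto
  qed
  have sub: "?f ` ?D \<subseteq> {\<tau>. \<tau> permutes {..<Suc n}}"
    by (auto intro!: permutes_compose up_permutes cyc_permutes)
  have "card (?f ` ?D) = card {\<tau>. \<tau> permutes {..<Suc n}}"
    using card_image[OF inj] by (simp add: card_cartesian_product card_permutations[of _ n] card_permutations[of _ "Suc n"])
  then have "?f ` ?D = {\<tau>. \<tau> permutes {..<Suc n}}"
    using sub by (intro card_subset_eq) (auto simp: finite_permutations)
  with inj show ?thesis by (simp add: bij_betw_def)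
qed

text \<open>Laplace expansion along the first slot: the permutations are grouped by the argument
  \<open>j\<close> that \<open>cyc j\<close> brings there, at the price of (-1)^j.\<close>

lemma alt_sum_rec:
  assumes "xs \<noteq> []"
  shows "alt_sum F xs = (\<Sum>j<length xs. signed (even j) (alt_sum (\<lambda>ys. F (xs ! j # ys)) (del j xs)))"
proof -
  obtain n where n: "length xs = Suc n" using assms by (cases xs) auto
  let ?g = "\<lambda>\<tau>. signed (evenperm \<tau>) (F (permute_list \<tau> xs))"
  have "alt_sum F xs = (\<Sum>(j, q)\<in>{..<Suc n} \<times> {q. q permutes {..<n}}. ?g (cyc j \<circ> up q))"
    unfolding alt_sum_def n
    by (subst sum.reindex_bij_betw[OF bij_betw_cyc_up, symmetric]) (simp add: case_prod_beta)
  also have "\<dots> = (\<Sum>j<Suc n. \<Sum>q | q permutes {..<n}. ?g (cyc j \<circ> up q))"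
    by (rule sum.cartesian_product[symmetric])
  also have "\<dots> = (\<Sum>j<Suc n. \<Sum>q | q permutes {..<n}.
      signed (even j) (signed (evenperm q) (F (xs ! j # permute_list q (del j xs)))))"
  proof (intro sum.cong refl)
    fix j q assume "j \<in> {..<Suc n}" "q \<in> {q. q permutes {..<n}}"
    then have j: "j < Suc n" and q: "q permutes {..<n}" by auto
    have "evenperm (cyc j \<circ> up q) = (even j = evenperm q)"
      using permutes_lessThan_permutation[OF cyc_permutes[OF j]] permutes_lessThan_permutation[OF up_permutes[OF q]]
      by (simp add: evenperm_comp evenperm_cyc evenperm_up[OF q])
    moreover have "permute_list (cyc j \<circ> up q) xs = xs ! j # permute_list q (del j xs)"
      using up_permutes[OF q] n j by (simp add: permute_list_compose permute_list_cyc permute_list_up)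
    ultimately show "?g (cyc j \<circ> up q) = signed (even j) (signed (evenperm q) (F (xs ! j # permute_list q (del j xs))))"
      by simp
  qed
  finally show ?thesis
    by (simp add: alt_sum_def signed_sum n length_del)
qed

lemma permute_list_inv_cyc:
  assumes "j \<le> length xs"
  shows "permute_list (Hilbert_Choice.inv (cyc j)) (y # xs) = ins j y xs"
proof -
  let ?ys = "ins j y xs"
  have c: "cyc j permutes {..<length ?ys}" using assms by (intro cyc_permutes) auto
  have "permute_list (cyc j) ?ys = y # xs"
    using assms by (subst permute_list_cyc) (auto simp: ins_def del_def nth_append)
  then have "permute_list (Hilbert_Choice.inv (cyc j)) (y # xs) = permute_list (Hilbert_Choice.inv (cyc j)) (permute_list (cyc j) ?ys)"
    by simp
  also have "\<dots> = permute_list (cyc j \<circ> Hilbert_Choice.inv (cyc j)) ?ys"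
    using permutes_inv[OF c] by (simp add: permute_list_compose)
  also have "\<dots> = ?ys" by (simp only: permutes_inv_o[OF c] permute_list_id)
  finally show ?thesis .
qed

text \<open>Laplace expansion along the first argument: the permutations are grouped by the slot
  \<open>k\<close> that receives \<open>y\<close>. Inverting them reduces this to the same
  factorisation, because undoing \<open>cyc k\<close> inserts the head at \<open>k\<close>.\<close>

lemma alt_sum_Cons_ins:
  "alt_sum F (y # xs) = (\<Sum>k\<le>length xs. signed (even k) (alt_sum (\<lambda>zs. F (ins k y zs)) xs))"
proof -
  let ?n = "length xs"
  let ?g = "\<lambda>\<tau>. signed (evenperm \<tau>) (F (permute_list \<tau> (y # xs)))"
  have "alt_sum F (y # xs) = (\<Sum>\<tau> | \<tau> permutes {..<Suc ?n}. ?g (Hilbert_Choice.inv \<tau>))"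
    unfolding alt_sum_def using sum_permutations_inverse[of ?g "{..<Suc ?n}"] by simp
  also have "\<dots> = (\<Sum>(j, q)\<in>{..<Suc ?n} \<times> {q. q permutes {..<?n}}. ?g (Hilbert_Choice.inv (cyc j \<circ> up q)))"
    by (subst sum.reindex_bij_betw[OF bij_betw_cyc_up, symmetric]) (simp add: case_prod_beta)
  also have "\<dots> = (\<Sum>j<Suc ?n. \<Sum>q | q permutes {..<?n}. ?g (Hilbert_Choice.inv (cyc j \<circ> up q)))"
    by (rule sum.cartesian_product[symmetric])
  also have "\<dots> = (\<Sum>j<Suc ?n. \<Sum>q | q permutes {..<?n}.
      signed (even j) (signed (evenperm (Hilbert_Choice.inv q)) (F (ins j y (permute_list (Hilbert_Choice.inv q) xs)))))"
  proof (intro sum.cong refl)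
    fix j q assume "j \<in> {..<Suc ?n}" "q \<in> {q. q permutes {..<?n}}"
    then have j: "j < Suc ?n" and q: "q permutes {..<?n}" by auto
    note c = cyc_permutes[OF j] and u = up_permutes[OF q]
    note P = permutes_lessThan_permutation
    have "evenperm (Hilbert_Choice.inv (cyc j \<circ> up q)) = (even j = evenperm (Hilbert_Choice.inv q))"
      by (simp add: evenperm_inv permutation_compose P[OF c] P[OF u] P[OF q] evenperm_comp evenperm_cyc evenperm_up[OF q])
    moreover have "Hilbert_Choice.inv (cyc j \<circ> up q) = up (Hilbert_Choice.inv q) \<circ> Hilbert_Choice.inv (cyc j)"
      using permutes_bij[OF c] permutes_bij[OF u] by (simp add: o_inv_distrib up_inv[OF q])
    then have "permute_list (Hilbert_Choice.inv (cyc j \<circ> up q)) (y # xs) = ins j y (permute_list (Hilbert_Choice.inv q) xs)"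
      using permutes_inv[OF c] j by (simp add: permute_list_compose permute_list_up permute_list_inv_cyc)
    ultimately show "?g (Hilbert_Choice.inv (cyc j \<circ> up q)) = signed (even j) (signed (evenperm (Hilbert_Choice.inv q)) (F (ins j y (permute_list (Hilbert_Choice.inv q) xs))))"
      by simp
  qed
  also have "\<dots> = (\<Sum>j<Suc ?n. signed (even j) (\<Sum>q | q permutes {..<?n}. signed (evenperm q) (F (ins j y (permute_list q xs)))))"
    by (intro sum.cong refl, subst (2) sum_permutations_inverse) (simp add: signed_sum)
  finally show ?thesis by (simp add: alt_sum_def lessThan_Suc_atMost)
qed

section \<open>Rearranging the arguments of an alternating sum\<close>

definition uncons :: "('a \<Rightarrow> 'a list \<Rightarrow> 'b) \<Rightarrow> 'a list \<Rightarrow> 'b" where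
  "uncons G xs = G (hd xs) (tl xs)"

lemma uncons_Cons [simp]: "uncons G (x # xs) = G x xs"
  by (simp add: uncons_def)

text \<open>\<open>uncons\<close> binds the leading argument as a variable, so that nested sums can
  be expanded and compared one argument at a time.\<close>

lemma alt_sum_uncons:
  assumes "xs \<noteq> []"
  shows "alt_sum (uncons G) xs = (\<Sum>j<length xs. signed (even j) (alt_sum (G (xs ! j)) (del j xs)))"
  unfolding alt_sum_rec[OF assms] by simp

lemma alt_sum_uncons_cong:
  assumes "xs \<noteq> []" "\<And>x ys. Suc (length ys) = length xs \<Longrightarrow> alt_sum (G x) ys = alt_sum (H x) ys"
  shows "alt_sum (uncons G) xs = alt_sum (uncons H) xs"
  unfolding alt_sum_uncons[OF assms(1)]
  by (intro sum.cong refl arg_cong[of _ _ "signed _"] assms) (auto simp: length_del)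

text \<open>The entry passes the \<open>m\<close> entries in front of it, and each of them costs a
  sign.\<close>

lemma alt_sum_move:
  assumes "m < length xs"
  shows "alt_sum (\<lambda>ys. G (take m ys) (ys ! m) (drop (Suc m) ys)) xs =
    signed (even m) (alt_sum (uncons (\<lambda>y ys. G (take m ys) y (drop m ys))) xs)"
proof -
  let ?F = "uncons (\<lambda>y ys. G (take m ys) y (drop m ys))"
  have "alt_sum (\<lambda>ys. G (take m ys) (ys ! m) (drop (Suc m) ys)) xs = alt_sum (\<lambda>ys. ?F (permute_list (cyc m) ys)) xs"
    using assms by (intro alt_sum_cong) (simp add: permute_list_cyc del_def)
  also have "\<dots> = signed (even m) (alt_sum ?F xs)"
    using assms by (simp add: alt_sum_compose cyc_permutes evenperm_cyc)
  finally show ?thesis .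
qed

text \<open>Both entries pass the same \<open>m\<close> entries, so the two signs cancel.\<close>

lemma alt_sum_move2:
  assumes "Suc m < length xs"
  shows "alt_sum (\<lambda>ys. G (take m ys) (ys ! m) (ys ! Suc m) (drop (Suc (Suc m)) ys)) xs =
    alt_sum (uncons (\<lambda>a. uncons (\<lambda>b ys. G (take m ys) a b (drop m ys)))) xs"
proof -
  \<comment> \<open>The second entry is read as the head of what follows slot \<open>m\<close>. Once
    the first entry has left, it stands in slot \<open>m\<close> itself, and the same move applies
    to it.\<close>
  have "alt_sum (\<lambda>ys. G (take m ys) (ys ! m) (ys ! Suc m) (drop (Suc (Suc m)) ys)) xs =
      alt_sum (\<lambda>ys. (\<lambda>u a v. G u a (hd v) (tl v)) (take m ys) (ys ! m) (drop (Suc m) ys)) xs"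
    using assms by (intro alt_sum_cong) (simp add: hd_drop_conv_nth tl_drop drop_Suc nth_tl)
  also have "\<dots> = signed (even m) (alt_sum (uncons (\<lambda>a ys. G (take m ys) a (hd (drop m ys)) (tl (drop m ys)))) xs)"
    using assms by (subst alt_sum_move) auto
  also have "alt_sum (uncons (\<lambda>a ys. G (take m ys) a (hd (drop m ys)) (tl (drop m ys)))) xs =
      alt_sum (uncons (\<lambda>a ys. signed (even m) (uncons (\<lambda>b ys. G (take m ys) a b (drop m ys)) ys))) xs"
  proof (rule alt_sum_uncons_cong)
    fix a :: 'a and ys :: "'a list" assume "Suc (length ys) = length xs"
    then have m: "m < length ys" using assms by simp
    have "alt_sum (\<lambda>ys. G (take m ys) a (hd (drop m ys)) (tl (drop m ys))) ys =
      alt_sum (\<lambda>ys. G (take m ys) a (ys ! m) (drop (Suc m) ys)) ys"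
      using m by (intro alt_sum_cong) (simp add: hd_drop_conv_nth tl_drop drop_Suc nth_tl)
    also have "\<dots> = alt_sum (\<lambda>ys. signed (even m) (uncons (\<lambda>b ys. G (take m ys) a b (drop m ys)) ys)) ys"
      using m by (subst alt_sum_move) (auto simp: alt_sum_signed)
    finally show "alt_sum (\<lambda>ys. G (take m ys) a (hd (drop m ys)) (tl (drop m ys))) ys =
      alt_sum (\<lambda>ys. signed (even m) (uncons (\<lambda>b ys. G (take m ys) a b (drop m ys)) ys)) ys" .
  qed (use assms in auto)
  also have "uncons (\<lambda>a ys. signed (even m) (uncons (\<lambda>b ys. G (take m ys) a b (drop m ys)) ys)) =
     (\<lambda>ys. signed (even m) (uncons (\<lambda>a. uncons (\<lambda>b ys. G (take m ys) a b (drop m ys))) ys))"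
    by (simp add: uncons_def fun_eq_iff)
  finally show ?thesis by (simp add: alt_sum_signed)
qed

lemma length_ge_2: "2 \<le> length ys \<Longrightarrow> \<exists>a b r. ys = a # b # r"
  and length_ge_3: "3 \<le> length ys \<Longrightarrow> \<exists>a b c r. ys = a # b # c # r"
  by (auto simp: Suc_le_length_iff numeral_3_eq_3 numeral_2_eq_2)

lemma alt_sum_cong_2:
  assumes "2 \<le> length xs" "\<And>a b ys. length (a # b # ys) = length xs \<Longrightarrow> F (a # b # ys) = G (a # b # ys)"
  shows "alt_sum F xs = alt_sum G xs"
  using assms(1) by (intro alt_sum_cong) (metis assms(2) length_ge_2)

lemma alt_sum_cong_3:
  assumes "3 \<le> length xs" "\<And>a b c ys. length (a # b # c # ys) = length xs \<Longrightarrow> F (a # b # c # ys) = G (a # b # c # ys)"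
  shows "alt_sum F xs = alt_sum G xs"
  using assms(1) by (intro alt_sum_cong) (metis assms(2) length_ge_3)

text \<open>A cyclic shift of three arguments is even: it is a block of two passing over
  one.\<close>

lemma alt_sum_rotate3:
  assumes "3 \<le> length xs"
  shows "alt_sum (uncons (\<lambda>a. uncons (\<lambda>b. uncons (\<lambda>c. G b c a)))) xs = alt_sum (uncons (\<lambda>a. uncons (\<lambda>b. uncons (G a b)))) xs"
proof -
  have "alt_sum (uncons (\<lambda>a. uncons (\<lambda>b. uncons (\<lambda>c. G b c a)))) xs =
     alt_sum (\<lambda>ys. (\<lambda>u b c v. G b c (hd u) v) (take 1 ys) (ys ! 1) (ys ! Suc 1) (drop (Suc (Suc 1)) ys)) xs"
    using assms by (intro alt_sum_cong_3) auto
  also have "\<dots> = alt_sum (uncons (\<lambda>b. uncons (\<lambda>c ys. G b c (hd (take 1 ys)) (drop 1 ys)))) xs"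
    using assms by (subst alt_sum_move2) auto
  also have "\<dots> = alt_sum (uncons (\<lambda>a. uncons (\<lambda>b. uncons (G a b)))) xs"
    using assms by (intro alt_sum_cong_3) auto
  finally show ?thesis .
qed

lemma alt_sum_swap2:
  assumes "2 \<le> length xs"
  shows "alt_sum (uncons (\<lambda>a. uncons (\<lambda>b. G b a))) xs = - alt_sum (uncons (\<lambda>a. uncons (G a))) xs"
proof -
  have "alt_sum (uncons (\<lambda>a. uncons (\<lambda>b. G b a))) xs =
     alt_sum (\<lambda>ys. (\<lambda>u b v. G b (hd u) v) (take 1 ys) (ys ! 1) (drop (Suc 1) ys)) xs"
    using assms by (intro alt_sum_cong_2) auto
  also have "\<dots> = - alt_sum (uncons (\<lambda>b ys. G b (hd (take 1 ys)) (drop 1 ys))) xs"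
    using assms by (subst alt_sum_move) auto
  also have "alt_sum (uncons (\<lambda>b ys. G b (hd (take 1 ys)) (drop 1 ys))) xs = alt_sum (uncons (\<lambda>a. uncons (G a))) xs"
    using assms by (intro alt_sum_cong_2) auto
  finally show ?thesis .
qed

text \<open>Every permutation contributes the same value, as the two signs cancel. The factor n! is
  written as a sum of a constant because there are no scalars here.\<close>

lemma alt_sum_alt_sum:
  "alt_sum (alt_sum F) xs = (\<Sum>\<tau> | \<tau> permutes {..<length xs}. alt_sum F xs)"
  unfolding alt_sum_def[of "alt_sum F"]
  by (intro sum.cong refl) (simp add: alt_sum_permute_list)

text \<open>Exchanging two equal arguments fixes the list and flips the sign, so twice the sum is
  zero.\<close>

lemma alt_sum_not_distinct:
  assumes nd: "\<not> distinct xs" and tor: "\<And>v::'b::ab_group_add. v + v = 0 \<Longrightarrow> v = 0"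
  shows "alt_sum F xs = (0::'b)"
proof -
  obtain i j where ij: "i < length xs" "j < length xs" "i \<noteq> j" "xs ! i = xs ! j"
    using nd by (auto simp: distinct_conv_nth)
  let ?\<rho> = "Transposition.transpose i j"
  have \<rho>: "?\<rho> permutes {..<length xs}" using ij by (intro permutes_swap_id) auto
  have "permute_list ?\<rho> xs = xs"
    using ij by (intro nth_equalityI)
      (auto simp: permute_list_nth[OF \<rho>] Transposition.transpose_def)
  then have "alt_sum F xs = - alt_sum F xs"
    using alt_sum_permute_list[OF \<rho>, of F] ij by (simp add: evenperm_swap)
  then have "alt_sum F xs + alt_sum F xs = 0" by (simp only: eq_neg_iff_add_eq_0)
  then show ?thesis by (rule tor)
qed

text \<open>Antisymmetrising the later arguments beforehand only multiplies the total by the number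
  of their permutations. This cancels the factor 1/q! of a wedge product whose second factor is
  already an alternating sum.\<close>

lemma alt_sum_uncons_absorb:
  assumes "xs \<noteq> []"
  shows "alt_sum (uncons (\<lambda>x. alt_sum (G x))) xs =
    (\<Sum>\<tau> | \<tau> permutes {..<length xs - 1}. alt_sum (uncons G) xs)"
proof -
  have "alt_sum (uncons (\<lambda>x. alt_sum (G x))) xs =
    alt_sum (uncons (\<lambda>x ys. \<Sum>\<tau> | \<tau> permutes {..<length xs - 1}. G x ys)) xs"
  proof (rule alt_sum_uncons_cong[OF assms])
    fix x :: 'a and ys :: "'a list" assume "Suc (length ys) = length xs"
    then have *: "length xs - 1 = length ys" by simp
    show "alt_sum (alt_sum (G x)) ys = alt_sum (\<lambda>ys. \<Sum>\<tau> | \<tau> permutes {..<length xs - 1}. G x ys) ys"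
      by (simp only: * alt_sum_alt_sum alt_sum_sum)
  qed
  also have "uncons (\<lambda>x ys. \<Sum>\<tau> | \<tau> permutes {..<length xs - 1}. G x ys) =
      (\<lambda>ys. \<Sum>\<tau> | \<tau> permutes {..<length xs - 1}. uncons G ys)"
    by (simp add: uncons_def fun_eq_iff)
  finally show ?thesis by (simp add: alt_sum_sum)
qed

lemma alt_sum_uncons2_absorb:
  assumes "2 \<le> length xs"
  shows "alt_sum (uncons (\<lambda>x. uncons (\<lambda>y. alt_sum (G x y)))) xs =
    (\<Sum>\<tau> | \<tau> permutes {..<length xs - 2}. alt_sum (uncons (\<lambda>x. uncons (G x))) xs)"
proof -
  have "alt_sum (uncons (\<lambda>x. uncons (\<lambda>y. alt_sum (G x y)))) xs =
    alt_sum (uncons (\<lambda>x ys. \<Sum>\<tau> | \<tau> permutes {..<length xs - 2}. uncons (G x) ys)) xs"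
  proof (rule alt_sum_uncons_cong)
    fix x :: 'a and ys :: "'a list" assume "Suc (length ys) = length xs"
    then have *: "ys \<noteq> []" "length ys - 1 = length xs - 2" using assms by auto
    show "alt_sum (uncons (\<lambda>y. alt_sum (G x y))) ys =
      alt_sum (\<lambda>ys. \<Sum>\<tau> | \<tau> permutes {..<length xs - 2}. uncons (G x) ys) ys"
      unfolding alt_sum_uncons_absorb[OF *(1)] alt_sum_sum *(2) ..
  qed (use assms in auto)
  also have "uncons (\<lambda>x ys. \<Sum>\<tau> | \<tau> permutes {..<length xs - 2}. uncons (G x) ys) =
      (\<lambda>ys. \<Sum>\<tau> | \<tau> permutes {..<length xs - 2}. uncons (\<lambda>x. uncons (G x)) ys)"
    by (simp add: uncons_def fun_eq_iff)
  finally show ?thesis by (simp add: alt_sum_sum)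
qed

section \<open>Deleted entries and sums over pairs of arguments\<close>

lemma nths_Compl_singleton: "nths xs (- {j}) = del j xs"
proof (induction xs arbitrary: j)
  case (Cons x xs)
  have "{k. Suc k \<in> - {j}} = (case j of 0 \<Rightarrow> UNIV | Suc i \<Rightarrow> - {i})"
    by (auto split: nat.splits)
  with Cons show ?case by (cases j) (simp_all add: nths_Cons del_def nths_all)
qed (simp add: del_def)

lemma nths_Compl_doubleton:
  "i < j \<Longrightarrow> nths xs (- {i, j}) = del i (del j xs)"
proof (induction xs arbitrary: i j)
  case (Cons x xs)
  then obtain j' where j: "j = Suc j'" by (cases j) auto
  have "{k. Suc k \<in> - {i, j}} = (case i of 0 \<Rightarrow> - {j'} | Suc i' \<Rightarrow> - {i', j'})"
    by (auto split: nat.splits simp: j)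
  with Cons show ?case
    by (cases i) (simp_all add: nths_Cons nths_Compl_singleton j, simp_all add: del_def)
qed (simp add: del_def)

text \<open>The simplicial identity for face maps.\<close>

lemma del_del: "j \<le> k \<Longrightarrow> del k (del j xs) = del j (del (Suc k) xs)"
proof (induction xs arbitrary: j k)
  case (Cons x xs)
  then show ?case by (cases j; cases k) (auto simp: del_def)
qed (simp add: del_def)

text \<open>Expanding two slots runs over ordered pairs of distinct arguments, while the bracket sum
  of the differential runs over i < j. Antisymmetry of \<open>H\<close> makes both orders contribute
  equally, hence the two copies of \<open>S\<close>. The minus sign arises because the first
  deletion shifts the index of the larger argument by one.\<close>

lemma alt_sum_uncons2_pairs:
  fixes H :: "'a \<Rightarrow> 'a \<Rightarrow> 'a list \<Rightarrow> 'b::ab_group_add"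
  assumes anti: "\<And>x y zs. Suc (Suc (length zs)) = length xs \<Longrightarrow> H y x zs = - H x y zs"
  defines "S \<equiv> (\<Sum>(i, j)\<in>{(i, j). i < j \<and> j < length xs}.
      signed (even (i + j)) (alt_sum (H (xs ! i) (xs ! j)) (nths xs (- {i, j}))))"
  assumes len: "2 \<le> length xs"
  shows "alt_sum (uncons (\<lambda>x. uncons (H x))) xs = - (S + S)"
proof -
  let ?n = "length xs"
  define T where "T i j = signed (even (i + j)) (alt_sum (H (xs ! i) (xs ! j)) (nths xs (- {i, j})))" for i j
  have inner: "signed (even j) (alt_sum (uncons (H (xs ! j))) (del j xs)) =
      - (\<Sum>k<j. T k j) - (\<Sum>k\<in>{Suc j..<?n}. T j k)" if j: "j < ?n" for j
  proof -
    have ld: "length (del j xs) = ?n - 1" using j by (simp add: length_del)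
    then have ne: "del j xs \<noteq> []" using len by auto
    let ?s = "\<lambda>k. signed (even j) (signed (even k) (alt_sum (H (xs ! j) (del j xs ! k)) (del k (del j xs))))"
    \<comment> \<open>An index below \<open>j\<close> survives the deletion unchanged, but the pair
      is in the wrong order; antisymmetry supplies the minus.\<close>
    have less: "?s k = - T k j" if k: "k < j" for k
    proof -
      have "alt_sum (H (xs ! j) (xs ! k)) (del k (del j xs)) = alt_sum (\<lambda>zs. - H (xs ! k) (xs ! j) zs) (del k (del j xs))"
        using k j by (intro alt_sum_cong anti) (simp add: length_del)
      moreover have "del j xs ! k = xs ! k" using k j by (simp add: del_def nth_append)
      ultimately show ?thesis
        using k by (auto simp: T_def alt_sum_minus nths_Compl_doubleton signed_def)
    qed
    \<comment> \<open>Here the pair is in order, and the minus is the parity of the shift from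
      \<open>k\<close> to \<open>Suc k\<close>.\<close>
    have ge: "?s k = - T j (Suc k)" if k: "j \<le> k" "Suc k < ?n" for k
    proof -
      have "del k (del j xs) = nths xs (- {j, Suc k})"
        using k by (simp add: nths_Compl_doubleton del_del)
      moreover have "del j xs ! k = xs ! Suc k" using k j by (simp add: del_def nth_append)
      ultimately show ?thesis
        using k by (auto simp: T_def signed_def)
    qed
    have "signed (even j) (alt_sum (uncons (H (xs ! j))) (del j xs)) = (\<Sum>k<?n - 1. ?s k)"
      unfolding alt_sum_uncons[OF ne] by (simp add: signed_sum ld)
    also have "\<dots> = (\<Sum>k<j. ?s k) + (\<Sum>k\<in>{j..<?n - 1}. ?s k)"
      using j len by (subst sum.union_disjoint[symmetric]) (auto intro!: sum.cong simp: ivl_disj_un)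
    also have "(\<Sum>k<j. ?s k) = - (\<Sum>k<j. T k j)"
      by (simp only: sum_negf[symmetric]) (intro sum.cong refl less, simp)
    also have "(\<Sum>k\<in>{j..<?n - 1}. ?s k) = (\<Sum>k\<in>{j..<?n - 1}. - T j (Suc k))"
      by (intro sum.cong refl ge) auto
    also have "\<dots> = - (\<Sum>k\<in>{Suc j..<?n}. T j k)"
    proof -
      have "Suc (?n - 1) = ?n" using len by linarith
      then have "{Suc j..<?n} = {Suc j..<Suc (?n - 1)}" by (simp only:)
      then show ?thesis by (simp only: sum_negf sum.shift_bounds_Suc_ivl)
    qed
    finally show ?thesis by simp
  qed
  \<comment> \<open>The pairs are grouped once by their larger and once by their smaller index, to
    match the two inner sums.\<close>
  have S1: "S = (\<Sum>j<?n. \<Sum>k<j. T k j)"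
  proof -
    have "(\<Sum>j<?n. \<Sum>k<j. T k j) = (\<Sum>(j, k)\<in>Sigma {..<?n} (\<lambda>j. {..<j}). T k j)"
      by (rule sum.Sigma) auto
    also have "\<dots> = S" unfolding S_def T_def
      by (rule sum.reindex_bij_witness[of _ "\<lambda>(i, j). (j, i)" "\<lambda>(i, j). (j, i)"]) auto
    finally show ?thesis by simp
  qed
  have S2: "S = (\<Sum>j<?n. \<Sum>k\<in>{Suc j..<?n}. T j k)"
  proof -
    have "(\<Sum>j<?n. \<Sum>k\<in>{Suc j..<?n}. T j k) = (\<Sum>(j, k)\<in>Sigma {..<?n} (\<lambda>j. {Suc j..<?n}). T j k)"
      by (rule sum.Sigma) auto
    also have "\<dots> = S" unfolding S_def T_def
      by (rule sum.cong) auto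
    finally show ?thesis by simp
  qed
  have "alt_sum (uncons (\<lambda>x. uncons (H x))) xs = (\<Sum>j<?n. - (\<Sum>k<j. T k j) - (\<Sum>k\<in>{Suc j..<?n}. T j k))"
    using len by (subst alt_sum_uncons) (auto intro!: sum.cong inner)
  also have "\<dots> = - (S + S)"
    by (subst S1, subst S2) (simp add: sum_subtractf sum_negf)
  finally show ?thesis .
qed

section \<open>The differential of an alternating sum\<close>

lemma module_scale_signs:
  assumes "vector_space s"
  shows "s ((-1) ^ j) v = signed (even j) v"
proof -
  interpret vector_space s by fact
  show ?thesis by (cases "even j") (simp_all add: signed_def)
qed

text \<open>The bracket part of the differential, doubled because only the sum over both orders of the
  two bracketed arguments is an alternating sum.\<close>

lemma ce_diff_alt_sum:
  fixes L :: "('k::field, 'g::ab_group_add) lie_alg" and V :: "('k, 'g, 'v::ab_group_add) lie_mod"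
  assumes V: "vector_space (mscale V)"
    and act: "\<And>x v w. mact V x (v + w) = mact V x v + mact V x w"
    and anti: "\<And>x y. lbr L y x = - lbr L x y"
    and len: "length xs = Suc n"
    and \<omega>: "\<And>ys. length ys = n \<Longrightarrow> \<omega> ys = alt_sum F ys"
    and F: "\<And>k y zs. k < n \<Longrightarrow> Suc (length zs) = n \<Longrightarrow> F (ins k (- y) zs) = - F (ins k y zs)"
  shows "ce_diff L V \<omega> xs + ce_diff L V \<omega> xs =
    alt_sum (uncons (\<lambda>x ys. mact V x (F ys))) xs + alt_sum (uncons (\<lambda>x ys. mact V x (F ys))) xs -
    (\<Sum>k<n. signed (even k) (alt_sum (uncons (\<lambda>x. uncons (\<lambda>y zs. F (ins k (lbr L x y) zs)))) xs))"
proof -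
  define A where "A = (\<Sum>j<length xs. mscale V ((-1) ^ j) (mact V (xs ! j) (\<omega> (nths xs (- {j})))))"
  define P where "P = {(i, j). i < j \<and> j < length xs}"
  define S where "S = (\<Sum>(i, j)\<in>P.
        mscale V ((-1) ^ (i + j)) (\<omega> (lbr L (xs ! i) (xs ! j) # nths xs (- {i, j}))))"
  define S' where "S' k = (\<Sum>(i, j)\<in>P. signed (even (i + j)) (alt_sum (\<lambda>zs. F (ins k (lbr L (xs ! i) (xs ! j)) zs)) (nths xs (- {i, j}))))" for k
  have A: "A = alt_sum (uncons (\<lambda>x ys. mact V x (F ys))) xs"
  proof -
    have "A = (\<Sum>j<length xs. signed (even j) (alt_sum (\<lambda>ys. mact V (xs ! j) (F ys)) (del j xs)))"
      unfolding A_def nths_Compl_singleton module_scale_signs[OF V]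
      by (intro sum.cong refl) (simp add: \<omega> len length_del additive_alt_sum[of "mact V _", OF act])
    also have "\<dots> = alt_sum (uncons (\<lambda>x ys. mact V x (F ys))) xs"
      using len by (subst alt_sum_uncons) auto
    finally show ?thesis .
  qed
  \<comment> \<open>The bracket is the first argument of \<omega>; expansion along that argument
    distributes it over the slots \<open>k\<close> of \<open>F\<close>.\<close>
  have S: "S = (\<Sum>k<n. signed (even k) (S' k))"
  proof -
    have "S = (\<Sum>(i, j)\<in>P. \<Sum>k<n. signed (even k) (signed (even (i + j)) (alt_sum (\<lambda>zs. F (ins k (lbr L (xs ! i) (xs ! j)) zs)) (nths xs (- {i, j})))))"
      unfolding S_def
    proof (intro sum.cong refl, clarify)
      fix i j assume "(i, j) \<in> P"
      then have ij: "i < j" "j < Suc n" by (auto simp: P_def len)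
      then have l: "length (nths xs (- {i, j})) = n - 1"
        by (simp add: nths_Compl_doubleton length_del len)
      have n: "{..n - 1} = {..<n}" using ij by auto
      have "mscale V ((-1) ^ (i + j)) (\<omega> (lbr L (xs ! i) (xs ! j) # nths xs (- {i, j}))) =
        signed (even (i + j)) (alt_sum F (lbr L (xs ! i) (xs ! j) # nths xs (- {i, j})))"
        using ij l by (simp add: module_scale_signs[OF V] \<omega>)
      also have "\<dots> = (\<Sum>k<n. signed (even (i + j)) (signed (even k) (alt_sum (\<lambda>zs. F (ins k (lbr L (xs ! i) (xs ! j)) zs)) (nths xs (- {i, j})))))"
        unfolding alt_sum_Cons_ins l n signed_sum ..
      also have "\<dots> = (\<Sum>k<n. signed (even k) (signed (even (i + j)) (alt_sum (\<lambda>zs. F (ins k (lbr L (xs ! i) (xs ! j)) zs)) (nths xs (- {i, j})))))"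
        by (intro sum.cong refl) (auto simp: signed_def)
      finally show "mscale V ((-1) ^ (i + j)) (\<omega> (lbr L (xs ! i) (xs ! j) # nths xs (- {i, j}))) =
         (\<Sum>k<n. signed (even k) (signed (even (i + j)) (alt_sum (\<lambda>zs. F (ins k (lbr L (xs ! i) (xs ! j)) zs)) (nths xs (- {i, j})))))" .
    qed
    also have "\<dots> = (\<Sum>k<n. \<Sum>(i, j)\<in>P. signed (even k) (signed (even (i + j)) (alt_sum (\<lambda>zs. F (ins k (lbr L (xs ! i) (xs ! j)) zs)) (nths xs (- {i, j})))))"
      unfolding case_prod_beta by (rule sum.swap)
    finally show ?thesis by (simp add: S'_def signed_sum case_prod_beta)
  qed
  have "alt_sum (uncons (\<lambda>x. uncons (\<lambda>y zs. F (ins k (lbr L x y) zs)))) xs = - (S' k + S' k)" if k: "k < n" for k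
    unfolding S'_def P_def
  proof (rule alt_sum_uncons2_pairs)
    fix x y and zs :: "'g list" assume "Suc (Suc (length zs)) = length xs"
    then show "F (ins k (lbr L y x) zs) = - F (ins k (lbr L x y) zs)"
      using k len by (subst anti) (simp add: F)
  qed (use k len in auto)
  then have "(\<Sum>k<n. signed (even k) (alt_sum (uncons (\<lambda>x. uncons (\<lambda>y zs. F (ins k (lbr L x y) zs)))) xs)) =
     (\<Sum>k<n. signed (even k) (- (S' k + S' k)))"
    by (intro sum.cong refl) simp
  also have "\<dots> = - (S + S)"
    by (simp add: S sum_negf[symmetric] sum.distrib[symmetric] signed_add signed_minus signed_diff)
  finally have "(\<Sum>k<n. signed (even k) (alt_sum (uncons (\<lambda>x. uncons (\<lambda>y zs. F (ins k (lbr L x y) zs)))) xs)) = - (S + S)" .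
  moreover have "ce_diff L V \<omega> xs = A + S"
    by (simp add: ce_diff_def A_def S_def P_def)
  ultimately show ?thesis by (simp add: A[symmetric])
qed

section \<open>Alternating sums over pairs of arguments\<close>

fun pairs :: "('a \<Rightarrow> 'a \<Rightarrow> 'n) \<Rightarrow> 'a list \<Rightarrow> 'n list" where
  "pairs R (x # y # zs) = R x y # pairs R zs"
| "pairs R _ = []"

lemma length_pairs [simp]: "length (pairs R xs) = length xs div 2"
  by (induction R xs rule: pairs.induct) auto

lemma pairs_append: "even (length us) \<Longrightarrow> pairs R (us @ vs) = pairs R us @ pairs R vs"
  by (induction R us rule: pairs.induct) auto

lemma take_pairs: "take i (pairs R xs) = pairs R (take (2 * i) xs)"
proof (induction R xs arbitrary: i rule: pairs.induct)
  case (1 R x y zs)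
  then show ?case by (cases i) auto
qed (simp_all add: take_Cons split: nat.split)

lemma drop_pairs: "drop i (pairs R xs) = pairs R (drop (2 * i) xs)"
proof (induction R xs arbitrary: i rule: pairs.induct)
  case (1 R x y zs)
  then show ?case by (cases i) auto
qed (simp_all add: drop_Cons split: nat.split)

lemma nth_pairs: "2 * i + 1 < length xs \<Longrightarrow> pairs R xs ! i = R (xs ! (2 * i)) (xs ! (2 * i + 1))"
proof (induction R xs arbitrary: i rule: pairs.induct)
  case (1 R x y zs)
  then show ?case by (cases i) auto
qed simp_all

text \<open>A block of two arguments moves to the front without a sign, and a symmetric function does
  not see the move.\<close>

lemma alt_sum_pairs_block:
  fixes xs :: "'a list"
  assumes sym: "\<And>us vs. mset us = mset vs \<Longrightarrow> f us = f vs"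
    and i: "2 * i + 1 < length xs"
  shows "alt_sum (\<lambda>ys. f ((pairs R ys)[i := S (ys ! (2 * i)) (ys ! (2 * i + 1))])) xs =
    alt_sum (uncons (\<lambda>a. uncons (\<lambda>b ys. f (S a b # pairs R ys)))) xs"
proof -
  let ?G = "\<lambda>u a b v. f (pairs R u @ S a b # pairs R v)"
  have "alt_sum (\<lambda>ys. f ((pairs R ys)[i := S (ys ! (2 * i)) (ys ! (2 * i + 1))])) xs =
    alt_sum (\<lambda>ys. ?G (take (2 * i) ys) (ys ! (2 * i)) (ys ! Suc (2 * i)) (drop (Suc (Suc (2 * i))) ys)) xs"
    using i by (intro alt_sum_cong) (simp add: upd_conv_take_nth_drop take_pairs drop_pairs)
  also have "\<dots> = alt_sum (uncons (\<lambda>a. uncons (\<lambda>b ys. ?G (take (2 * i) ys) a b (drop (2 * i) ys)))) xs"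
    using i by (intro alt_sum_move2) simp
  also have "\<dots> = alt_sum (uncons (\<lambda>a. uncons (\<lambda>b ys. f (S a b # pairs R ys)))) xs"
  proof (rule alt_sum_cong_2)
    fix a b and ys :: "'a list"
    have "mset (pairs R (take (2 * i) ys) @ pairs R (drop (2 * i) ys)) = mset (pairs R ys)"
      by (simp only: take_pairs[symmetric] drop_pairs[symmetric] append_take_drop_id)
    then show "uncons (\<lambda>a. uncons (\<lambda>b ys. ?G (take (2 * i) ys) a b (drop (2 * i) ys))) (a # b # ys) =
       uncons (\<lambda>a. uncons (\<lambda>b ys. f (S a b # pairs R ys))) (a # b # ys)"
      by (auto intro!: sym)
  qed (use i in auto)
  finally show ?thesis .
qed

text \<open>Slot \<open>k\<close> belongs to block \<open>k div 2\<close>. For odd \<open>k\<close>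
  the inserted vector comes second in its block, and antisymmetry of \<open>R\<close> pays for the
  sign (-1)^k. Its partner stands at the even position \<open>2 * i\<close> and reaches the front
  for free.\<close>

lemma alt_sum_pairs_ins:
  fixes f :: "'n::ab_group_add list \<Rightarrow> 'v::ab_group_add" and ws :: "'a list"
  assumes sym: "\<And>us vs. mset us = mset vs \<Longrightarrow> f us = f vs"
    and neg: "\<And>a us. Suc (length us) = p \<Longrightarrow> f (- a # us) = - f (a # us)"
    and R: "\<And>x y. R y x = - R x y"
    and len: "Suc (length ws) = 2 * p" and k: "k < 2 * p"
  shows "signed (even k) (alt_sum (\<lambda>ys. f (pairs R (ins k y ys))) ws) =
    alt_sum (uncons (\<lambda>w ys. f (R y w # pairs R ys))) ws"
proof -
  define i where "i = k div 2"
  have i: "2 * i < length ws" using k len unfolding i_def by presburger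
  let ?G = "\<lambda>u w v. f (pairs R u @ R y w # pairs R v)"
  have ws: "ys = take (2 * i) ys @ ys ! (2 * i) # drop (Suc (2 * i)) ys" if "length ys = length ws" for ys :: "'a list"
    using that i by (simp add: id_take_nth_drop)
  have step: "f (pairs R (ins k y ys)) = signed (even k) (?G (take (2 * i) ys) (ys ! (2 * i)) (drop (Suc (2 * i)) ys))"
    if l: "length ys = length ws" for ys
  proof -
    let ?u = "take (2 * i) ys" and ?w = "ys ! (2 * i)" and ?v = "drop (Suc (2 * i)) ys"
    have eu: "even (length ?u)" using l i by (simp add: min_def)
    show ?thesis
    proof (cases "even k")
      case True
      then have "k = 2 * i" by (simp add: i_def)
      then have "ins k y ys = ?u @ y # ?w # ?v"
        using l i by (simp add: ins_def Cons_nth_drop_Suc)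
      with True eu show ?thesis by (simp add: pairs_append)
    next
      case False
      then have "k = Suc (2 * i)" by (simp add: i_def)
      then have "ins k y ys = ?u @ ?w # y # ?v"
        using l i by (simp add: ins_def take_Suc_conv_app_nth)
      then have "f (pairs R (ins k y ys)) = f (pairs R ?u @ - R y ?w # pairs R ?v)"
        using eu R[of y "ys ! (2 * i)"] by (simp add: pairs_append)
      also have "\<dots> = f (- R y ?w # pairs R ?u @ pairs R ?v)"
        by (rule sym) simp
      also have "\<dots> = - f (R y ?w # pairs R ?u @ pairs R ?v)"
      proof (rule neg)
        have "even (length ?v)" using l i len by (simp, presburger)
        moreover have "length ?u + length ?v + 2 = 2 * p" using l i len by (simp add: min_def)
        ultimately show "Suc (length (pairs R ?u @ pairs R ?v)) = p" using eu by (auto elim!: evenE)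
      qed
      also have "f (R y ?w # pairs R ?u @ pairs R ?v) = f (pairs R ?u @ R y ?w # pairs R ?v)"
        by (rule sym) simp
      finally show ?thesis using False by simp
    qed
  qed
  have "signed (even k) (alt_sum (\<lambda>ys. f (pairs R (ins k y ys))) ws) =
    alt_sum (\<lambda>ys. ?G (take (2 * i) ys) (ys ! (2 * i)) (drop (Suc (2 * i)) ys)) ws"
    unfolding alt_sum_signed[symmetric] by (intro alt_sum_cong) (simp add: step)
  also have "\<dots> = alt_sum (uncons (\<lambda>w ys. ?G (take (2 * i) ys) w (drop (2 * i) ys))) ws"
    using i by (subst alt_sum_move) auto
  also have "\<dots> = alt_sum (uncons (\<lambda>w ys. f (R y w # pairs R ys))) ws"
  proof (rule alt_sum_uncons_cong)
    fix w and ys :: "'a list"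
    have "mset (pairs R (take (2 * i) ys) @ pairs R (drop (2 * i) ys)) = mset (pairs R ys)" for ys
      by (simp only: take_pairs[symmetric] drop_pairs[symmetric] append_take_drop_id)
    then show "alt_sum (\<lambda>ys. ?G (take (2 * i) ys) w (drop (2 * i) ys)) ys = alt_sum (\<lambda>ys. f (R y w # pairs R ys)) ys"
      by (intro alt_sum_cong sym) simp
  qed (use i in auto)
  finally show ?thesis .
qed

text \<open>Rotating three arguments leaves an alternating sum unchanged, so three times the sum is
  the alternating sum of \<open>g\<close> applied to the cyclic sum of \<open>B\<close>.\<close>

lemma alt_sum_cyclic_vanish:
  fixes g :: "'n::ab_group_add \<Rightarrow> 'a list \<Rightarrow> 'v::ab_group_add"
  assumes add: "\<And>a b us. length us + 3 = length xs \<Longrightarrow> g (a + b) us = g a us + g b us"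
    and B: "\<And>x a b. B x a b + B a b x + B b x a = 0"
    and tor: "\<And>v::'v. v + v + v = 0 \<Longrightarrow> v = 0"
    and len: "3 \<le> length xs"
  shows "alt_sum (uncons (\<lambda>x. uncons (\<lambda>a. uncons (\<lambda>b. g (B x a b))))) xs = 0"
proof (rule tor)
  let ?A = "\<lambda>B. alt_sum (uncons (\<lambda>x. uncons (\<lambda>a. uncons (\<lambda>b. g (B x a b))))) xs"
  have r1: "?A (\<lambda>x a b. B a b x) = ?A B"
    by (rule alt_sum_rotate3[OF len, where G = "\<lambda>x a b. g (B x a b)"])
  have r2: "?A (\<lambda>x a b. B b x a) = ?A (\<lambda>x a b. B a b x)"
    by (rule alt_sum_rotate3[OF len, where G = "\<lambda>x a b. g (B a b x)"])
  have "?A B + ?A B + ?A B = ?A B + ?A (\<lambda>x a b. B a b x) + ?A (\<lambda>x a b. B b x a)"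
    by (simp only: r1 r2)
  also have "\<dots> = ?A (\<lambda>x a b. B x a b + B a b x + B b x a)"
    unfolding alt_sum_add[symmetric] using len by (intro alt_sum_cong_3) (simp_all add: add)
  also have "\<dots> = alt_sum (\<lambda>ys. 0) xs"
    unfolding B using len
  proof (intro alt_sum_cong_3)
    fix a b c and ys :: "'a list" assume "length (a # b # c # ys) = length xs"
    then show "uncons (\<lambda>x. uncons (\<lambda>a. uncons (\<lambda>b. g 0))) (a # b # c # ys) = 0"
      using add[of ys 0 0] by simp
  qed
  finally show "?A B + ?A B + ?A B = 0" by simp
qed


section \<open>The Leibniz rule\<close>

lemma sum_const_add_self:
  "(\<Sum>x\<in>A. v) + (\<Sum>x\<in>A. v) = (\<Sum>x<2 * card A. v)" if "finite A"
  using that by (induction A rule: finite_induct) (simp_all add: algebra_simps)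

lemma sum_lessThan_add: "(\<Sum>i<r + q. g i) = (\<Sum>i<r. g i) + (\<Sum>i<q. g (r + i))"
  for g :: "nat \<Rightarrow> 'b::comm_monoid_add"
  by (induction q) (simp_all add: add.assoc)

text \<open>The data at one fixed section: \<open>R\<close> is its curvature and \<open>D\<close>
  the covariant derivative on the kernel. Of \<open>f\<close> only symmetry, additivity and
  equivariance enter, so the constants 1/2^p and 1/2^m can be absorbed into \<open>f\<close> when
  the locale is interpreted.\<close>

locale equivariant_curvature =
  fixes L :: "('k::field, 'g::ab_group_add) lie_alg" and V :: "('k, 'g, 'v::ab_group_add) lie_mod"
    and R :: "'g \<Rightarrow> 'g \<Rightarrow> 'n::ab_group_add" and D :: "'g \<Rightarrow> 'n \<Rightarrow> 'n"
    and p :: nat and f :: "'n list \<Rightarrow> 'v"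
  assumes V: "vector_space (mscale V)"
    and act_add: "mact V x (v + w) = mact V x v + mact V x w"
    and lbr_anti: "lbr L y x = - lbr L x y"
    and R_add: "R (x + y) z = R x z + R y z"
    and R_anti: "R y x = - R x y"
    and f_sym: "mset us = mset vs \<Longrightarrow> f us = f vs"
    and f_add: "Suc (length us) = p \<Longrightarrow> f ((c + d) # us) = f (c # us) + f (d # us)"
    and f_inv: "length us = p \<Longrightarrow> mact V x (f us) = (\<Sum>i<p. f (us[i := D x (us ! i)]))"
    and bianchi: "D x (R a b) + D a (R b x) + D b (R x a) =
      R (lbr L x a) b + R (lbr L a b) x + R (lbr L b x) a"
    and tor2: "(v::'v) + v = 0 \<Longrightarrow> v = 0"
    and tor3: "(v::'v) + v + v = 0 \<Longrightarrow> v = 0"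
begin

lemma f_zero: "Suc (length us) = p \<Longrightarrow> f (0 # us) = 0"
  using f_add[of us 0 0] by simp

lemma f_neg: "Suc (length us) = p \<Longrightarrow> f (- a # us) = - f (a # us)"
  using f_add[of us a "- a"] f_zero[of us] by (simp add: eq_neg_iff_add_eq_0 add.commute)

lemma f_diff: "Suc (length us) = p \<Longrightarrow> f ((a - b) # us) = f (a # us) - f (b # us)"
  using f_add[of us a "- b"] f_neg[of us b] by simp

lemma f_neg_middle:
  assumes "Suc (length us + length vs) = p"
  shows "f (us @ - a # vs) = - f (us @ a # vs)"
proof -
  have "f (us @ - a # vs) = f (- a # us @ vs)" by (rule f_sym) simp
  also have "\<dots> = - f (a # us @ vs)" using assms by (intro f_neg) simp
  also have "f (a # us @ vs) = f (us @ a # vs)" by (rule f_sym) simp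
  finally show ?thesis .
qed

lemma R_neg: "R (- x) y = - R x y"
proof -
  have "R 0 y = 0" using R_add[of 0 0 y] by simp
  then show ?thesis using R_add[of x "- x" y] by (simp add: eq_neg_iff_add_eq_0 add.commute)
qed

lemma R_neg_right: "R x (- y) = - R x y"
  using R_anti[of x "- y"] R_neg[of y x] R_anti[of y x] by simp

text \<open>One term of the covariant exterior derivative of \<open>R\<close>; the Bianchi identity
  says that its cyclic sum is zero.\<close>

definition B :: "'g \<Rightarrow> 'g \<Rightarrow> 'g \<Rightarrow> 'n" where
  "B x a b = D x (R a b) - R (lbr L x a) b"

lemma B_cyclic: "B x a b + B a b x + B b x a = 0"
  using bianchi[of x a b] by (simp add: B_def algebra_simps)

text \<open>The sum given by equivariance is cut between the leading entries and the curvature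
  blocks. The list \<open>ws\<close> is empty for the characteristic cochain and
  \<open>[\<alpha> z]\<close> for the transgression.\<close>

lemma act_pairs:
  assumes "even (length ys)" "length (ws @ pairs R ys) = p" "length ws = r"
  shows "mact V x (f (ws @ pairs R ys)) = (\<Sum>i<r. f (ws[i := D x (ws ! i)] @ pairs R ys)) +
    (\<Sum>i<p - r. f (ws @ (pairs R ys)[i := D x (R (ys ! (2 * i)) (ys ! (2 * i + 1)))]))"
proof -
  have p: "p = r + (p - r)" using assms by auto
  have "mact V x (f (ws @ pairs R ys)) = (\<Sum>i<r + (p - r). f ((ws @ pairs R ys)[i := D x ((ws @ pairs R ys) ! i)]))"
    using assms f_inv[of "ws @ pairs R ys" x] by simp
  also have "\<dots> = (\<Sum>i<r. f ((ws @ pairs R ys)[i := D x ((ws @ pairs R ys) ! i)])) +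
     (\<Sum>i<p - r. f ((ws @ pairs R ys)[r + i := D x ((ws @ pairs R ys) ! (r + i))]))"
    by (rule sum_lessThan_add)
  also have "(\<Sum>i<r. f ((ws @ pairs R ys)[i := D x ((ws @ pairs R ys) ! i)])) = (\<Sum>i<r. f (ws[i := D x (ws ! i)] @ pairs R ys))"
    using assms by (intro sum.cong) (auto simp: list_update_append nth_append)
  also have "(\<Sum>i<p - r. f ((ws @ pairs R ys)[r + i := D x ((ws @ pairs R ys) ! (r + i))])) =
     (\<Sum>i<p - r. f (ws @ (pairs R ys)[i := D x (R (ys ! (2 * i)) (ys ! (2 * i + 1)))]))"
  proof (intro sum.cong refl)
    fix i assume "i \<in> {..<p - r}"
    then have "2 * i + 1 < length ys" using assms by auto
    then show "f ((ws @ pairs R ys)[r + i := D x ((ws @ pairs R ys) ! (r + i))]) =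
      f (ws @ (pairs R ys)[i := D x (R (ys ! (2 * i)) (ys ! (2 * i + 1)))])"
      using assms by (simp add: list_update_append nth_append nth_pairs)
  qed
  finally show ?thesis .
qed

text \<open>This supplies the oddness in each slot that \<open>ce_diff_alt_sum\<close> requires of
  its summand.\<close>

lemma pairs_ins_neg:
  assumes "length ys + 1 = 2 * q" "k < 2 * q" "length ws + q = p"
  shows "f (ws @ pairs R (ins k (- y) ys)) = - f (ws @ pairs R (ins k y ys))"
proof -
  define i where "i = k div 2"
  define r where "r = q - i - 1"
  have "i < q" using assms(2) unfolding i_def by presburger
  then have q: "q = Suc (i + r)" by (simp add: r_def)
  show ?thesis
  proof (cases "even k")
    case True
    then have k: "k = 2 * i" by (simp add: i_def)
    with assms q have ki: "k < length ys" by simp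
    have "ins k y ys = take (2 * i) ys @ y # ys ! (2 * i) # drop (Suc (2 * i)) ys" for y
      using k ki by (simp add: ins_def Cons_nth_drop_Suc)
    moreover have "even (length (take (2 * i) ys))" using ki k by (simp add: min_def)
    ultimately have "pairs R (ins k y ys) = pairs R (take (2 * i) ys) @ R y (ys ! (2 * i)) # pairs R (drop (Suc (2 * i)) ys)" for y
      by (simp add: pairs_append)
    moreover have "Suc (length (ws @ pairs R (take (2 * i) ys)) + length (pairs R (drop (Suc (2 * i)) ys))) = p"
      using assms q ki by simp
    ultimately show ?thesis
      using f_neg_middle[of "ws @ pairs R (take (2 * i) ys)"] by (simp add: R_neg)
  next
    case False
    then have k: "k = Suc (2 * i)" by (simp add: i_def)
    with assms q have ki: "2 * i < length ys" by simp
    have "ins k y ys = take (2 * i) ys @ ys ! (2 * i) # y # drop (Suc (2 * i)) ys" for y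
      using k ki by (simp add: ins_def take_Suc_conv_app_nth)
    moreover have "even (length (take (2 * i) ys))" using ki k by (simp add: min_def)
    ultimately have "pairs R (ins k y ys) = pairs R (take (2 * i) ys) @ R (ys ! (2 * i)) y # pairs R (drop (Suc (2 * i)) ys)" for y
      by (simp add: pairs_append)
    moreover have "Suc (length (ws @ pairs R (take (2 * i) ys)) + length (pairs R (drop (Suc (2 * i)) ys))) = p"
      using assms q ki by simp
    ultimately show ?thesis
      using f_neg_middle[of "ws @ pairs R (take (2 * i) ys)"] by (simp add: R_neg_right)
  qed
qed

text \<open>By additivity of \<open>f\<close> the difference of the two sides carries
  \<open>B x a b\<close> in one entry, and the cyclic sum of \<open>B\<close> vanishes.\<close>

lemma alt_sum_bianchi:
  assumes "2 * length ws + length xs = Suc (2 * p)" "3 \<le> length xs"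
  shows "alt_sum (uncons (\<lambda>x. uncons (\<lambda>a. uncons (\<lambda>b ys. f (ws @ D x (R a b) # pairs R ys))))) xs =
    alt_sum (uncons (\<lambda>x. uncons (\<lambda>a. uncons (\<lambda>b ys. f (ws @ R (lbr L x a) b # pairs R ys))))) xs"
proof -
  have sym: "f (ws @ a # us) = f (a # ws @ us)" for a us by (rule f_sym) simp
  have "alt_sum (uncons (\<lambda>x. uncons (\<lambda>a. uncons (\<lambda>b ys. f (ws @ D x (R a b) # pairs R ys))))) xs -
    alt_sum (uncons (\<lambda>x. uncons (\<lambda>a. uncons (\<lambda>b ys. f (ws @ R (lbr L x a) b # pairs R ys))))) xs =
    alt_sum (uncons (\<lambda>x. uncons (\<lambda>a. uncons (\<lambda>b. (\<lambda>c ys. f (ws @ c # pairs R ys)) (B x a b))))) xs"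
    unfolding alt_sum_diff[symmetric]
  proof (rule alt_sum_cong_3[OF assms(2)])
    fix x a b and ys :: "'g list" assume "length (x # a # b # ys) = length xs"
    then have "Suc (length (ws @ pairs R ys)) = p" using assms by simp
    then show "uncons (\<lambda>x. uncons (\<lambda>a. uncons (\<lambda>b ys. f (ws @ D x (R a b) # pairs R ys)))) (x # a # b # ys) -
       uncons (\<lambda>x. uncons (\<lambda>a. uncons (\<lambda>b ys. f (ws @ R (lbr L x a) b # pairs R ys)))) (x # a # b # ys) =
       uncons (\<lambda>x. uncons (\<lambda>a. uncons (\<lambda>b. (\<lambda>c ys. f (ws @ c # pairs R ys)) (B x a b)))) (x # a # b # ys)"
      by (simp add: sym f_diff B_def)
  qed
  also have "\<dots> = 0"
  proof (rule alt_sum_cyclic_vanish)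
    fix a b and ys :: "'g list" assume "length ys + 3 = length xs"
    then have "Suc (length (ws @ pairs R ys)) = p" using assms by simp
    then show "f (ws @ (a + b) # pairs R ys) = f (ws @ a # pairs R ys) + f (ws @ b # pairs R ys)"
      by (simp add: sym f_add)
  qed (rule B_cyclic, erule tor3, rule assms(2))
  finally show ?thesis by simp
qed

text \<open>The doubled action part consists of 2 * p copies of \<open>?A\<close>, two for each
  block, and the bracket part of 2 * p copies of \<open>?C\<close>, one for each slot; the Bianchi
  identity equates \<open>?A\<close> and \<open>?C\<close>.\<close>

lemma ce_diff_pairs:
  assumes len: "length xs = Suc (2 * p)"
    and \<omega>: "\<And>ys. length ys = 2 * p \<Longrightarrow> \<omega> ys = alt_sum (\<lambda>ys. f (pairs R ys)) ys"
  shows "ce_diff L V \<omega> xs = 0"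
proof (rule tor2)
  let ?A = "alt_sum (uncons (\<lambda>x. uncons (\<lambda>a. uncons (\<lambda>b ys. f (D x (R a b) # pairs R ys))))) xs"
  let ?C = "alt_sum (uncons (\<lambda>x. uncons (\<lambda>a. uncons (\<lambda>b ys. f (R (lbr L x a) b # pairs R ys))))) xs"
  have act: "alt_sum (uncons (\<lambda>x ys. mact V x (f (pairs R ys)))) xs = (\<Sum>i<p. ?A)"
  proof -
    have "alt_sum (uncons (\<lambda>x ys. mact V x (f (pairs R ys)))) xs =
      alt_sum (uncons (\<lambda>x ys. \<Sum>i<p. uncons (\<lambda>a. uncons (\<lambda>b ys. f (D x (R a b) # pairs R ys))) ys)) xs"
    proof (rule alt_sum_uncons_cong)
      fix x and ys :: "'g list" assume "Suc (length ys) = length xs"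
      then have l: "length ys = 2 * p" using len by simp
      have "alt_sum (\<lambda>ys. mact V x (f (pairs R ys))) ys =
        alt_sum (\<lambda>ys. \<Sum>i<p. f ((pairs R ys)[i := D x (R (ys ! (2 * i)) (ys ! (2 * i + 1)))])) ys"
        using l by (intro alt_sum_cong) (use act_pairs[where ws = "[]" and r = 0] in simp)
      also have "\<dots> = (\<Sum>i<p. alt_sum (uncons (\<lambda>a. uncons (\<lambda>b ys. f (D x (R a b) # pairs R ys)))) ys)"
        unfolding alt_sum_sum using l by (intro sum.cong refl alt_sum_pairs_block f_sym) auto
      finally show "alt_sum (\<lambda>ys. mact V x (f (pairs R ys))) ys =
        alt_sum (\<lambda>ys. \<Sum>i<p. uncons (\<lambda>a. uncons (\<lambda>b ys. f (D x (R a b) # pairs R ys))) ys) ys"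
        by (simp only: alt_sum_sum)
    qed (use len in auto)
    also have "uncons (\<lambda>x ys. \<Sum>i<p. uncons (\<lambda>a. uncons (\<lambda>b ys. f (D x (R a b) # pairs R ys))) ys) =
      (\<lambda>ys. \<Sum>i<p. uncons (\<lambda>x. uncons (\<lambda>a. uncons (\<lambda>b ys. f (D x (R a b) # pairs R ys)))) ys)"
      by (simp add: uncons_def fun_eq_iff)
    finally show ?thesis by (simp only: alt_sum_sum)
  qed
  \<comment> \<open>Whichever slot receives the bracket, its block comes to the front without a net
    sign, so the contribution does not depend on \<open>k\<close>.\<close>
  have br: "signed (even k) (alt_sum (uncons (\<lambda>x. uncons (\<lambda>y zs. f (pairs R (ins k (lbr L x y) zs))))) xs) = ?C"
    if k: "k < 2 * p" for k
  proof -
    have "signed (even k) (alt_sum (uncons (\<lambda>x. uncons (\<lambda>y zs. f (pairs R (ins k (lbr L x y) zs))))) xs) =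
      alt_sum (uncons (\<lambda>x. uncons (\<lambda>y zs. signed (even k) (f (pairs R (ins k (lbr L x y) zs)))))) xs"
      unfolding alt_sum_signed[symmetric] by (simp add: uncons_def[abs_def])
    also have "\<dots> = ?C"
    proof (rule alt_sum_uncons_cong)
      fix x and ys :: "'g list" assume l: "Suc (length ys) = length xs"
      show "alt_sum (uncons (\<lambda>y zs. signed (even k) (f (pairs R (ins k (lbr L x y) zs))))) ys =
        alt_sum (uncons (\<lambda>a. uncons (\<lambda>b ys. f (R (lbr L x a) b # pairs R ys)))) ys"
      proof (rule alt_sum_uncons_cong)
        fix y and zs :: "'g list" assume "Suc (length zs) = length ys"
        with l have "Suc (length zs) = 2 * p" using len by simp
        then show "alt_sum (\<lambda>zs. signed (even k) (f (pairs R (ins k (lbr L x y) zs)))) zs =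
          alt_sum (uncons (\<lambda>b ys. f (R (lbr L x y) b # pairs R ys))) zs"
          using k unfolding alt_sum_signed by (intro alt_sum_pairs_ins[where p = p] f_sym f_neg R_anti)
      qed (use l k len in auto)
    qed (use len in auto)
    finally show ?thesis .
  qed
  have "ce_diff L V \<omega> xs + ce_diff L V \<omega> xs = (\<Sum>i<p. ?A) + (\<Sum>i<p. ?A) -
      (\<Sum>k<2 * p. signed (even k) (alt_sum (uncons (\<lambda>x. uncons (\<lambda>y zs. f (pairs R (ins k (lbr L x y) zs))))) xs))"
    unfolding act[symmetric]
    by (rule ce_diff_alt_sum[OF V act_add lbr_anti len \<omega>])
      (use pairs_ins_neg[where ws = "[]" and q = p] in auto)
  also have "\<dots> = (\<Sum>i<2 * p. ?A) - (\<Sum>k<2 * p. ?C)"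
    by (simp add: br sum_const_add_self)
  also have "\<dots> = 0"
  \<comment> \<open>For \<open>p = 0\<close> there are too few arguments for the Bianchi identity,
    but both sums are empty.\<close>
  proof (cases "p = 0")
    case False
    then show ?thesis using alt_sum_bianchi[of "[]" xs] len by simp
  qed simp
  finally show "ce_diff L V \<omega> xs + ce_diff L V \<omega> xs = 0" .
qed

text \<open>The action gives \<open>?AD\<close> for the entry \<alpha> and \<open>- ?BD\<close> for
  each of the \<open>m\<close> curvature blocks; the bracket gives \<open>?AL\<close> for slot 0 and
  \<open>- ?BL\<close> for each of the 2 * m slots behind it. Doubling the action balances
  \<open>?BD\<close> against \<open>?BL\<close>, which agree by the Bianchi identity. What remains,
  \<open>?AD + ?AD - ?AL\<close>, antisymmetrises the covariant exterior derivative of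
  \<alpha>.\<close>

lemma ce_diff_Cons_pairs:
  assumes p: "p = Suc m" and len: "length xs = 2 * p"
    and \<alpha>_neg: "\<And>x. \<alpha> (- x) = - \<alpha> x"
    and \<omega>: "\<And>ys. length ys = Suc (2 * m) \<Longrightarrow> \<omega> ys = alt_sum (uncons (\<lambda>z ys. f (\<alpha> z # pairs R ys))) ys"
  shows "ce_diff L V \<omega> xs + ce_diff L V \<omega> xs =
    alt_sum (uncons (\<lambda>x. uncons (\<lambda>z ys. f ((D x (\<alpha> z) - D z (\<alpha> x) - \<alpha> (lbr L x z)) # pairs R ys)))) xs"
proof -
  let ?F = "uncons (\<lambda>z ys. f (\<alpha> z # pairs R ys))"
  let ?AD = "alt_sum (uncons (\<lambda>x. uncons (\<lambda>z ys. f (D x (\<alpha> z) # pairs R ys)))) xs"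
  let ?AL = "alt_sum (uncons (\<lambda>x. uncons (\<lambda>z ys. f (\<alpha> (lbr L x z) # pairs R ys)))) xs"
  let ?BD = "alt_sum (uncons (\<lambda>z. uncons (\<lambda>x. uncons (\<lambda>a. uncons (\<lambda>b ys. f (\<alpha> z # D x (R a b) # pairs R ys)))))) xs"
  let ?BL = "alt_sum (uncons (\<lambda>z. uncons (\<lambda>x. uncons (\<lambda>a. uncons (\<lambda>b ys. f (\<alpha> z # R (lbr L x a) b # pairs R ys)))))) xs"
  have ne: "xs \<noteq> []" using len p by auto
  have len2: "2 \<le> length xs" using len p by auto
  have act: "alt_sum (uncons (\<lambda>x ys. mact V x (?F ys))) xs = ?AD - (\<Sum>i<m. ?BD)"
  proof -
    let ?H = "\<lambda>x z ys. f (D x (\<alpha> z) # pairs R ys) + (\<Sum>i<m. uncons (\<lambda>a. uncons (\<lambda>b ys. f (\<alpha> z # D x (R a b) # pairs R ys))) ys)"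
    have "alt_sum (uncons (\<lambda>x ys. mact V x (?F ys))) xs = alt_sum (uncons (\<lambda>x. uncons (?H x))) xs"
    proof (rule alt_sum_uncons_cong[OF ne])
      fix x and ys :: "'g list" assume l: "Suc (length ys) = length xs"
      have "(\<lambda>ys. mact V x (?F ys)) = uncons (\<lambda>z ys. mact V x (f (\<alpha> z # pairs R ys)))"
        by (simp add: uncons_def fun_eq_iff)
      then have "alt_sum (\<lambda>ys. mact V x (?F ys)) ys = alt_sum (uncons (\<lambda>z ys. mact V x (f (\<alpha> z # pairs R ys)))) ys"
        by (rule arg_cong)
      also have "\<dots> = alt_sum (uncons (?H x)) ys"
      proof (rule alt_sum_uncons_cong)
        fix z and zs :: "'g list" assume "Suc (length zs) = length ys"
        with l have l': "length zs = 2 * m" using len p by simp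
        have sym: "f (\<alpha> z # us) = f (\<alpha> z # vs)" if "mset us = mset vs" for us vs
          using that by (intro f_sym) simp
        have "alt_sum (\<lambda>ys. mact V x (f (\<alpha> z # pairs R ys))) zs =
          alt_sum (\<lambda>ys. f (D x (\<alpha> z) # pairs R ys) + (\<Sum>i<m. f (\<alpha> z # (pairs R ys)[i := D x (R (ys ! (2 * i)) (ys ! (2 * i + 1)))]))) zs"
          using l' p by (intro alt_sum_cong) (use act_pairs[where ws = "[\<alpha> z]" and r = 1] in simp)
        also have "\<dots> = alt_sum (\<lambda>ys. f (D x (\<alpha> z) # pairs R ys)) zs +
           (\<Sum>i<m. alt_sum (uncons (\<lambda>a. uncons (\<lambda>b ys. f (\<alpha> z # D x (R a b) # pairs R ys)))) zs)"
          unfolding alt_sum_add alt_sum_sum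
          by (intro arg_cong2[of _ _ _ _ "(+)"] refl sum.cong alt_sum_pairs_block[where f = "\<lambda>us. f (\<alpha> z # us)"] sym)
            (use l' in auto)
        finally show "alt_sum (\<lambda>ys. mact V x (f (\<alpha> z # pairs R ys))) zs = alt_sum (?H x z) zs"
          by (simp only: alt_sum_add alt_sum_sum)
      qed (use l len p in auto)
      finally show "alt_sum (\<lambda>ys. mact V x (?F ys)) ys = alt_sum (uncons (?H x)) ys" .
    qed
    also have "uncons (\<lambda>x. uncons (?H x)) = (\<lambda>ys. uncons (\<lambda>x. uncons (\<lambda>z ys. f (D x (\<alpha> z) # pairs R ys))) ys +
      (\<Sum>i<m. uncons (\<lambda>x. uncons (\<lambda>z. uncons (\<lambda>a. uncons (\<lambda>b ys. f (\<alpha> z # D x (R a b) # pairs R ys))))) ys))"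
      by (simp add: uncons_def fun_eq_iff)
    also have "alt_sum \<dots> xs = ?AD + (\<Sum>i<m. alt_sum (uncons (\<lambda>x. uncons (\<lambda>z. uncons (\<lambda>a. uncons (\<lambda>b ys. f (\<alpha> z # D x (R a b) # pairs R ys)))))) xs)"
      by (simp only: alt_sum_add alt_sum_sum)
    \<comment> \<open>The derivation \<open>x\<close> has to pass \<open>z\<close> to reach the
      block it acts on, which is the origin of the minus.\<close>
    also have "alt_sum (uncons (\<lambda>x. uncons (\<lambda>z. uncons (\<lambda>a. uncons (\<lambda>b ys. f (\<alpha> z # D x (R a b) # pairs R ys)))))) xs = - ?BD"
      by (rule alt_sum_swap2[OF len2])
    finally show ?thesis by (simp add: sum_negf)
  qed
  have br0: "signed (even 0) (alt_sum (uncons (\<lambda>x. uncons (\<lambda>y zs. ?F (ins 0 (lbr L x y) zs)))) xs) = ?AL"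
    by (simp add: ins_def)
  have br: "signed (even (Suc k)) (alt_sum (uncons (\<lambda>x. uncons (\<lambda>y zs. ?F (ins (Suc k) (lbr L x y) zs)))) xs) = - ?BL"
    if k: "k < 2 * m" for k
  proof -
    have len3: "3 \<le> length xs" using len p k by auto
    \<comment> \<open>Bringing \<open>z\<close> in front of both bracketed arguments is a cyclic
      shift and costs no sign. The minus in \<open>- ?BL\<close> stems from slot
      \<open>Suc k\<close> being slot \<open>k\<close> of the paired tail.\<close>
    have "alt_sum (uncons (\<lambda>x. uncons (\<lambda>y zs. ?F (ins (Suc k) (lbr L x y) zs)))) xs =
      alt_sum (uncons (\<lambda>x. uncons (\<lambda>y. uncons (\<lambda>z zs. f (\<alpha> z # pairs R (ins k (lbr L x y) zs)))))) xs"
      by (rule alt_sum_cong_3[OF len3]) (simp add: ins_def)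
    also have "\<dots> = alt_sum (uncons (\<lambda>z. uncons (\<lambda>x. uncons (\<lambda>y zs. f (\<alpha> z # pairs R (ins k (lbr L x y) zs)))))) xs"
      by (rule alt_sum_rotate3[OF len3, symmetric, where G = "\<lambda>x y z zs. f (\<alpha> z # pairs R (ins k (lbr L x y) zs))"])
    finally have *: "alt_sum (uncons (\<lambda>x. uncons (\<lambda>y zs. ?F (ins (Suc k) (lbr L x y) zs)))) xs =
      alt_sum (uncons (\<lambda>z. uncons (\<lambda>x. uncons (\<lambda>y zs. f (\<alpha> z # pairs R (ins k (lbr L x y) zs)))))) xs" .
    have "signed (even k) (alt_sum (uncons (\<lambda>z. uncons (\<lambda>x. uncons (\<lambda>y zs. f (\<alpha> z # pairs R (ins k (lbr L x y) zs)))))) xs) =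
      alt_sum (uncons (\<lambda>z. uncons (\<lambda>x. uncons (\<lambda>y zs. signed (even k) (f (\<alpha> z # pairs R (ins k (lbr L x y) zs))))))) xs"
      unfolding alt_sum_signed[symmetric] by (simp add: uncons_def[abs_def])
    also have "\<dots> = ?BL"
    proof (intro alt_sum_uncons_cong)
      fix z x y and as bs cs :: "'g list"
      assume "Suc (length as) = length xs" "Suc (length bs) = length as" "Suc (length cs) = length bs"
      then have l: "Suc (length cs) = 2 * m" using len p by simp
      have sym: "f (\<alpha> z # us) = f (\<alpha> z # vs)" if "mset us = mset vs" for us vs
        using that by (intro f_sym) simp
      have neg: "f (\<alpha> z # - a # us) = - f (\<alpha> z # a # us)" if "Suc (length us) = m" for a us
        using f_neg_middle[of "[\<alpha> z]" us a] that p by simp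
      show "alt_sum (\<lambda>zs. signed (even k) (f (\<alpha> z # pairs R (ins k (lbr L x y) zs)))) cs =
        alt_sum (uncons (\<lambda>b ys. f (\<alpha> z # R (lbr L x y) b # pairs R ys))) cs"
        unfolding alt_sum_signed
        by (rule alt_sum_pairs_ins[where f = "\<lambda>us. f (\<alpha> z # us)", OF sym neg R_anti l k])
    qed (use len p k in auto)
    finally have "- signed (even k) (alt_sum (uncons (\<lambda>z. uncons (\<lambda>x. uncons (\<lambda>y zs. f (\<alpha> z # pairs R (ins k (lbr L x y) zs)))))) xs) = - ?BL"
      by (rule arg_cong)
    moreover have "signed (even (Suc k)) v = - signed (even k) v" for v :: 'v by (simp add: signed_def)
    ultimately show ?thesis by (simp only: *)
  qed
  have F: "?F (ins k (- y) zs) = - ?F (ins k y zs)" if kl: "k < Suc (2 * m)" "Suc (length zs) = Suc (2 * m)" for k y zs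
  proof (cases k)
    case 0
    then show ?thesis using kl p by (simp add: ins_def \<alpha>_neg f_neg)
  next
    case (Suc j)
    then obtain w ws where zs: "zs = w # ws" using kl by (cases zs) auto
    show ?thesis
      using kl Suc zs p pairs_ins_neg[of ws m j "[\<alpha> w]" y] by (simp add: ins_def)
  qed
  have "ce_diff L V \<omega> xs + ce_diff L V \<omega> xs = (?AD - (\<Sum>i<m. ?BD)) + (?AD - (\<Sum>i<m. ?BD)) -
      (\<Sum>k<Suc (2 * m). signed (even k) (alt_sum (uncons (\<lambda>x. uncons (\<lambda>y zs. ?F (ins k (lbr L x y) zs)))) xs))"
    unfolding act[symmetric]
    by (rule ce_diff_alt_sum[OF V act_add lbr_anti _ \<omega> F]) (use len p in auto)
  also have "\<dots> = (?AD - (\<Sum>i<m. ?BD)) + (?AD - (\<Sum>i<m. ?BD)) - (?AL - (\<Sum>k<2 * m. ?BL))"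
    unfolding sum.lessThan_Suc_shift br0 by (simp add: br sum_negf del: even_Suc)
  also have "\<dots> = ?AD + ?AD - ?AL - ((\<Sum>k<2 * m. ?BD) - (\<Sum>k<2 * m. ?BL))"
    using sum_const_add_self[of "{..<m}" ?BD] by (simp add: algebra_simps)
  also have "(\<Sum>k<2 * m. ?BD) - (\<Sum>k<2 * m. ?BL) = 0"
  proof (cases "m = 0")
    case False
    have "?BD = ?BL"
    proof (rule alt_sum_uncons_cong[OF ne])
      fix z and ys :: "'g list" assume "Suc (length ys) = length xs"
      then show "alt_sum (uncons (\<lambda>x. uncons (\<lambda>a. uncons (\<lambda>b ys. f (\<alpha> z # D x (R a b) # pairs R ys))))) ys =
        alt_sum (uncons (\<lambda>x. uncons (\<lambda>a. uncons (\<lambda>b ys. f (\<alpha> z # R (lbr L x a) b # pairs R ys))))) ys"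
        using alt_sum_bianchi[of "[\<alpha> z]" ys] len p False by simp
    qed
    then show ?thesis by simp
  qed simp
  \<comment> \<open>In one copy of \<open>?AD\<close> the first two arguments are exchanged; this is
    the term with \<open>D z (\<alpha> x)\<close>.\<close>
  also have "?AD + ?AD - ?AL - 0 = alt_sum (uncons (\<lambda>x. uncons (\<lambda>z ys. f (D x (\<alpha> z) # pairs R ys)))) xs
     - alt_sum (uncons (\<lambda>x. uncons (\<lambda>z ys. f (D z (\<alpha> x) # pairs R ys)))) xs - ?AL"
    using alt_sum_swap2[OF len2, of "\<lambda>x z ys. f (D x (\<alpha> z) # pairs R ys)"] by simp
  also have "\<dots> = alt_sum (uncons (\<lambda>x. uncons (\<lambda>z ys. f ((D x (\<alpha> z) - D z (\<alpha> x) - \<alpha> (lbr L x z)) # pairs R ys)))) xs"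
    unfolding alt_sum_diff[symmetric] using len p by (intro alt_sum_cong_2[OF len2]) (simp add: f_diff)
  finally show ?thesis .
qed

end

section \<open>Linear maps on symmetric powers\<close>

lemma poly_mapping_sum_single:
  "P = (\<Sum>m\<in>Poly_Mapping.keys P. Poly_Mapping.single m (Poly_Mapping.lookup P m))"
  by (rule poly_mapping_eqI) (auto simp: lookup_sum lookup_single when_def sum.delta in_keys_iff)

lemma poly_mapping_additive_ext:
  fixes T T' :: "('a \<Rightarrow>\<^sub>0 'k::ab_group_add) \<Rightarrow> 'v::ab_group_add"
  assumes "\<And>P Q. T (P + Q) = T P + T Q" "\<And>P Q. T' (P + Q) = T' P + T' Q"
    and "\<And>m c. T (Poly_Mapping.single m c) = T' (Poly_Mapping.single m c)"
  shows "T P = T' P"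
  by (subst (1 2) poly_mapping_sum_single)
    (simp only: additive_sum[of T, OF assms(1)] additive_sum[of T', OF assms(2)] assms(3))

text \<open>The linear map of \<open>f\<close> on representatives. \<open>SOME\<close> picks an
  enumeration of each monomial, immaterial for symmetric \<open>f\<close>. Monomials of degree other
  than p get 0 because \<open>f\<close> vanishes on lists of other lengths, so the map is available
  on all polynomials, including the inhomogeneous elements of the ideal.\<close>

definition poly_eval ::
  "('k::field \<Rightarrow> 'v::ab_group_add \<Rightarrow> 'v) \<Rightarrow> ('n list \<Rightarrow> 'v) \<Rightarrow> ('n multiset \<Rightarrow>\<^sub>0 'k) \<Rightarrow> 'v" where
  "poly_eval sv f P = (\<Sum>m\<in>Poly_Mapping.keys P. sv (Poly_Mapping.lookup P m) (f (SOME l. mset l = m)))"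

context
  fixes s :: "'k::field \<Rightarrow> 'n::ab_group_add \<Rightarrow> 'n" and sv :: "'k \<Rightarrow> 'v::ab_group_add \<Rightarrow> 'v"
    and p :: nat and f :: "'n list \<Rightarrow> 'v"
  assumes vs: "vector_space s" and vv: "vector_space sv" and f: "f \<in> sym_maps s sv p"
begin

interpretation V: vector_space sv by (rule vv)

lemma sym_map_outside: "length l \<noteq> p \<Longrightarrow> f l = 0"
  using f by (auto simp: sym_maps_def multilinear_maps_def)

lemma sym_map_mset:
  assumes "mset l = mset l'"
  shows "f l = f l'"
proof (cases "length l' = p")
  case True
  obtain \<tau> where "\<tau> permutes {..<length l'}" "permute_list \<tau> l' = l"
    using assms by (rule mset_eq_permutation)
  with True f show ?thesis by (auto simp: sym_maps_def)
next
  case False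
  then show ?thesis using assms mset_eq_length[OF assms] by (simp add: sym_map_outside)
qed

lemma sym_map_linear:
  assumes "length l + length l' + 1 = p"
  shows "Vector_Spaces.linear s sv (\<lambda>x. f (l @ x # l'))"
proof -
  have "Vector_Spaces.linear s sv (\<lambda>x. f (xs[i := x]))" if "length xs = p" "i < p" for xs i
    using f that by (auto simp: sym_maps_def multilinear_maps_def)
  from this[of "l @ 0 # l'" "length l"]
  have "Vector_Spaces.linear s sv (\<lambda>x. f ((l @ 0 # l')[length l := x]))"
    using assms by simp
  then show ?thesis by simp
qed

lemma sym_map_add: "Suc (length l) = p \<Longrightarrow> f ((x + y) # l) = f (x # l) + f (y # l)"
  and sym_map_scale: "Suc (length l) = p \<Longrightarrow> f (s c x # l) = sv c (f (x # l))"
  using sym_map_linear[of "[]" l] by (auto simp: Vector_Spaces.linear_iff)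

lemma sym_map_some: "f (SOME l. mset l = mset l') = f l'"
  by (rule sym_map_mset) (rule someI[of "\<lambda>l. mset l = mset l'"], rule refl)

lemma poly_eval_superset:
  "finite A \<Longrightarrow> Poly_Mapping.keys P \<subseteq> A \<Longrightarrow>
    poly_eval sv f P = (\<Sum>m\<in>A. sv (Poly_Mapping.lookup P m) (f (SOME l. mset l = m)))"
  unfolding poly_eval_def by (intro sum.mono_neutral_left) (auto simp: in_keys_iff)

lemma poly_eval_add: "poly_eval sv f (P + Q) = poly_eval sv f P + poly_eval sv f Q"
proof -
  let ?A = "Poly_Mapping.keys P \<union> Poly_Mapping.keys Q"
  have "poly_eval sv f (P + Q) = (\<Sum>m\<in>?A. sv (Poly_Mapping.lookup (P + Q) m) (f (SOME l. mset l = m)))"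
    using keys_add[of P Q] by (intro poly_eval_superset) auto
  also have "\<dots> = poly_eval sv f P + poly_eval sv f Q"
    by (simp add: poly_eval_superset[of ?A P] poly_eval_superset[of ?A Q] lookup_add V.scale_left_distrib sum.distrib)
  finally show ?thesis .
qed

lemma poly_eval_0 [simp]: "poly_eval sv f 0 = 0"
  by (simp add: poly_eval_def)

lemma poly_eval_minus: "poly_eval sv f (- P) = - poly_eval sv f P"
  using poly_eval_add[of P "- P"] by (simp add: eq_neg_iff_add_eq_0 add.commute)

lemma poly_eval_diff: "poly_eval sv f (P - Q) = poly_eval sv f P - poly_eval sv f Q"
  using poly_eval_add[of P "- Q"] poly_eval_minus[of Q] by simp

lemma poly_eval_single: "poly_eval sv f (Poly_Mapping.single (mset l) c) = sv c (f l)"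
  by (simp add: poly_eval_def sym_map_some)

lemma poly_eval_const_mult: "poly_eval sv f (sym_const c * P) = sv c (poly_eval sv f P)"
proof (rule poly_mapping_additive_ext[where T = "\<lambda>P::'n multiset \<Rightarrow>\<^sub>0 'k. poly_eval sv f (sym_const c * P)"
        and T' = "\<lambda>P. sv c (poly_eval sv f P)"])
  fix m :: "'n multiset" and c'
  obtain l where "mset l = m" using ex_mset by blast
  then show "poly_eval sv f (sym_const c * Poly_Mapping.single m c') = sv c (poly_eval sv f (Poly_Mapping.single m c'))"
    by (auto simp: sym_const_def mult_single poly_eval_single)
qed (simp_all add: distrib_left poly_eval_add V.scale_right_distrib)

lemma single_mult_var: "Poly_Mapping.single (mset l) c * sym_var y = Poly_Mapping.single (mset (y # l)) (c::'k)"
  by (simp add: sym_var_def mult_single)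

text \<open>It suffices to take a monomial for \<open>Q\<close>. If it has degree p - 1, linearity
  of \<open>f\<close> in its first entry applies; otherwise every term has the wrong degree and
  evaluates to 0.\<close>

lemma poly_eval_relations:
  "poly_eval sv f (Q * (sym_var (y + z) - sym_var y - sym_var z)) = 0"
  "poly_eval sv f (Q * (sym_var (s c y) - sym_const c * sym_var y)) = 0"
proof -
  show "poly_eval sv f (Q * (sym_var (y + z) - sym_var y - sym_var z)) = 0"
  proof (rule poly_mapping_additive_ext[where T = "\<lambda>Q. poly_eval sv f (Q * (sym_var (y + z) - sym_var y - sym_var z))"
        and T' = "\<lambda>P. 0"])
    fix m :: "'n multiset" and a
    obtain l where m: "mset l = m" using ex_mset by blast
    have "poly_eval sv f (Poly_Mapping.single m a * (sym_var (y + z) - sym_var y - sym_var z)) =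
       sv a (f ((y + z) # l)) - sv a (f (y # l)) - sv a (f (z # l))"
      by (simp only: right_diff_distrib m[symmetric] single_mult_var poly_eval_diff poly_eval_single)
    also have "\<dots> = 0"
      by (cases "Suc (length l) = p") (simp_all add: sym_map_add sym_map_outside V.scale_right_distrib)
    finally show "poly_eval sv f (Poly_Mapping.single m a * (sym_var (y + z) - sym_var y - sym_var z)) = 0" .
  qed (simp_all add: distrib_right poly_eval_add)
  show "poly_eval sv f (Q * (sym_var (s c y) - sym_const c * sym_var y)) = 0"
  proof (rule poly_mapping_additive_ext[where T = "\<lambda>Q. poly_eval sv f (Q * (sym_var (s c y) - sym_const c * sym_var y))"
        and T' = "\<lambda>P. 0"])
    fix m :: "'n multiset" and a
    obtain l where m: "mset l = m" using ex_mset by blast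
    have *: "Poly_Mapping.single m a * (sym_const c * sym_var y) = sym_const c * Poly_Mapping.single (mset (y # l)) a"
      by (simp only: mult.left_commute m[symmetric] single_mult_var)
    have "poly_eval sv f (Poly_Mapping.single m a * (sym_var (s c y) - sym_const c * sym_var y)) =
       sv a (f (s c y # l)) - sv c (sv a (f (y # l)))"
      by (simp only: right_diff_distrib * poly_eval_diff poly_eval_const_mult)
        (simp only: m[symmetric] single_mult_var poly_eval_single)
    also have "\<dots> = 0"
      by (cases "Suc (length l) = p") (simp_all add: sym_map_scale sym_map_outside mult.commute)
    finally show "poly_eval sv f (Poly_Mapping.single m a * (sym_var (s c y) - sym_const c * sym_var y)) = 0" .
  qed (simp_all add: distrib_right poly_eval_add)
qed

text \<open>The kernel of \<open>poly_eval sv f\<close> need not be an ideal. The set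
  \<open>?J\<close> of all P whose multiples lie in that kernel is one, it contains the generating
  relations, and hence it contains the ideal they generate.\<close>

lemma poly_eval_ideal:
  assumes "P \<in> sym_ideal s"
  shows "poly_eval sv f P = 0"
proof -
  let ?R = "ring_of_type_algebra :: ('n multiset \<Rightarrow>\<^sub>0 'k) ring"
  let ?J = "{P. \<forall>Q. poly_eval sv f (Q * P) = 0}"
  have R: "ring ?R" by (rule ring_from_type_algebra)
  have J: "ideal ?J ?R"
  proof (rule idealI[OF R])
    show "subgroup ?J (add_monoid ?R)"
    proof (rule group.subgroupI)
      interpret ring ?R by (rule R)
      show "Group.group (add_monoid ?R)" by (rule a_group)
      show "?J \<noteq> {}" by (auto intro: exI[of _ 0])
      fix a assume a: "a \<in> ?J"
      have "inv\<^bsub>add_monoid ?R\<^esub> a = - a"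
        by (rule comm_monoid.comm_inv_char[OF a_comm_monoid]) (auto simp: ring_of_type_algebra_def)
      with a show "inv\<^bsub>add_monoid ?R\<^esub> a \<in> ?J" by (simp add: poly_eval_minus)
    qed (auto simp: ring_of_type_algebra_def distrib_left poly_eval_add)
  next
    fix a x assume a: "a \<in> ?J"
    have "Q * (x * a) = (Q * x) * a" "Q * (a * x) = (Q * x) * a" for Q
      by (simp_all add: mult_ac)
    then have "poly_eval sv f (Q * (x * a)) = 0" "poly_eval sv f (Q * (a * x)) = 0" for Q
      using a by (simp_all only: mem_Collect_eq)
    then show "x \<otimes>\<^bsub>?R\<^esub> a \<in> ?J" "a \<otimes>\<^bsub>?R\<^esub> x \<in> ?J"
      by (auto simp: ring_of_type_algebra_def)
  qed
  have "sym_ideal s \<subseteq> ?J"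
    unfolding sym_ideal_def by (rule ring.genideal_minimal[OF R J]) (auto simp: poly_eval_relations)
  with assms have "poly_eval sv f (1 * P) = 0" by blast
  then show ?thesis by simp
qed

end

section \<open>The symmetric algebra computed through representatives\<close>

lemma sym_ideal_ideal: "ideal (sym_ideal s) ring_of_type_algebra"
  unfolding sym_ideal_def
  by (rule ring.genideal_ideal[OF ring_from_type_algebra]) (simp add: ring_of_type_algebra_def)

lemma sym_alg_ring: "ring (sym_alg s)"
  unfolding sym_alg_def by (rule ideal.quotient_is_ring[OF sym_ideal_ideal])

lemma sym_proj_hom: "sym_proj s \<in> ring_hom ring_of_type_algebra (sym_alg s)"
  unfolding sym_alg_def sym_proj_def[abs_def] by (rule ideal.rcos_ring_hom[OF sym_ideal_ideal])

lemma sym_proj_closed [simp]: "sym_proj s P \<in> carrier (sym_alg s)"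
  using ring_hom_closed[OF sym_proj_hom, of P s] by (simp add: ring_of_type_algebra_def)

lemma sym_proj_add: "sym_proj s P \<oplus>\<^bsub>sym_alg s\<^esub> sym_proj s Q = sym_proj s (P + Q)"
  using ring_hom_add[OF sym_proj_hom, of P Q s] by (simp add: ring_of_type_algebra_def)

lemma sym_proj_mult: "sym_proj s P \<otimes>\<^bsub>sym_alg s\<^esub> sym_proj s Q = sym_proj s (P * Q)"
  using ring_hom_mult[OF sym_proj_hom, of P Q s] by (simp add: ring_of_type_algebra_def)

lemma sym_proj_1: "\<one>\<^bsub>sym_alg s\<^esub> = sym_proj s 1"
  using ring_hom_one[OF sym_proj_hom, of s] by (simp add: ring_of_type_algebra_def)

lemma sym_proj_0: "\<zero>\<^bsub>sym_alg s\<^esub> = sym_proj s 0"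
proof -
  interpret ring "sym_alg s" by (rule sym_alg_ring)
  have "sym_proj s 0 \<oplus>\<^bsub>sym_alg s\<^esub> sym_proj s 0 = sym_proj s 0" by (simp add: sym_proj_add)
  then show ?thesis using add.l_cancel_one' by fastforce
qed

lemma sym_scale_proj: "sym_scale s c (sym_proj s P) = sym_proj s (sym_const c * P)"
  by (simp add: sym_scale_def sym_proj_mult)

lemma sym_proj_finsum: "finsum (sym_alg s) (\<lambda>i. sym_proj s (g i)) A = sym_proj s (sum g A)"
proof -
  interpret ring "sym_alg s" by (rule sym_alg_ring)
  show ?thesis
    by (induction A rule: infinite_finite_induct)
      (simp_all add: finsum_infinite sym_proj_add finsum_insert, simp_all add: sym_proj_0)
qed

lemma sym_proj_eqD:
  assumes "sym_proj s P = sym_proj s Q"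
  shows "P - Q \<in> sym_ideal s"
proof -
  interpret ideal "sym_ideal s" "ring_of_type_algebra" by (rule sym_ideal_ideal)
  have "P \<in> sym_proj s P"
    unfolding sym_proj_def by (rule a_rcos_self) (simp add: ring_of_type_algebra_def)
  with assms have "P \<in> sym_proj s Q" by simp
  then obtain h where "h \<in> sym_ideal s" "P = h + Q"
    by (auto simp: sym_proj_def a_r_coset_def' ring_of_type_algebra_def)
  then show ?thesis by simp
qed

lemma prod_list_sym_var: "prod_list (map sym_var ys) = Poly_Mapping.single (mset ys) (1::'k::field)"
  by (induction ys) (simp_all add: sym_var_def mult_single add.commute[of "{#_#}"])

lemma sym_prod_proj: "sym_prod s ys = sym_proj s (Poly_Mapping.single (mset ys) 1)"
proof -
  have "sym_prod s ys = sym_proj s (prod_list (map sym_var ys))"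
    unfolding sym_prod_def by (induction ys) (simp_all add: sym_gen_def sym_proj_mult sym_proj_1)
  then show ?thesis by (simp only: prod_list_sym_var)
qed

text \<open>The definite description in \<open>sym_lift\<close> is resolved here. A map
  \<open>F\<close> with the required properties exists because \<open>poly_eval\<close> kills the
  ideal; it is unique because a homogeneous polynomial is a combination of monomials of degree p,
  whose classes are the products \<open>sym_prod\<close>.\<close>

lemma sym_lift_proj:
  assumes vs: "vector_space s" and vv: "vector_space sv" and f: "f \<in> sym_maps s sv p"
    and P: "\<forall>m\<in>Poly_Mapping.keys P. size m = p"
  shows "sym_lift s sv p f (sym_proj s P) = poly_eval sv f P"
proof -
  note a = vs vv f
  interpret V: vector_space sv by (rule vv)
  have wd: "poly_eval sv f P = poly_eval sv f Q" if "sym_proj s P = sym_proj s Q" for P Q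
    using poly_eval_ideal[OF a sym_proj_eqD[OF that]] by (simp add: poly_eval_diff[OF a])
  \<comment> \<open>The restriction fixes the values outside the symmetric power, where
    \<open>extensional\<close> demands \<open>undefined\<close>.\<close>
  define F where "F = restrict (\<lambda>A. poly_eval sv f (SOME P. sym_proj s P = A)) (sym_power s p)"
  have F: "F (sym_proj s P) = poly_eval sv f P" if "sym_proj s P \<in> sym_power s p" for P
  proof -
    have "sym_proj s (SOME Q. sym_proj s Q = sym_proj s P) = sym_proj s P"
      by (rule someI[of "\<lambda>Q. sym_proj s Q = sym_proj s P"]) (rule refl)
    from wd[OF this] show ?thesis using that by (simp add: F_def)
  qed
  have homog: "sym_proj s P \<in> sym_power s p" if "\<And>m. Poly_Mapping.lookup P m \<noteq> 0 \<Longrightarrow> size m = p" for P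
    unfolding sym_power_def using that by (intro imageI) (auto simp: in_keys_iff)
  have powerE: "\<exists>P. A = sym_proj s P \<and> (\<forall>m. Poly_Mapping.lookup P m \<noteq> 0 \<longrightarrow> size m = p)" if "A \<in> sym_power s p" for A
    using that by (auto simp: sym_power_def in_keys_iff)
  have lookup_const: "Poly_Mapping.lookup (sym_const c * P) m = c * Poly_Mapping.lookup P m" for c :: 'a and P :: "'b multiset \<Rightarrow>\<^sub>0 'a" and m
    by (simp add: sym_const_def mult_map_scale_conv_mult[symmetric] Poly_Mapping.map.rep_eq when_def)
  let ?char = "\<lambda>F. F \<in> extensional (sym_power s p) \<and>
     (\<forall>A\<in>sym_power s p. \<forall>B\<in>sym_power s p. F (A \<oplus>\<^bsub>sym_alg s\<^esub> B) = F A + F B) \<and>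
     (\<forall>c. \<forall>A\<in>sym_power s p. F (sym_scale s c A) = sv c (F A)) \<and>
     (\<forall>ys. length ys = p \<longrightarrow> F (sym_prod s ys) = f ys)"
  have charF: "?char F"
  proof (intro conjI ballI allI impI)
    show "F \<in> extensional (sym_power s p)" by (simp add: F_def)
  next
    fix A B assume "A \<in> sym_power s p" "B \<in> sym_power s p"
    then obtain P Q where PQ: "A = sym_proj s P" "\<And>m. Poly_Mapping.lookup P m \<noteq> 0 \<Longrightarrow> size m = p"
      "B = sym_proj s Q" "\<And>m. Poly_Mapping.lookup Q m \<noteq> 0 \<Longrightarrow> size m = p" using powerE by metis
    have "Poly_Mapping.lookup (P + Q) m \<noteq> 0 \<Longrightarrow> size m = p" for m
      using PQ(2,4)[of m] by (cases "Poly_Mapping.lookup P m = 0") (auto simp: lookup_add)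
    then show "F (A \<oplus>\<^bsub>sym_alg s\<^esub> B) = F A + F B"
      using PQ(2,4) unfolding PQ(1,3) sym_proj_add by (simp add: F homog poly_eval_add[OF a])
  next
    fix c A assume "A \<in> sym_power s p"
    then obtain P where P: "A = sym_proj s P" "\<And>m. Poly_Mapping.lookup P m \<noteq> 0 \<Longrightarrow> size m = p" using powerE by metis
    have "Poly_Mapping.lookup (sym_const c * P) m \<noteq> 0 \<Longrightarrow> size m = p" for m
      using P(2)[of m] by (simp add: lookup_const)
    then show "F (sym_scale s c A) = sv c (F A)"
      using P(2) unfolding P(1) sym_scale_proj by (simp add: F homog poly_eval_const_mult[OF a])
  next
    fix ys :: "'b list" assume "length ys = p"
    then have "F (sym_proj s (Poly_Mapping.single (mset ys) 1)) = poly_eval sv f (Poly_Mapping.single (mset ys) 1)"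
      by (intro F homog) (auto simp: lookup_single when_def split: if_splits)
    then show "F (sym_prod s ys) = f ys"
      by (simp only: sym_prod_proj poly_eval_single[OF a] V.scale_one)
  qed
  have uniq: "G = F" if G: "?char G" for G
  proof (rule extensionalityI)
    show "G \<in> extensional (sym_power s p)" "F \<in> extensional (sym_power s p)" using G charF by auto
    fix A assume "A \<in> sym_power s p"
    then obtain P where P: "A = sym_proj s P" "\<And>m. m \<in> Poly_Mapping.keys P \<Longrightarrow> size m = p"
      by (auto simp: sym_power_def)
    \<comment> \<open>Stated for an arbitrary \<open>H\<close> with the characterising properties,
      so that it serves both the competitor \<open>G\<close> and \<open>F\<close> itself.\<close>
    have ind: "H (sym_proj s (\<Sum>m\<in>M. Poly_Mapping.single m (c m))) = (\<Sum>m\<in>M. sv (c m) (f (SOME l. mset l = m)))"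
      if "?char H" "finite M" "\<And>m. m \<in> M \<Longrightarrow> size m = p" for H M c
      using that(2,3)
    proof (induction M rule: finite_induct)
      case empty
      have "sym_proj s 0 \<in> sym_power s p" by (rule homog) simp
      then have "H (sym_proj s 0 \<oplus>\<^bsub>sym_alg s\<^esub> sym_proj s 0) = H (sym_proj s 0) + H (sym_proj s 0)"
        using that(1) by blast
      then show ?case by (simp add: sym_proj_add)
    next
      case (insert m M)
      obtain l where l: "mset l = m" using ex_mset by blast
      with insert.prems[of m] have len: "length l = p" by (simp flip: size_mset)
      have ps: "sym_proj s (Poly_Mapping.single m 1) \<in> sym_power s p" "sym_proj s (Poly_Mapping.single m (c m)) \<in> sym_power s p"
        using insert.prems by (auto intro!: homog simp: lookup_single when_def split: if_splits)
      have pM: "sym_proj s (\<Sum>m\<in>M. Poly_Mapping.single m (c m)) \<in> sym_power s p"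
      proof (rule homog, rule ccontr)
        fix m' assume "Poly_Mapping.lookup (\<Sum>m\<in>M. Poly_Mapping.single m (c m)) m' \<noteq> 0" "size m' \<noteq> p"
        then show False using insert.prems
          by (auto simp: lookup_sum lookup_single when_def elim!: sum.not_neutral_contains_not_neutral split: if_splits)
      qed
      have "H (sym_proj s (Poly_Mapping.single m (c m))) = H (sym_scale s (c m) (sym_proj s (Poly_Mapping.single m 1)))"
        by (simp add: sym_scale_proj sym_const_def mult_single)
      also have "\<dots> = sv (c m) (H (sym_proj s (Poly_Mapping.single m 1)))"
        using that(1) ps(1) by blast
      also have "H (sym_proj s (Poly_Mapping.single m 1)) = f l"
        using that(1) len unfolding l[symmetric] sym_prod_proj[symmetric] by blast
      also have "f l = f (SOME l. mset l = m)"
        using sym_map_some[OF a, of l] l by simp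
      finally have "H (sym_proj s (Poly_Mapping.single m (c m))) = sv (c m) (f (SOME l. mset l = m))" .
      moreover have "H (sym_proj s (Poly_Mapping.single m (c m)) \<oplus>\<^bsub>sym_alg s\<^esub> sym_proj s (\<Sum>m\<in>M. Poly_Mapping.single m (c m))) =
        H (sym_proj s (Poly_Mapping.single m (c m))) + H (sym_proj s (\<Sum>m\<in>M. Poly_Mapping.single m (c m)))"
        using that(1) ps(2) pM by blast
      ultimately show ?case using insert by (simp add: sym_proj_add)
    qed
    show "G A = F A"
      unfolding P(1) by (subst (1 2) poly_mapping_sum_single) (simp only: ind[OF G] ind[OF charF] P(2) finite_keys)
  qed
  have "sym_lift s sv p f = F"
    unfolding sym_lift_def by (rule the_equality[of ?char]) (use charF uniq in blast)+
  then show ?thesis using F[OF homog] P by (auto simp: in_keys_iff)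
qed

section \<open>Wedge products with values in the symmetric algebra\<close>

lemma sym_const_mult: "sym_const a * sym_const b = sym_const (a * b)"
  by (simp add: sym_const_def mult_single)

lemma of_nat_sym_const: "of_nat n = sym_const (of_nat n)"
  by (simp add: sym_const_def single_of_nat)

lemma sym_const_sign: "sym_const (of_int (sign \<tau>)) * P = signed (evenperm \<tau>) P"
  by (simp add: sign_def sym_const_def single_uminus)

lemma sym_wedge_proj:
  assumes len: "length xs = p + q"
    and \<alpha>: "\<And>ys. length ys = p \<Longrightarrow> \<alpha> ys = sym_proj s (a ys)"
    and \<beta>: "\<And>ys. length ys = q \<Longrightarrow> \<beta> ys = sym_proj s (b ys)"
  shows "sym_wedge s p q \<alpha> \<beta> xs =
    sym_proj s (sym_const (1 / (of_nat (fact p) * of_nat (fact q))) * alt_sum (\<lambda>ys. a (take p ys) * b (drop p ys)) xs)"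
  unfolding sym_wedge_def using len
  by (simp add: \<alpha> \<beta> sym_proj_mult sym_scale_proj sym_proj_finsum sym_const_sign alt_sum_def)

lemma const_mult_alt_sum:
  "sym_const c * alt_sum (\<lambda>ys. Poly_Mapping.single (h ys) a) xs = alt_sum (\<lambda>ys. Poly_Mapping.single (h ys) (c * a)) xs"
  by (subst additive_alt_sum[of "\<lambda>P. sym_const c * P"]) (simp_all add: distrib_left sym_const_def mult_single)

text \<open>A wedge step brings 1/(2! (2n)!), and absorbing the inner alternating sum gives back
  (2n)!. Each factor thus leaves exactly 1/2.\<close>

lemma sym_wedge_power_curv:
  fixes s :: "'k::field_char_0 \<Rightarrow> 'n::ab_group_add \<Rightarrow> 'n"
  shows "length xs = 2 * n \<Longrightarrow> sym_wedge_power s (sym_gen s \<circ> R) n xs =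
    sym_proj s (alt_sum (\<lambda>ys. Poly_Mapping.single (mset (pairs (\<lambda>x y. R [x, y]) ys)) (1 / 2 ^ n)) xs)"
proof (induction n arbitrary: xs)
  case 0
  then show ?case by (simp add: sym_proj_1)
next
  case (Suc n)
  let ?R = "\<lambda>x y. R [x, y]"
  let ?c = "1 / (of_nat (fact 2) * of_nat (fact (2 * n))) :: 'k"
  have len2: "2 \<le> length xs" using Suc.prems by simp
  have "sym_wedge_power s (sym_gen s \<circ> R) (Suc n) xs = sym_proj s (sym_const ?c *
    alt_sum (\<lambda>ys. sym_var (R (take 2 ys)) * alt_sum (\<lambda>ys. Poly_Mapping.single (mset (pairs ?R ys)) (1 / 2 ^ n)) (drop 2 ys)) xs)"
    unfolding sym_wedge_power.simps
    by (rule sym_wedge_proj[OF _ _ Suc.IH]) (simp_all add: Suc.prems sym_gen_def)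
  also have "alt_sum (\<lambda>ys. sym_var (R (take 2 ys)) * alt_sum (\<lambda>ys. Poly_Mapping.single (mset (pairs ?R ys)) (1 / 2 ^ n :: 'k)) (drop 2 ys)) xs =
    alt_sum (uncons (\<lambda>x. uncons (\<lambda>y. alt_sum (\<lambda>ys. Poly_Mapping.single (mset (?R x y # pairs ?R ys)) (1 / 2 ^ n))))) xs"
  proof (rule alt_sum_cong_2[OF len2])
    fix x y and zs :: "'a list"
    have "P * alt_sum F zs = alt_sum (\<lambda>ys. P * F ys) zs" for P :: "'n multiset \<Rightarrow>\<^sub>0 'k" and F
      by (rule additive_alt_sum) (rule distrib_left)
    then show "sym_var (R (take 2 (x # y # zs))) * alt_sum (\<lambda>ys. Poly_Mapping.single (mset (pairs ?R ys)) (1 / 2 ^ n :: 'k)) (drop 2 (x # y # zs)) =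
      uncons (\<lambda>x. uncons (\<lambda>y. alt_sum (\<lambda>ys. Poly_Mapping.single (mset (?R x y # pairs ?R ys)) (1 / 2 ^ n)))) (x # y # zs)"
      by (simp add: sym_var_def mult_single)
  qed
  also have "\<dots> = of_nat (fact (2 * n)) * alt_sum (uncons (\<lambda>x. uncons (\<lambda>y ys. Poly_Mapping.single (mset (?R x y # pairs ?R ys)) (1 / 2 ^ n)))) xs"
    unfolding alt_sum_uncons2_absorb[OF len2] sum_constant using Suc.prems by (simp add: card_permutations)
  also have "alt_sum (uncons (\<lambda>x. uncons (\<lambda>y ys. Poly_Mapping.single (mset (?R x y # pairs ?R ys)) (1 / 2 ^ n :: 'k)))) xs =
    alt_sum (\<lambda>ys. Poly_Mapping.single (mset (pairs ?R ys)) (1 / 2 ^ n)) xs"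
    by (rule alt_sum_cong_2[OF len2]) simp
  finally show ?case
    by (simp only: of_nat_sym_const mult.assoc[symmetric] sym_const_mult const_mult_alt_sum) simp
qed

text \<open>The 1-form contributes 1/1!, and (2n)! cancels as before, so only the 1/2^n of the
  curvature power is left.\<close>

lemma sym_wedge_transgression:
  fixes s :: "'k::field_char_0 \<Rightarrow> 'n::ab_group_add \<Rightarrow> 'n"
  assumes len: "length xs = 1 + 2 * n"
  shows "sym_wedge s 1 (2 * n) (sym_gen s \<circ> A) (sym_wedge_power s (sym_gen s \<circ> R) n) xs =
    sym_proj s (alt_sum (\<lambda>ys. Poly_Mapping.single (mset (uncons (\<lambda>z ys. A [z] # pairs (\<lambda>x y. R [x, y]) ys) ys)) (1 / 2 ^ n)) xs)"
proof -
  let ?R = "\<lambda>x y. R [x, y]"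
  let ?c = "1 / (of_nat (fact 1) * of_nat (fact (2 * n))) :: 'k"
  have ne: "xs \<noteq> []" using len by auto
  have "sym_wedge s 1 (2 * n) (sym_gen s \<circ> A) (sym_wedge_power s (sym_gen s \<circ> R) n) xs = sym_proj s (sym_const ?c *
    alt_sum (\<lambda>ys. sym_var (A (take 1 ys)) * alt_sum (\<lambda>ys. Poly_Mapping.single (mset (pairs ?R ys)) (1 / 2 ^ n)) (drop 1 ys)) xs)"
    by (rule sym_wedge_proj[OF len _ sym_wedge_power_curv]) (simp_all add: sym_gen_def)
  also have "alt_sum (\<lambda>ys. sym_var (A (take 1 ys)) * alt_sum (\<lambda>ys. Poly_Mapping.single (mset (pairs ?R ys)) (1 / 2 ^ n :: 'k)) (drop 1 ys)) xs =
    alt_sum (uncons (\<lambda>z. alt_sum (\<lambda>ys. Poly_Mapping.single (mset (A [z] # pairs ?R ys)) (1 / 2 ^ n)))) xs"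
  proof (rule alt_sum_cong)
    fix ys :: "'a list" assume "length ys = length xs"
    then obtain z zs where "ys = z # zs" using ne by (cases ys) auto
    moreover have "P * alt_sum F zs = alt_sum (\<lambda>ys. P * F ys) zs" for P :: "'n multiset \<Rightarrow>\<^sub>0 'k" and F
      by (rule additive_alt_sum) (rule distrib_left)
    ultimately show "sym_var (A (take 1 ys)) * alt_sum (\<lambda>ys. Poly_Mapping.single (mset (pairs ?R ys)) (1 / 2 ^ n :: 'k)) (drop 1 ys) =
      uncons (\<lambda>z. alt_sum (\<lambda>ys. Poly_Mapping.single (mset (A [z] # pairs ?R ys)) (1 / 2 ^ n))) ys"
      by (simp add: sym_var_def mult_single)
  qed
  also have "\<dots> = of_nat (fact (2 * n)) * alt_sum (uncons (\<lambda>z ys. Poly_Mapping.single (mset (A [z] # pairs ?R ys)) (1 / 2 ^ n))) xs"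
    unfolding alt_sum_uncons_absorb[OF ne] sum_constant using len by (simp add: card_permutations)
  also have "uncons (\<lambda>z ys. Poly_Mapping.single (mset (A [z] # pairs ?R ys)) (1 / 2 ^ n :: 'k)) =
    (\<lambda>ys. Poly_Mapping.single (mset (uncons (\<lambda>z ys. A [z] # pairs ?R ys) ys)) (1 / 2 ^ n))"
    by (simp add: uncons_def fun_eq_iff)
  finally show ?thesis
    by (simp only: of_nat_sym_const mult.assoc[symmetric] sym_const_mult const_mult_alt_sum) simp
qed

text \<open>The representative is homogeneous of degree p since every monomial in it enumerates a
  list \<open>h ys\<close>; the lift may then be evaluated termwise.\<close>

lemma sym_lift_alt_sum:
  assumes vs: "vector_space s" and vv: "vector_space sv" and f: "f \<in> sym_maps s sv p"
    and h: "\<And>ys. length ys = length xs \<Longrightarrow> length (h ys) = p"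
  shows "sym_lift s sv p f (sym_proj s (alt_sum (\<lambda>ys. Poly_Mapping.single (mset (h ys)) c) xs)) =
    sv c (alt_sum (\<lambda>ys. f (h ys)) xs)"
proof -
  note a = vs vv f
  interpret V: vector_space sv by (rule vv)
  have "size m = p" if "m \<in> Poly_Mapping.keys (alt_sum (\<lambda>ys. Poly_Mapping.single (mset (h ys)) c) xs)" for m
  proof (rule ccontr)
    assume m: "size m \<noteq> p"
    have "Poly_Mapping.lookup (alt_sum (\<lambda>ys. Poly_Mapping.single (mset (h ys)) c) xs) m =
      alt_sum (\<lambda>ys. Poly_Mapping.lookup (Poly_Mapping.single (mset (h ys)) c) m) xs"
      by (rule additive_alt_sum) (simp add: lookup_add)
    also have "\<dots> = alt_sum (\<lambda>ys. 0) xs"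
      using m h by (intro alt_sum_cong) (auto simp: lookup_single when_def)
    finally show False using that by (simp add: in_keys_iff)
  qed
  then have "sym_lift s sv p f (sym_proj s (alt_sum (\<lambda>ys. Poly_Mapping.single (mset (h ys)) c) xs)) =
    poly_eval sv f (alt_sum (\<lambda>ys. Poly_Mapping.single (mset (h ys)) c) xs)"
    by (intro sym_lift_proj[OF a]) blast
  also have "\<dots> = alt_sum (\<lambda>ys. sv c (f (h ys))) xs"
    by (subst additive_alt_sum[of "poly_eval sv f", OF poly_eval_add[OF a]]) (simp only: poly_eval_single[OF a])
  also have "\<dots> = sv c (alt_sum (\<lambda>ys. f (h ys)) xs)"
    by (rule additive_alt_sum[symmetric]) (rule V.scale_right_distrib)
  finally show ?thesis .
qed

lemma sym_lift_zero:
  assumes "vector_space s" "vector_space sv" "f \<in> sym_maps s sv p"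
  shows "sym_lift s sv p f \<zero>\<^bsub>sym_alg s\<^esub> = 0"
  unfolding sym_proj_0 using sym_lift_proj[OF assms, of 0] by (simp add: poly_eval_def)

section \<open>Multilinear maps\<close>

text \<open>In contrast to \<open>multilinear_maps\<close>, lists of other lengths are left
  unconstrained: \<open>f (pairs R ys)\<close> need not vanish on lists of length 2 * p + 1, where
  \<open>pairs\<close> drops the last entry.\<close>

definition multilin ::
  "('k::field \<Rightarrow> 'a::ab_group_add \<Rightarrow> 'a) \<Rightarrow> ('k \<Rightarrow> 'b::ab_group_add \<Rightarrow> 'b) \<Rightarrow> nat \<Rightarrow> ('a list \<Rightarrow> 'b) \<Rightarrow> bool" where
  "multilin s sv p f \<longleftrightarrow> (\<forall>us vs. length us + length vs + 1 = p \<longrightarrow> Vector_Spaces.linear s sv (\<lambda>x. f (us @ x # vs)))"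

lemma multilinD:
  "multilin s sv p f \<Longrightarrow> length us + length vs + 1 = p \<Longrightarrow> Vector_Spaces.linear s sv (\<lambda>x. f (us @ x # vs))"
  by (simp add: multilin_def)

lemma multilin_Cons:
  assumes "multilin s sv (Suc p) f"
  shows "multilin s sv p (\<lambda>us. f (a # us))"
  unfolding multilin_def
proof (intro allI impI)
  fix us vs :: "'b list" assume "length us + length vs + 1 = p"
  then show "Vector_Spaces.linear s sv (\<lambda>x. f (a # us @ x # vs))"
    using multilinD[OF assms, of "a # us" vs] by simp
qed

lemma multilin_head:
  assumes "multilin s sv (Suc p) f" "length us = p"
  shows "f ((x + y) # us) = f (x # us) + f (y # us)" "f (s c x # us) = sv c (f (x # us))"
  using multilinD[OF assms(1), of "[]" us] assms(2) by (auto simp: Vector_Spaces.linear_iff)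

lemma multilin_list_update:
  assumes "multilin s sv n F" "length xs = n" "i < n"
  shows "Vector_Spaces.linear s sv (\<lambda>x. F (xs[i := x]))"
  using multilinD[OF assms(1), of "take i xs" "drop (Suc i) xs"] assms(2,3)
  by (simp add: upd_conv_take_nth_drop)

lemma permute_list_update:
  assumes \<tau>: "\<tau> permutes {..<length xs}" and i: "i < length xs"
  shows "permute_list \<tau> (xs[i := x]) = (permute_list \<tau> xs)[Hilbert_Choice.inv \<tau> i := x]"
proof (rule nth_equalityI)
  fix j assume "j < length (permute_list \<tau> (xs[i := x]))"
  then have j: "j < length xs" by simp
  have "\<tau> j < length xs" using permutes_in_image[OF \<tau>, of j] j by simp
  moreover have "(\<tau> j = i) = (j = Hilbert_Choice.inv \<tau> i)"
    using permutes_inverses[OF \<tau>] by metis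
  ultimately show "permute_list \<tau> (xs[i := x]) ! j = (permute_list \<tau> xs)[Hilbert_Choice.inv \<tau> i := x] ! j"
    using j \<tau> by (auto simp: permute_list_nth nth_list_update)
qed simp

lemma linear_signed:
  assumes "Vector_Spaces.linear s sv g"
  shows "Vector_Spaces.linear s sv (\<lambda>x. signed b (g x))"
proof -
  interpret vector_space sv using assms by (simp add: Vector_Spaces.linear_iff)
  show ?thesis using assms by (auto simp: Vector_Spaces.linear_iff signed_def)
qed

lemma linear_sum:
  assumes "vector_space s" "vector_space sv" "\<And>i. i \<in> A \<Longrightarrow> Vector_Spaces.linear s sv (g i)"
  shows "Vector_Spaces.linear s sv (\<lambda>x. \<Sum>i\<in>A. g i x)"
proof -
  interpret vector_space sv by fact
  show ?thesis using assms by (auto simp: Vector_Spaces.linear_iff sum.distrib scale_sum_right)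
qed

lemma linear_alt_sum:
  assumes vs: "vector_space s" "vector_space sv" and F: "multilin s sv n F" and xs: "length xs = n" "i < n"
  shows "Vector_Spaces.linear s sv (\<lambda>x. alt_sum F (xs[i := x]))"
  unfolding alt_sum_def length_list_update
proof (intro linear_sum vs linear_signed)
  fix \<tau> assume "\<tau> \<in> {\<tau>. \<tau> permutes {..<length xs}}"
  then have \<tau>: "\<tau> permutes {..<length xs}" by simp
  have "Hilbert_Choice.inv \<tau> i < n"
    using permutes_in_image[OF permutes_inv[OF \<tau>], of i] xs by simp
  then show "Vector_Spaces.linear s sv (\<lambda>x. F (permute_list \<tau> (xs[i := x])))"
    using xs by (simp add: permute_list_update[OF \<tau>] multilin_list_update[OF F])
qed

lemma multilin_pairs:
  assumes R1: "\<And>y. Vector_Spaces.linear s s' (\<lambda>x. R x y)" and R2: "\<And>x. Vector_Spaces.linear s s' (\<lambda>y. R x y)"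
  shows "multilin s' sv p f \<Longrightarrow> multilin s sv (2 * p) (\<lambda>ys. f (pairs R ys))"
proof (induction p arbitrary: f)
  case 0
  then show ?case by (simp add: multilin_def)
next
  case (Suc p)
  show ?case unfolding multilin_def
  proof (intro allI impI)
    fix us vs :: "'a list" assume len: "length us + length vs + 1 = 2 * Suc p"
    have head: "Vector_Spaces.linear s' sv (\<lambda>n. f (n # ws))" if "length ws = p" for ws
      using multilinD[OF Suc.prems, of "[]" ws] that by simp
    consider "us = []" | a where "us = [a]" | a b us' where "us = a # b # us'"
      by (metis list.exhaust)
    then show "Vector_Spaces.linear s sv (\<lambda>x. f (pairs R (us @ x # vs)))"
    proof cases
      case 1
      then obtain w ws where vs: "vs = w # ws" using len by (cases vs) auto
      show ?thesis
        using Vector_Spaces.linear_compose[OF R1[of w] head[of "pairs R ws"]] len vs 1 by (simp add: o_def)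
    next
      case 2
      show ?thesis
        using Vector_Spaces.linear_compose[OF R2[of a] head[of "pairs R vs"]] len 2 by (simp add: o_def)
    next
      case 3
      show ?thesis
        using multilinD[OF Suc.IH[OF multilin_Cons[OF Suc.prems]], of us' vs] len 3 by simp
    qed
  qed
qed

lemma multilin_Cons_pairs:
  assumes R: "\<And>y. Vector_Spaces.linear s s' (\<lambda>x. R x y)" "\<And>x. Vector_Spaces.linear s s' (\<lambda>y. R x y)"
    and \<alpha>: "Vector_Spaces.linear s s' \<alpha>" and f: "multilin s' sv (Suc m) f"
  shows "multilin s sv (Suc (2 * m)) (uncons (\<lambda>z ys. f (\<alpha> z # pairs R ys)))"
  unfolding multilin_def
proof (intro allI impI)
  fix us vs :: "'a list" assume len: "length us + length vs + 1 = Suc (2 * m)"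
  show "Vector_Spaces.linear s sv (\<lambda>x. uncons (\<lambda>z ys. f (\<alpha> z # pairs R ys)) (us @ x # vs))"
  proof (cases us)
    case Nil
    then have "Vector_Spaces.linear s' sv (\<lambda>n. f (n # pairs R vs))"
      using multilinD[OF f, of "[]" "pairs R vs"] len by simp
    from Vector_Spaces.linear_compose[OF \<alpha> this] Nil show ?thesis by (simp add: o_def)
  next
    case (Cons a us')
    then show ?thesis
      using multilinD[OF multilin_pairs[OF R multilin_Cons[OF f]], of us' vs] len by simp
  qed
qed

section \<open>Polynomial curves and their weak integrals\<close>

text \<open>Formal differentiation of polynomial curves in a space without topology: a curve and its
  derivative are built together from monomials. In \<open>mono\<close> the truncated exponent at
  \<open>k = 0\<close> is harmless, as its coefficient is 0.\<close>

inductive poly_curve_deriv ::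
  "('k::real_normed_field \<Rightarrow> 'v::ab_group_add \<Rightarrow> 'v) \<Rightarrow> (real \<Rightarrow> 'v) \<Rightarrow> (real \<Rightarrow> 'v) \<Rightarrow> bool" for sv where
  mono: "poly_curve_deriv sv (\<lambda>t. sv (of_real t ^ k) v) (\<lambda>t. sv (of_nat k * of_real t ^ (k - 1)) v)"
| add: "poly_curve_deriv sv g g' \<Longrightarrow> poly_curve_deriv sv h h' \<Longrightarrow> poly_curve_deriv sv (\<lambda>t. g t + h t) (\<lambda>t. g' t + h' t)"

lemma poly_curve_deriv_const:
  assumes "vector_space sv"
  shows "poly_curve_deriv sv (\<lambda>t. v) (\<lambda>t. 0)"
proof -
  interpret vector_space sv by fact
  show ?thesis using poly_curve_deriv.mono[of sv 0 v] by simp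
qed

lemma poly_curve_deriv_linear:
  assumes T: "Vector_Spaces.linear s sv T" and g: "poly_curve_deriv s g g'"
  shows "poly_curve_deriv sv (\<lambda>t. T (g t)) (\<lambda>t. T (g' t))"
  using g
proof induction
  case (mono k v)
  show ?case using T poly_curve_deriv.mono[of sv k "T v"] by (simp add: Vector_Spaces.linear_iff)
next
  case (add g g' h h')
  show ?case using T poly_curve_deriv.add[OF add.IH] by (simp add: Vector_Spaces.linear_iff)
qed

lemma poly_curve_deriv_signed:
  assumes "vector_space sv" "poly_curve_deriv sv g g'"
  shows "poly_curve_deriv sv (\<lambda>t. signed b (g t)) (\<lambda>t. signed b (g' t))"
proof (rule poly_curve_deriv_linear[OF _ assms(2)])
  interpret vector_space sv by fact
  show "Vector_Spaces.linear sv sv (signed b)"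
    using assms(1) by (auto simp: Vector_Spaces.linear_iff signed_def)
qed

lemma poly_curve_deriv_sum:
  assumes "vector_space sv" "\<And>i. i \<in> A \<Longrightarrow> poly_curve_deriv sv (g i) (g' i)"
  shows "poly_curve_deriv sv (\<lambda>t. \<Sum>i\<in>A. g i t) (\<lambda>t. \<Sum>i\<in>A. g' i t)"
  using assms(2)
  by (induction A rule: infinite_finite_induct)
    (auto intro: poly_curve_deriv_const[OF assms(1)] poly_curve_deriv.add)

lemma poly_curve_deriv_alt_sum:
  assumes "vector_space sv" "\<And>ys. length ys = length xs \<Longrightarrow> poly_curve_deriv sv (\<lambda>t. F t ys) (\<lambda>t. F' t ys)"
  shows "poly_curve_deriv sv (\<lambda>t. alt_sum (F t) xs) (\<lambda>t. alt_sum (F' t) xs)"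
  unfolding alt_sum_def
  by (intro poly_curve_deriv_sum poly_curve_deriv_signed assms) simp

text \<open>The product rule for a monomial factor, to which the general Leibniz rule for
  multilinear maps is reduced.\<close>

lemma poly_curve_deriv_mult:
  assumes "vector_space sv" and g: "poly_curve_deriv sv g g'"
  shows "poly_curve_deriv sv (\<lambda>t. sv (of_real t ^ k) (g t))
    (\<lambda>t. sv (of_nat k * of_real t ^ (k - 1)) (g t) + sv (of_real t ^ k) (g' t))"
  using g
proof induction
  interpret vector_space sv by fact
  case (mono j v)
  have "of_nat (k + j) * (of_real t :: 'a) ^ (k + j - 1) =
     of_nat k * of_real t ^ (k - 1) * of_real t ^ j + of_real t ^ k * (of_nat j * of_real t ^ (j - 1))" for t
    by (cases k; cases j) (simp_all add: algebra_simps power_add)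
  then show ?case
    using poly_curve_deriv.mono[of sv "k + j" v]
    by (simp add: scale_left_distrib[symmetric] power_add)
next
  interpret vector_space sv by fact
  case (add g g' h h')
  show ?case using poly_curve_deriv.add[OF add.IH] by (simp add: scale_right_distrib algebra_simps)
qed

text \<open>The outer induction is over the slots, the inner one over the construction of the curve
  in the first slot. There a monomial t^k c lets t^k be pulled out as a scalar, leaving a
  multilinear map with \<open>c\<close> fixed.\<close>

lemma poly_curve_deriv_multilin:
  assumes sv: "vector_space sv"
  shows "multilin s sv (length gs) f \<Longrightarrow> length gs' = length gs \<Longrightarrow>
    (\<And>i. i < length gs \<Longrightarrow> poly_curve_deriv s (gs ! i) (gs' ! i)) \<Longrightarrow>
    poly_curve_deriv sv (\<lambda>t. f (map (\<lambda>g. g t) gs))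
      (\<lambda>t. \<Sum>i<length gs. f ((map (\<lambda>g. g t) gs)[i := (gs' ! i) t]))"
proof (induction gs arbitrary: f gs')
  case Nil
  then show ?case by (simp add: poly_curve_deriv_const[OF sv])
next
  case (Cons g gs)
  interpret vector_space sv by (rule sv)
  obtain g' gt where gs': "gs' = g' # gt" using Cons.prems(2) by (cases gs') auto
  have gt: "length gt = length gs" "\<And>i. i < length gs \<Longrightarrow> poly_curve_deriv s (gs ! i) (gt ! i)"
    using Cons.prems(2) Cons.prems(3)[of "Suc _"] by (auto simp: gs')
  have f: "multilin s sv (Suc (length gs)) f" using Cons.prems(1) by simp
  let ?m = "\<lambda>t. map (\<lambda>g. g t) gs"
  have "poly_curve_deriv s g g'" using Cons.prems(3)[of 0] gs' by simp
  then have "poly_curve_deriv sv (\<lambda>t. f (g t # ?m t))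
      (\<lambda>t. f (g' t # ?m t) + (\<Sum>i<length gs. f (g t # (?m t)[i := (gt ! i) t])))"
  proof induction
    case (mono k c)
    show ?case
      using poly_curve_deriv_mult[OF sv Cons.IH[OF multilin_Cons[OF f, of c] gt], of k]
      by (simp add: multilin_head[OF f] scale_sum_right)
  next
    case (add g g' h h')
    show ?case
      using poly_curve_deriv.add[OF add.IH] by (simp add: multilin_head[OF f] sum.distrib algebra_simps)
  qed
  then show ?case by (simp add: gs' sum.lessThan_Suc_shift del: sum.lessThan_Suc)
qed

section \<open>Weak integration over the unit interval\<close>

definition weak_integral ::
  "('k::real_normed_field \<Rightarrow> 'v::ab_group_add \<Rightarrow> 'v) \<Rightarrow> (real \<Rightarrow> 'v) \<Rightarrow> 'v \<Rightarrow> bool" where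
  "weak_integral sv \<gamma> v \<longleftrightarrow> (\<forall>l :: 'v \<Rightarrow> 'k. Vector_Spaces.linear sv (*) l \<longrightarrow>
     ((\<lambda>t. l (\<gamma> t)) has_integral l v) {0..1})"

lemma vector_space_mult: "vector_space ((*) :: 'k::field \<Rightarrow> 'k \<Rightarrow> 'k)"
  by unfold_locales (auto simp: algebra_simps)

text \<open>If \<open>v - w\<close> is nonzero it is linearly independent, hence part of a basis,
  and some functional takes the value 1 on it.\<close>

lemma functionals_separate:
  fixes sv :: "'k::field \<Rightarrow> 'v::ab_group_add \<Rightarrow> 'v"
  assumes "vector_space sv" "\<And>l. Vector_Spaces.linear sv (*) l \<Longrightarrow> l v = l w"
  shows "v = w"
proof (rule ccontr)
  interpret V: vector_space sv by fact
  interpret P: vector_space_pair sv "(*) :: 'k \<Rightarrow> 'k \<Rightarrow> 'k"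
    by (intro vector_space_pair.intro assms vector_space_mult)
  assume "v \<noteq> w"
  then have "V.independent {v - w}" by simp
  from P.linear_independent_extend[OF this, of "\<lambda>_. 1"]
  obtain l where l: "Vector_Spaces.linear sv (*) l" "l (v - w) = 1" by auto
  have "l ((v - w) + w) = l (v - w) + l w" using l(1) by (simp only: Vector_Spaces.linear_iff)
  then have "l v = 1 + l w" using l(2) by simp
  with assms(2)[OF l(1)] show False by simp
qed

lemma weak_integral_unique:
  assumes "vector_space sv" "weak_integral sv \<gamma> v" "weak_integral sv \<gamma> w"
  shows "v = w"
  by (rule functionals_separate[OF assms(1)])
    (use assms(2,3) in \<open>auto simp: weak_integral_def intro: has_integral_unique\<close>)

text \<open>Every use of the definite description in \<open>integral01\<close> goes through a
  witness of \<open>weak_integral\<close> and its uniqueness.\<close>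

lemma integral01_eq:
  assumes "vector_space sv" "weak_integral sv \<gamma> v"
  shows "integral01 sv \<gamma> = v"
  unfolding integral01_def weak_integral_def[symmetric]
  by (rule the_equality) (use assms weak_integral_unique in blast)+

text \<open>A functional on the target, composed with \<open>T\<close>, is a functional on the
  source.\<close>

lemma weak_integral_linear:
  fixes sv :: "'k::real_normed_field \<Rightarrow> 'v::ab_group_add \<Rightarrow> 'v" and sw :: "'k \<Rightarrow> 'w::ab_group_add \<Rightarrow> 'w"
  assumes T: "Vector_Spaces.linear sv sw T" and g: "weak_integral sv \<gamma> v"
  shows "weak_integral sw (\<lambda>t. T (\<gamma> t)) (T v)"
  unfolding weak_integral_def
proof (intro allI impI)
  fix l :: "'w \<Rightarrow> 'k" assume "Vector_Spaces.linear sw (*) l"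
  from Vector_Spaces.linear_compose[OF T this] have "Vector_Spaces.linear sv (*) (\<lambda>x. l (T x))"
    by (simp add: o_def)
  from g[unfolded weak_integral_def, rule_format, OF this]
  show "((\<lambda>t. l (T (\<gamma> t))) has_integral l (T v)) {0..1}" .
qed

lemma weak_integral_add:
  assumes "weak_integral sv \<gamma> v" "weak_integral sv \<delta> w"
  shows "weak_integral sv (\<lambda>t. \<gamma> t + \<delta> t) (v + w)"
  using assms by (auto simp: weak_integral_def Vector_Spaces.linear_iff intro!: has_integral_add)

lemma weak_integral_zero:
  fixes sv :: "'k::real_normed_field \<Rightarrow> 'v::ab_group_add \<Rightarrow> 'v"
  assumes "vector_space sv"
  shows "weak_integral sv (\<lambda>t. 0) 0"
proof -
  interpret vector_space sv by fact
  have "l 0 = 0" if "Vector_Spaces.linear sv (*) l" for l :: "'v \<Rightarrow> 'k"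
    using that by (metis Vector_Spaces.linear_iff mult_zero_left scale_zero_left)
  then show ?thesis
    unfolding weak_integral_def using has_integral_0 by metis
qed

lemma weak_integral_sum:
  assumes "vector_space sv" "\<And>i. i \<in> A \<Longrightarrow> weak_integral sv (\<gamma> i) (v i)"
  shows "weak_integral sv (\<lambda>t. \<Sum>i\<in>A. \<gamma> i t) (\<Sum>i\<in>A. v i)"
  using assms(2)
  by (induction A rule: infinite_finite_induct)
    (auto intro: weak_integral_zero[OF assms(1)] weak_integral_add)

lemma weak_integral_monomial:
  fixes sv :: "'k::real_normed_field \<Rightarrow> 'v::ab_group_add \<Rightarrow> 'v"
  assumes "(h has_integral a) {0..1::real}"
  shows "weak_integral sv (\<lambda>t. sv (of_real (h t)) v) (sv (of_real a) v)"
  unfolding weak_integral_def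
proof (intro allI impI)
  fix l :: "'v \<Rightarrow> 'k" assume l: "Vector_Spaces.linear sv (*) l"
  have "((\<lambda>t. h t *\<^sub>R l v) has_integral a *\<^sub>R l v) {0..1}"
    by (rule has_integral_scaleR_left[OF assms])
  with l show "((\<lambda>t. l (sv (of_real (h t)) v)) has_integral l (sv (of_real a) v)) {0..1}"
    by (simp add: Vector_Spaces.linear_iff scaleR_conv_of_real)
qed

lemma has_integral_power01: "((\<lambda>t. t ^ k) has_integral 1 / real (Suc k)) {0..1::real}"
proof -
  have "((\<lambda>t. t ^ k) has_integral 1 ^ Suc k / real (Suc k) - 0 ^ Suc k / real (Suc k)) {0..1::real}"
    by (rule fundamental_theorem_of_calculus)
      (auto intro!: derivative_eq_intros simp: has_real_derivative_iff_has_vector_derivative[symmetric] simp del: power_Suc)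
  then show ?thesis by simp
qed

lemma poly_curve_weak_integrable:
  assumes "poly_curve_deriv sv g g'"
  shows "\<exists>v. weak_integral sv g v"
  using assms
proof induction
  case (mono k v)
  show ?case using weak_integral_monomial[OF has_integral_power01, of sv k v] by auto
next
  case (add g g' h h')
  then show ?case by (blast intro: weak_integral_add)
qed

lemma weak_integral_deriv:
  assumes sv: "vector_space sv" and "poly_curve_deriv sv g g'"
  shows "weak_integral sv g' (g 1 - g 0)"
  using assms(2)
proof induction
  interpret vector_space sv by (rule sv)
  case (mono k v)
  \<comment> \<open>Since \<open>0 ^ 0 = 1\<close>, the value \<open>1 - 0 ^ k\<close> is also right
    for constant curves, whose derivative is 0.\<close>
  have "((\<lambda>t. real k * t ^ (k - 1)) has_integral 1 - 0 ^ k) {0..1}"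
  proof (cases k)
    case (Suc j)
    then show ?thesis using has_integral_mult_right[OF has_integral_power01[of j], of "real k"] by simp
  qed simp
  from weak_integral_monomial[OF this, of sv v] show ?case
    by (simp add: scale_left_diff_distrib)
next
  case (add g g' h h')
  from weak_integral_add[OF add.IH] show ?case by (simp add: algebra_simps)
qed

section \<open>The geometry of an extension\<close>

lemma additive_diff:
  fixes T :: "'a::ab_group_add \<Rightarrow> 'b::ab_group_add"
  assumes "\<And>v w. T (v + w) = T v + T w"
  shows "T (v - w) = T v - T w" "T (- v) = - T v" "T 0 = 0"
proof -
  show 0: "T 0 = 0" using assms[of 0 0] by simp
  show n: "T (- v) = - T v" for v using assms[of v "- v"] 0 by (simp add: eq_neg_iff_add_eq_0 add.commute)
  show "T (v - w) = T v - T w" using assms[of v "- w"] n by simp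
qed

lemma lie_algebraD:
  assumes "lie_algebra L"
  shows "vector_space (lscale L)"
    and "lbr L x (y + z) = lbr L x y + lbr L x z" "lbr L (x + y) z = lbr L x z + lbr L y z"
    and "lbr L x (lscale L c y) = lscale L c (lbr L x y)" "lbr L (lscale L c x) y = lscale L c (lbr L x y)"
    and "lbr L y x = - lbr L x y"
    and "lbr L x (lbr L y z) + lbr L y (lbr L z x) + lbr L z (lbr L x y) = 0"
proof -
  note * = assms[unfolded lie_algebra_def Vector_Spaces.linear_iff]
  show add: "lbr L x (y + z) = lbr L x y + lbr L x z" "lbr L (x + y) z = lbr L x z + lbr L y z" for x y z
    using * by simp_all
  have "lbr L (x + y) (x + y) = 0" "lbr L x x = 0" "lbr L y y = 0" using * by simp_all
  then show "lbr L y x = - lbr L x y" unfolding add by (simp add: eq_neg_iff_add_eq_0 add.commute)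
qed (use assms in \<open>simp_all add: lie_algebra_def Vector_Spaces.linear_iff\<close>)

lemma lie_moduleD:
  assumes "lie_module L V"
  shows "vector_space (mscale V)" "mact V x (v + w) = mact V x v + mact V x w"
    and "mact V x (mscale V c v) = mscale V c (mact V x v)"
    and "Vector_Spaces.linear (mscale V) (mscale V) (mact V x)"
  using assms by (simp_all add: lie_module_def Vector_Spaces.linear_iff)

locale lie_extension_module =
  fixes E :: "('k::real_normed_field, 'n::ab_group_add, 'h::ab_group_add, 'g::ab_group_add) lie_ext"
    and V :: "('k, 'g, 'v::ab_group_add) lie_mod"
  assumes extension: "lie_extension E" and module: "lie_module (quo_alg E) V"
begin

abbreviation "sv \<equiv> mscale V"
abbreviation "sn \<equiv> lscale (ker_alg E)"

lemma algebras: "lie_algebra (ker_alg E)" "lie_algebra (tot_alg E)" "lie_algebra (quo_alg E)"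
  using extension by (simp_all add: lie_extension_def)

lemmas vn = lie_algebraD(1)[OF algebras(1)] and vh = lie_algebraD(1)[OF algebras(2)]
  and vg = lie_algebraD(1)[OF algebras(3)] and vv = lie_moduleD(1)[OF module]

sublocale N: vector_space "lscale (ker_alg E)" by (rule vn)
sublocale H: vector_space "lscale (tot_alg E)" by (rule vh)
sublocale G: vector_space "lscale (quo_alg E)" by (rule vg)
sublocale V: vector_space "mscale V" by (rule vv)

lemmas lbr_add = lie_algebraD(2,3)[OF algebras(1)] lie_algebraD(2,3)[OF algebras(2)] lie_algebraD(2,3)[OF algebras(3)]
lemmas lbr_scale = lie_algebraD(4,5)[OF algebras(1)] lie_algebraD(4,5)[OF algebras(2)] lie_algebraD(4,5)[OF algebras(3)]
lemmas lbr_anti = lie_algebraD(6)[OF algebras(1)] lie_algebraD(6)[OF algebras(2)] lie_algebraD(6)[OF algebras(3)]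
lemmas jacobi = lie_algebraD(7)[OF algebras(2)] lie_algebraD(7)[OF algebras(3)]

lemma lbr_diff: "lbr (tot_alg E) x (y - z) = lbr (tot_alg E) x y - lbr (tot_alg E) x z"
    "lbr (tot_alg E) (y - z) x = lbr (tot_alg E) y x - lbr (tot_alg E) z x"
  by (rule additive_diff, rule lbr_add)+

lemma incl_add: "incl E (x + y) = incl E x + incl E y"
  and incl_scale: "incl E (sn c x) = lscale (tot_alg E) c (incl E x)"
  and incl_lbr: "incl E (lbr (ker_alg E) x y) = lbr (tot_alg E) (incl E x) (incl E y)"
  and proj_add: "proj E (h + h') = proj E h + proj E h'"
  and proj_lbr: "proj E (lbr (tot_alg E) h h') = lbr (quo_alg E) (proj E h) (proj E h')"
  and proj_incl: "proj E (incl E x) = 0"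
  and incl_inj: "incl E x = incl E y \<longleftrightarrow> x = y"
  using extension by (auto simp: lie_extension_def lie_hom_def Vector_Spaces.linear_iff inj_def)

lemmas incl_diff = additive_diff[of "incl E", OF incl_add] and proj_diff = additive_diff[of "proj E", OF proj_add]

lemma incl_the_inv: "proj E h = 0 \<Longrightarrow> incl E (the_inv (incl E) h) = h"
  using extension by (intro f_the_inv_into_f) (auto simp: lie_extension_def)

section \<open>Curvature and covariant derivative of a section\<close>

definition curv :: "('g \<Rightarrow> 'h) \<Rightarrow> 'g \<Rightarrow> 'g \<Rightarrow> 'n" where
  "curv \<sigma> x y = curvature E \<sigma> [x, y]"

text \<open>The covariant derivative on the kernel induced by the section; it represents the bracket
  of the quotient only up to the adjoint action of the curvature.\<close>

definition dact :: "('g \<Rightarrow> 'h) \<Rightarrow> 'g \<Rightarrow> 'n \<Rightarrow> 'n" where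
  "dact \<sigma> x n = the_inv (incl E) (lbr (tot_alg E) (\<sigma> x) (incl E n))"

lemma incl_dact: "incl E (dact \<sigma> x n) = lbr (tot_alg E) (\<sigma> x) (incl E n)"
  unfolding dact_def
  by (rule incl_the_inv) (simp add: proj_lbr proj_incl additive_diff(3)[of "lbr (quo_alg E) _", OF lbr_add(5)])

lemma section_add: "linear_section E \<sigma> \<Longrightarrow> \<sigma> (x + y) = \<sigma> x + \<sigma> y"
  and section_scale: "linear_section E \<sigma> \<Longrightarrow> \<sigma> (lscale (quo_alg E) c x) = lscale (tot_alg E) c (\<sigma> x)"
  and section_proj: "linear_section E \<sigma> \<Longrightarrow> proj E (\<sigma> x) = x"
  by (simp_all add: linear_section_def Vector_Spaces.linear_iff)

lemma incl_curv:
  "linear_section E \<sigma> \<Longrightarrow> incl E (curv \<sigma> x y) = lbr (tot_alg E) (\<sigma> x) (\<sigma> y) - \<sigma> (lbr (quo_alg E) x y)"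
  unfolding curv_def curvature_def
  by (simp, rule incl_the_inv) (simp add: proj_diff proj_lbr section_proj)

lemma curv_anti: "linear_section E \<sigma> \<Longrightarrow> curv \<sigma> y x = - curv \<sigma> x y"
  unfolding incl_inj[symmetric] incl_diff
  by (simp add: incl_curv lbr_anti(2)[of "\<sigma> y"] lbr_anti(3)[of y] additive_diff(2)[of \<sigma>, OF section_add])

lemma curv_linear: "linear_section E \<sigma> \<Longrightarrow> Vector_Spaces.linear (lscale (quo_alg E)) sn (\<lambda>x. curv \<sigma> x y)"
  unfolding Vector_Spaces.linear_iff
  by (auto simp: vg vn incl_inj[symmetric] incl_add incl_scale incl_curv lbr_add lbr_scale section_add section_scale
      H.scale_right_diff_distrib)

lemma curv_linear_right:
  assumes "linear_section E \<sigma>"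
  shows "Vector_Spaces.linear (lscale (quo_alg E)) sn (\<lambda>x. curv \<sigma> y x)"
  using curv_linear[OF assms, of y] by (simp add: Vector_Spaces.linear_iff curv_anti[OF assms, of y])

text \<open>Checked after applying \<open>incl\<close>. The triple brackets of section values cancel
  by the Jacobi identity of the total algebra, the terms with \<sigma> of a double bracket by that
  of the quotient, and the mixed terms occur on both sides.\<close>

lemma curv_bianchi:
  assumes \<sigma>: "linear_section E \<sigma>"
  shows "dact \<sigma> x (curv \<sigma> a b) + dact \<sigma> a (curv \<sigma> b x) + dact \<sigma> b (curv \<sigma> x a) =
    curv \<sigma> (lbr (quo_alg E) x a) b + curv \<sigma> (lbr (quo_alg E) a b) x + curv \<sigma> (lbr (quo_alg E) b x) a"
proof -
  let ?b = "lbr (tot_alg E)" and ?g = "lbr (quo_alg E)"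
  have 1: "\<sigma> (?g (?g x a) b) + \<sigma> (?g (?g a b) x) + \<sigma> (?g (?g b x) a) = 0"
  proof -
    have "?g (?g x a) b + ?g (?g a b) x + ?g (?g b x) a = - (?g b (?g x a) + ?g x (?g a b) + ?g a (?g b x))"
      by (subst lbr_anti(3)[of "?g x a" b], subst lbr_anti(3)[of "?g a b" x], subst lbr_anti(3)[of "?g b x" a]) simp
    also have "\<dots> = 0" using jacobi(2)[of b x a] by simp
    finally show ?thesis using additive_diff(3)[of \<sigma>, OF section_add[OF \<sigma>]] by (simp flip: section_add[OF \<sigma>])
  qed
  have 2: "?b (\<sigma> x) (?b (\<sigma> a) (\<sigma> b)) + ?b (\<sigma> a) (?b (\<sigma> b) (\<sigma> x)) + ?b (\<sigma> b) (?b (\<sigma> x) (\<sigma> a)) = 0"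
    by (rule jacobi)
  have 3: "?b (\<sigma> (?g u v)) (\<sigma> w) = - ?b (\<sigma> w) (\<sigma> (?g u v))" for u v w
    by (rule lbr_anti)
  show ?thesis
    unfolding incl_inj[symmetric] incl_add incl_dact incl_curv[OF \<sigma>] lbr_diff 3
    using 1 2 by (simp add: algebra_simps)
qed

lemma two_torsion: "(v::'v) + v = 0 \<Longrightarrow> v = 0"
  and three_torsion: "(v::'v) + v + v = 0 \<Longrightarrow> v = 0"
proof -
  have "v + v = sv 2 v" by (metis V.scale_left_distrib V.scale_one one_add_one)
  moreover have "v + v + v = sv 3 v"
    using V.scale_left_distrib[of 2 1 v] \<open>v + v = sv 2 v\<close> by simp
  ultimately show "v + v = 0 \<Longrightarrow> v = 0" "v + v + v = 0 \<Longrightarrow> v = 0" by simp_all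
qed

lemma sym_invD: "f \<in> sym_inv E V p \<sigma> \<Longrightarrow> f \<in> sym_maps sn sv p"
  by (simp add: sym_inv_def)

lemma sym_maps_multilin: "f \<in> sym_maps sn sv p \<Longrightarrow> multilin sn sv p f"
  unfolding multilin_def using sym_map_linear[OF vn vv] by blast

lemma sym_inv_equivariant_curvature:
  assumes \<sigma>: "linear_section E \<sigma>" and f: "f \<in> sym_inv E V p \<sigma>"
  shows "equivariant_curvature (quo_alg E) V (curv \<sigma>) (dact \<sigma>) p f"
proof (rule equivariant_curvature.intro)
  show "curv \<sigma> (x + y) z = curv \<sigma> x z + curv \<sigma> y z" for x y z
    using curv_linear[OF \<sigma>] by (simp add: Vector_Spaces.linear_iff)
  show "f us = f ws" if "mset us = mset ws" for us ws
    using that by (rule sym_map_mset[OF vn vv sym_invD[OF f]])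
  show "f ((c + d) # us) = f (c # us) + f (d # us)" if "Suc (length us) = p" for c d us
    using that by (rule sym_map_add[OF vn vv sym_invD[OF f]])
  show "mact V x (f us) = (\<Sum>i<p. f (us[i := dact \<sigma> x (us ! i)]))" if "length us = p" for x us
    using f that by (simp add: sym_inv_def dact_def)
qed (fact vv lie_moduleD(2)[OF module] lbr_anti(3) curv_anti[OF \<sigma>] curv_bianchi[OF \<sigma>] two_torsion three_torsion)+

end

section \<open>Cohomology classes\<close>

lemma alt_maps_alt_sum:
  assumes vs: "vector_space s" "vector_space sv" and F: "multilin s sv n F"
    and tor: "\<And>v::'b::ab_group_add. v + v = 0 \<Longrightarrow> v = 0"
    and \<omega>: "\<And>xs. \<omega> xs = (if length xs = n then sv c (alt_sum F xs) else (0::'b))"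
  shows "\<omega> \<in> alt_maps s sv n"
proof -
  interpret V: vector_space sv by (rule vs)
  have "Vector_Spaces.linear s sv (\<lambda>x. sv c (alt_sum F (xs[i := x])))" if "length xs = n" "i < n" for xs i
    using linear_alt_sum[OF vs F that]
    by (simp add: Vector_Spaces.linear_iff V.scale_right_distrib mult.commute)
  moreover have "alt_sum F xs = 0" if "\<not> distinct xs" for xs
    by (rule alt_sum_not_distinct[OF that tor])
  ultimately show ?thesis by (simp add: alt_maps_def multilinear_maps_def \<omega>)
qed

lemma alt_maps_add:
  assumes "vector_space sv" "\<omega> \<in> alt_maps s sv n" "\<eta> \<in> alt_maps s sv n"
  shows "(\<lambda>xs. \<omega> xs + \<eta> xs) \<in> alt_maps s sv n"
proof -
  interpret vector_space sv by fact
  show ?thesis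
    using assms(2,3) unfolding alt_maps_def multilinear_maps_def Vector_Spaces.linear_iff
    by (auto simp: scale_right_distrib)
qed

lemma alt_maps_scale:
  assumes "vector_space sv" "\<omega> \<in> alt_maps s sv n"
  shows "(\<lambda>xs. sv c (\<omega> xs)) \<in> alt_maps s sv n"
proof -
  interpret vector_space sv by fact
  show ?thesis
    using assms(2) unfolding alt_maps_def multilinear_maps_def Vector_Spaces.linear_iff
    by (auto simp: scale_right_distrib mult.commute)
qed

lemma alt_maps_zero:
  assumes "vector_space s" "vector_space sv"
  shows "(\<lambda>xs. 0) \<in> alt_maps s sv n"
proof -
  interpret vector_space sv by fact
  show ?thesis using assms by (simp add: alt_maps_def multilinear_maps_def Vector_Spaces.linear_iff)
qed

context
  fixes L :: "('k::field, 'g::ab_group_add) lie_alg" and V :: "('k, 'g, 'v::ab_group_add) lie_mod"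
  assumes L: "vector_space (lscale L)" and M: "lie_module L V"
begin

interpretation V: vector_space "mscale V" by (rule lie_moduleD(1)[OF M])

lemma ce_diff_add: "ce_diff L V (\<lambda>xs. \<omega> xs + \<eta> xs) = (\<lambda>xs. ce_diff L V \<omega> xs + ce_diff L V \<eta> xs)"
  by (simp add: ce_diff_def lie_moduleD(2)[OF M] V.scale_right_distrib sum.distrib case_prod_beta add_ac)

lemma ce_diff_scale: "ce_diff L V (\<lambda>xs. mscale V c (\<omega> xs)) = (\<lambda>xs. mscale V c (ce_diff L V \<omega> xs))"
  by (simp add: ce_diff_def lie_moduleD(3)[OF M] V.scale_right_distrib V.scale_sum_right case_prod_beta mult.commute)

lemma ce_diff_zero: "ce_diff L V (\<lambda>xs. 0) = (\<lambda>xs. 0)"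
  using ce_diff_scale[of 0 "\<lambda>xs. 0"] by simp

lemma coboundaries_add:
  "\<omega> \<in> coboundaries L V p \<Longrightarrow> \<eta> \<in> coboundaries L V p \<Longrightarrow> (\<lambda>xs. \<omega> xs + \<eta> xs) \<in> coboundaries L V p"
  by (auto simp: coboundaries_def ce_diff_add[symmetric] intro!: imageI alt_maps_add V.vector_space_axioms split: if_splits)

lemma coboundaries_scale:
  "\<omega> \<in> coboundaries L V p \<Longrightarrow> (\<lambda>xs. mscale V c (\<omega> xs)) \<in> coboundaries L V p"
  by (auto simp: coboundaries_def ce_diff_scale[symmetric] intro!: imageI alt_maps_scale V.vector_space_axioms split: if_splits)

lemma coboundaries_zero: "(\<lambda>xs. 0) \<in> coboundaries L V p"
  using imageI[OF alt_maps_zero[OF L V.vector_space_axioms], of "ce_diff L V" "p - 1"]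
  by (simp add: coboundaries_def ce_diff_zero)

lemma cocycles_add:
  "\<omega> \<in> cocycles L V p \<Longrightarrow> \<eta> \<in> cocycles L V p \<Longrightarrow> (\<lambda>xs. \<omega> xs + \<eta> xs) \<in> cocycles L V p"
  by (simp add: cocycles_def ce_diff_add alt_maps_add V.vector_space_axioms)

lemma cocycles_scale:
  "\<omega> \<in> cocycles L V p \<Longrightarrow> (\<lambda>xs. mscale V c (\<omega> xs)) \<in> cocycles L V p"
  by (simp add: cocycles_def ce_diff_scale alt_maps_scale V.vector_space_axioms)

lemma equiv_coh_rel: "equiv (cocycles L V p) (coh_rel L V p)"
proof (rule equivI)
  show "coh_rel L V p \<subseteq> cocycles L V p \<times> cocycles L V p" by (auto simp: coh_rel_def)
  show "refl_on (cocycles L V p) (coh_rel L V p)"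
    by (auto simp: refl_on_def coh_rel_def coboundaries_zero)
  show "sym (coh_rel L V p)"
  proof (rule symI)
    fix \<omega> \<eta> assume "(\<omega>, \<eta>) \<in> coh_rel L V p"
    then show "(\<eta>, \<omega>) \<in> coh_rel L V p"
      using coboundaries_scale[of "\<lambda>xs. \<omega> xs - \<eta> xs" p "-1"] by (simp add: coh_rel_def)
  qed
  show "trans (coh_rel L V p)"
  proof (rule transI)
    fix \<omega> \<eta> \<zeta> assume "(\<omega>, \<eta>) \<in> coh_rel L V p" "(\<eta>, \<zeta>) \<in> coh_rel L V p"
    then show "(\<omega>, \<zeta>) \<in> coh_rel L V p"
      using coboundaries_add[of "\<lambda>xs. \<omega> xs - \<eta> xs" p "\<lambda>xs. \<eta> xs - \<zeta> xs"] by (simp add: coh_rel_def)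
  qed
qed

lemma coh_class_eq: "(\<omega>, \<eta>) \<in> coh_rel L V p \<Longrightarrow> coh_class L V p \<omega> = coh_class L V p \<eta>"
  unfolding coh_class_def by (rule equiv_class_eq[OF equiv_coh_rel])

lemma coh_class_in_cohomology: "\<omega> \<in> cocycles L V p \<Longrightarrow> coh_class L V p \<omega> \<in> cohomology L V p"
  unfolding coh_class_def cohomology_def by (rule quotientI)

lemma coh_class_self: "\<omega> \<in> cocycles L V p \<Longrightarrow> \<omega> \<in> coh_class L V p \<omega>"
  unfolding coh_class_def by (rule equiv_class_self[OF equiv_coh_rel])

text \<open>All representatives of a class yield the same scaled class, so the union defining
  \<open>coh_scale\<close> collapses to a single set.\<close>

lemma coh_scale_class:
  assumes "\<omega> \<in> cocycles L V p"
  shows "coh_scale L V p c (coh_class L V p \<omega>) = coh_class L V p (\<lambda>xs. mscale V c (\<omega> xs))"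
proof -
  have "coh_class L V p (\<lambda>xs. mscale V c (\<omega>' xs)) = coh_class L V p (\<lambda>xs. mscale V c (\<omega> xs))"
    if "\<omega>' \<in> coh_class L V p \<omega>" for \<omega>'
  proof (rule coh_class_eq[symmetric])
    have "(\<omega>, \<omega>') \<in> coh_rel L V p" using that by (simp add: coh_class_def)
    then show "(\<lambda>xs. mscale V c (\<omega> xs), \<lambda>xs. mscale V c (\<omega>' xs)) \<in> coh_rel L V p"
      using coboundaries_scale[of "\<lambda>xs. \<omega> xs - \<omega>' xs" p c]
      by (simp add: coh_rel_def cocycles_scale V.scale_right_diff_distrib)
  qed
  with coh_class_self[OF assms] show ?thesis unfolding coh_scale_def by blast
qed

lemma coh_add_class:
  assumes "\<omega> \<in> cocycles L V p" "\<eta> \<in> cocycles L V p"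
  shows "coh_add L V p (coh_class L V p \<omega>) (coh_class L V p \<eta>) = coh_class L V p (\<lambda>xs. \<omega> xs + \<eta> xs)"
proof -
  have "coh_class L V p (\<lambda>xs. \<omega>' xs + \<eta>' xs) = coh_class L V p (\<lambda>xs. \<omega> xs + \<eta> xs)"
    if "\<omega>' \<in> coh_class L V p \<omega>" "\<eta>' \<in> coh_class L V p \<eta>" for \<omega>' \<eta>'
  proof (rule coh_class_eq[symmetric])
    have "(\<omega>, \<omega>') \<in> coh_rel L V p" "(\<eta>, \<eta>') \<in> coh_rel L V p" using that by (simp_all add: coh_class_def)
    then show "(\<lambda>xs. \<omega> xs + \<eta> xs, \<lambda>xs. \<omega>' xs + \<eta>' xs) \<in> coh_rel L V p"
      using coboundaries_add[of "\<lambda>xs. \<omega> xs - \<omega>' xs" p "\<lambda>xs. \<eta> xs - \<eta>' xs"]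
      by (simp add: coh_rel_def cocycles_add algebra_simps)
  qed
  with coh_class_self[OF assms(1)] coh_class_self[OF assms(2)] show ?thesis unfolding coh_add_def by blast
qed

end

section \<open>Characteristic cochains\<close>

context lie_extension_module
begin

text \<open>This trades the symmetric algebra for an alternating sum; on lists of the wrong length
  the wedge power is zero, and so is its image under the lift.\<close>

lemma chern_cochain_eq:
  assumes f: "f \<in> sym_maps sn sv p"
  shows "chern_cochain E V p f \<sigma> xs =
    (if length xs = 2 * p then sv (1 / 2 ^ p) (alt_sum (\<lambda>ys. f (pairs (curv \<sigma>) ys)) xs) else 0)"
proof (cases "length xs = 2 * p")
  case True
  have "chern_cochain E V p f \<sigma> xs = sym_lift sn sv p f (sym_wedge_power sn (sym_gen sn \<circ> curvature E \<sigma>) p xs)"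
    by (simp add: chern_cochain_def Let_def)
  also have "\<dots> = sv (1 / 2 ^ p) (alt_sum (\<lambda>ys. f (pairs (\<lambda>x y. curvature E \<sigma> [x, y]) ys)) xs)"
    unfolding sym_wedge_power_curv[OF True] using True
    by (intro sym_lift_alt_sum[OF vn vv f]) simp
  finally show ?thesis using True by (simp add: curv_def[abs_def])
next
  case False
  then have "sym_wedge_power sn (sym_gen sn \<circ> curvature E \<sigma>) p xs = \<zero>\<^bsub>sym_alg sn\<^esub>"
    by (cases p) (auto simp: sym_wedge_def)
  with False show ?thesis
    by (simp add: chern_cochain_def Let_def sym_lift_zero[OF vn vv f])
qed

lemma chern_cochain_in_cochains:
  assumes f: "f \<in> sym_maps sn sv p" and \<sigma>: "linear_section E \<sigma>"
  shows "chern_cochain E V p f \<sigma> \<in> cochains (quo_alg E) V (2 * p)"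
  by (rule alt_maps_alt_sum[OF vg vv multilin_pairs[OF curv_linear[OF \<sigma>] curv_linear_right[OF \<sigma>] sym_maps_multilin[OF f]]])
    (auto simp: chern_cochain_eq[OF f] intro: two_torsion)

text \<open>Equality of cochains is equality on all lists, so lists of the wrong length have to be
  settled as well.\<close>

lemma ce_diff_length:
  assumes "\<And>xs. length xs \<noteq> n \<Longrightarrow> \<omega> xs = 0" "length xs \<noteq> Suc n"
  shows "ce_diff (quo_alg E) V \<omega> xs = 0"
proof -
  have "mact V x 0 = 0" for x by (rule additive_diff(3)[of "mact V x", OF lie_moduleD(2)[OF module]])
  moreover have "\<omega> (nths xs (- {j})) = 0" if "j < length xs" for j
    using that assms by (intro assms(1)) (simp add: nths_Compl_singleton length_del)
  moreover have "\<omega> (y # nths xs (- {i, j})) = 0" if "i < j" "j < length xs" for i j y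
    using that assms by (intro assms(1)) (simp add: nths_Compl_doubleton length_del)
  ultimately show ?thesis by (auto simp: ce_diff_def intro!: sum.neutral)
qed

lemma sym_maps_scale: "f \<in> sym_maps sn sv p \<Longrightarrow> (\<lambda>us. sv c (f us)) \<in> sym_maps sn sv p"
  by (auto simp: sym_maps_def multilinear_maps_def Vector_Spaces.linear_iff V.scale_right_distrib mult.commute)

lemma sym_maps_add: "f \<in> sym_maps sn sv p \<Longrightarrow> g \<in> sym_maps sn sv p \<Longrightarrow> (\<lambda>us. f us + g us) \<in> sym_maps sn sv p"
  by (auto simp: sym_maps_def multilinear_maps_def Vector_Spaces.linear_iff V.scale_right_distrib add_ac)

lemma sym_inv_scale: "f \<in> sym_inv E V p \<sigma> \<Longrightarrow> (\<lambda>us. sv c (f us)) \<in> sym_inv E V p \<sigma>"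
  by (auto simp: sym_inv_def sym_maps_scale lie_moduleD(3)[OF module] V.scale_sum_right)

lemma sym_inv_add: "f \<in> sym_inv E V p \<sigma> \<Longrightarrow> g \<in> sym_inv E V p \<sigma> \<Longrightarrow> (\<lambda>us. f us + g us) \<in> sym_inv E V p \<sigma>"
  by (auto simp: sym_inv_def sym_maps_add lie_moduleD(2)[OF module] sum.distrib)

lemma chern_cochain_cocycle:
  assumes \<sigma>: "linear_section E \<sigma>" and f: "f \<in> sym_inv E V p \<sigma>"
  shows "chern_cochain E V p f \<sigma> \<in> cocycles (quo_alg E) V (2 * p)"
proof -
  note fm = sym_invD[OF f]
  \<comment> \<open>The constant 1/2^p is moved into the symmetric map, which stays
    equivariant.\<close>
  interpret equivariant_curvature "quo_alg E" V "curv \<sigma>" "dact \<sigma>" p "\<lambda>us. sv (1 / 2 ^ p) (f us)"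
    by (rule sym_inv_equivariant_curvature[OF \<sigma> sym_inv_scale[OF f]])
  have "ce_diff (quo_alg E) V (chern_cochain E V p f \<sigma>) xs = 0" for xs
  proof (cases "length xs = Suc (2 * p)")
    case True
    then show ?thesis
      by (rule ce_diff_pairs)
        (simp add: chern_cochain_eq[OF fm] additive_alt_sum[of "sv (1 / 2 ^ p)", OF V.scale_right_distrib])
  next
    case False
    then show ?thesis by (intro ce_diff_length) (simp_all add: chern_cochain_eq[OF fm])
  qed
  then show ?thesis
    by (auto simp: cocycles_def chern_cochain_in_cochains[OF fm \<sigma>])
qed

end

section \<open>Transgression\<close>

locale two_sections = lie_extension_module E V
  for E :: "('k::real_normed_field, 'n::ab_group_add, 'h::ab_group_add, 'g::ab_group_add) lie_ext"
    and V :: "('k, 'g, 'v::ab_group_add) lie_mod" +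
  fixes \<sigma>0 \<sigma>1 :: "'g \<Rightarrow> 'h"
  assumes sec0: "linear_section E \<sigma>0" and sec1: "linear_section E \<sigma>1"
begin

definition \<alpha> :: "'g \<Rightarrow> 'n" where "\<alpha> x = section_diff E \<sigma>0 \<sigma>1 [x]"

abbreviation "interp t \<equiv> section_path E \<sigma>0 \<sigma>1 t"

lemma incl_\<alpha>: "incl E (\<alpha> x) = \<sigma>1 x - \<sigma>0 x"
  unfolding \<alpha>_def section_diff_def
  by (simp, rule incl_the_inv) (simp add: proj_diff section_proj[OF sec0] section_proj[OF sec1])

lemma \<alpha>_linear: "Vector_Spaces.linear (lscale (quo_alg E)) sn \<alpha>"
  unfolding Vector_Spaces.linear_iff incl_inj[symmetric]
  by (simp add: vg vn incl_add incl_scale incl_\<alpha> section_add[OF sec0] section_add[OF sec1]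
      section_scale[OF sec0] section_scale[OF sec1] H.scale_right_diff_distrib)

lemma \<alpha>_neg: "\<alpha> (- x) = - \<alpha> x"
  by (rule additive_diff(2)) (use \<alpha>_linear in \<open>simp add: Vector_Spaces.linear_iff\<close>)

lemma path_eq: "interp t x = \<sigma>0 x + lscale (tot_alg E) (of_real t) (incl E (\<alpha> x))"
  by (simp add: section_path_def incl_\<alpha> H.scale_left_diff_distrib H.scale_right_diff_distrib)

lemma path_0: "interp 0 = \<sigma>0" and path_1: "interp 1 = \<sigma>1"
  by (simp_all add: section_path_def fun_eq_iff)

lemma path_section: "linear_section E (interp t)"
proof -
  have \<alpha>: "\<alpha> (x + y) = \<alpha> x + \<alpha> y" "\<alpha> (lscale (quo_alg E) c x) = sn c (\<alpha> x)" for x y c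
    using \<alpha>_linear by (simp_all add: Vector_Spaces.linear_iff)
  have scale: "proj E (lscale (tot_alg E) c h) = lscale (quo_alg E) c (proj E h)" for c h
    using extension by (simp add: lie_extension_def lie_hom_def Vector_Spaces.linear_iff)
  show ?thesis
    unfolding linear_section_def Vector_Spaces.linear_iff
    by (simp add: vg vh path_eq section_add[OF sec0] section_scale[OF sec0] \<alpha> incl_add incl_scale
        H.scale_right_distrib add_ac mult.commute proj_add section_proj[OF sec0] scale proj_incl)
qed

lemma dact_path: "dact (interp t) x n = dact \<sigma>0 x n + sn (of_real t) (lbr (ker_alg E) (\<alpha> x) n)"
  unfolding incl_inj[symmetric] by (simp add: incl_add incl_scale incl_lbr incl_dact path_eq lbr_add lbr_scale)

lemma dact_path_convex: "dact (interp t) x n = sn (of_real (1 - t)) (dact \<sigma>0 x n) + sn (of_real t) (dact \<sigma>1 x n)"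
  unfolding incl_inj[symmetric] by (simp add: incl_add incl_scale incl_dact section_path_def lbr_add lbr_scale)

text \<open>The covariant exterior derivative of \<alpha> with respect to \<sigma>0.\<close>

definition curv1 :: "'g \<Rightarrow> 'g \<Rightarrow> 'n" where
  "curv1 x y = dact \<sigma>0 x (\<alpha> y) - dact \<sigma>0 y (\<alpha> x) - \<alpha> (lbr (quo_alg E) x y)"

text \<open>The bracket is expanded at \<sigma>0 + t \<alpha>; the terms linear in t collect to
  \<open>curv1\<close>. Writing \<open>t ^ 1\<close> puts every summand into the monomial shape of
  \<open>poly_curve_deriv\<close>.\<close>

lemma curv_path:
  "curv (interp t) x y = curv \<sigma>0 x y + (sn (of_real t ^ 1) (curv1 x y) + sn (of_real t ^ 2) (lbr (ker_alg E) (\<alpha> x) (\<alpha> y)))"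
proof -
  have "lbr (tot_alg E) (incl E (\<alpha> x)) (\<sigma>0 y) = - lbr (tot_alg E) (\<sigma>0 y) (incl E (\<alpha> x))" by (rule lbr_anti)
  then show ?thesis
    unfolding incl_inj[symmetric] incl_curv[OF path_section] incl_add incl_scale incl_lbr incl_curv[OF sec0] curv1_def
      incl_diff incl_dact path_eq lbr_add lbr_scale
    by (simp add: H.scale_right_diff_distrib H.scale_right_distrib power2_eq_square)
qed

definition dcurv :: "real \<Rightarrow> 'g \<Rightarrow> 'g \<Rightarrow> 'n" where
  "dcurv t x y = dact (interp t) x (\<alpha> y) - dact (interp t) y (\<alpha> x) - \<alpha> (lbr (quo_alg E) x y)"

text \<open>The derivative of the curvature is the covariant exterior derivative of \<alpha> at the
  same time t. Both covariant derivatives in \<open>dcurv\<close> contribute t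
  [\<alpha> x, \<alpha> y], which together make the derivative of the quadratic term.\<close>

lemma curv_path_deriv: "poly_curve_deriv sn (\<lambda>t. curv (interp t) x y) (\<lambda>t. dcurv t x y)"
proof -
  let ?b = "lbr (ker_alg E) (\<alpha> x) (\<alpha> y)"
  have anti: "lbr (ker_alg E) (\<alpha> y) (\<alpha> x) = - ?b" by (rule lbr_anti)
  have two: "sn (of_nat 2 * of_real t ^ (2 - 1)) ?b = sn (of_real t) ?b + sn (of_real t) ?b" for t
    by (simp flip: N.scale_left_distrib)
  have "dcurv t x y = 0 + (sn (of_nat 1 * of_real t ^ (1 - 1)) (curv1 x y) + sn (of_nat 2 * of_real t ^ (2 - 1)) ?b)" for t
    unfolding dcurv_def dact_path anti two curv1_def by (simp add: algebra_simps)
  then show ?thesis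
    unfolding curv_path
    by (simp only:) (intro poly_curve_deriv.add poly_curve_deriv.mono poly_curve_deriv_const vn)
qed

text \<open>By linearity of \<open>f\<close> in each slot, the right-hand side at time t is the
  combination of those at both ends with weights 1 - t and t; these add up to 1, so the action of
  \<open>x\<close> comes out once.\<close>

lemma sym_inv_path:
  assumes "f \<in> sym_inv E V p \<sigma>0" "f \<in> sym_inv E V p \<sigma>1"
  shows "f \<in> sym_inv E V p (interp t)"
proof -
  have inv: "mact V x (f ys) = (\<Sum>i<p. f (ys[i := dact \<sigma> x (ys ! i)]))"
    if "f \<in> sym_inv E V p \<sigma>" "length ys = p" for \<sigma> x ys
    using that by (simp add: sym_inv_def dact_def)
  have lin: "Vector_Spaces.linear sn sv (\<lambda>n. f (ys[i := n]))" if "length ys = p" "i < p" for ys i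
    using multilin_list_update[OF sym_maps_multilin[OF sym_invD[OF assms(1)]]] that by simp
  have "mact V x (f ys) = (\<Sum>i<p. f (ys[i := dact (interp t) x (ys ! i)]))" if len: "length ys = p" for x ys
  proof -
    have "(\<Sum>i<p. f (ys[i := dact (interp t) x (ys ! i)])) =
      (\<Sum>i<p. sv (of_real (1 - t)) (f (ys[i := dact \<sigma>0 x (ys ! i)])) + sv (of_real t) (f (ys[i := dact \<sigma>1 x (ys ! i)])))"
      by (intro sum.cong refl) (use lin[OF len] in \<open>simp add: dact_path_convex Vector_Spaces.linear_iff\<close>)
    also have "\<dots> = sv (of_real (1 - t)) (mact V x (f ys)) + sv (of_real t) (mact V x (f ys))"
      by (simp only: sum.distrib V.scale_sum_right[symmetric] inv[OF assms(1) len, symmetric] inv[OF assms(2) len, symmetric])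
    also have "\<dots> = mact V x (f ys)"
      by (simp flip: V.scale_left_distrib of_real_add)
    finally show ?thesis by simp
  qed
  then show ?thesis using sym_invD[OF assms(1)] by (simp add: sym_inv_def dact_def)
qed

text \<open>The integrand of the transgression in degree p = m + 1, freed from the symmetric
  algebra.\<close>

definition tform :: "nat \<Rightarrow> ('n list \<Rightarrow> 'v) \<Rightarrow> real \<Rightarrow> 'g list \<Rightarrow> 'v" where
  "tform m f t xs = (if length xs = Suc (2 * m)
     then alt_sum (uncons (\<lambda>z ys. sv (1 / 2 ^ m) (f (\<alpha> z # pairs (curv (interp t)) ys)))) xs else 0)"

lemma transgression_eq:
  assumes f: "f \<in> sym_maps sn sv (Suc m)"
  shows "transgression E V (Suc m) f \<sigma>0 \<sigma>1 xs = integral01 sv (\<lambda>t. tform m f t xs)"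
proof -
  have "sym_lift sn sv (Suc m) f (sym_wedge sn 1 (2 * m) (sym_gen sn \<circ> section_diff E \<sigma>0 \<sigma>1)
           (sym_wedge_power sn (sym_gen sn \<circ> curvature E (interp t)) m) xs) = tform m f t xs" for t
  proof (cases "length xs = 1 + 2 * m")
    case True
    have "(\<lambda>ys. f (uncons (\<lambda>z ys. \<alpha> z # pairs (curv (interp t)) ys) ys)) = uncons (\<lambda>z ys. f (\<alpha> z # pairs (curv (interp t)) ys))"
      by (simp add: uncons_def fun_eq_iff)
    moreover have "(\<lambda>ys. sv (1 / 2 ^ m) (uncons (\<lambda>z ys. f (\<alpha> z # pairs (curv (interp t)) ys)) ys)) =
       uncons (\<lambda>z ys. sv (1 / 2 ^ m) (f (\<alpha> z # pairs (curv (interp t)) ys)))"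
      by (simp add: uncons_def fun_eq_iff)
    ultimately show ?thesis
      using True unfolding sym_wedge_transgression[OF True]
      by (subst sym_lift_alt_sum[OF vn vv f])
        (simp_all add: uncons_def[of _ "_ :: 'g list"] curv_def[symmetric, abs_def] \<alpha>_def[symmetric] tform_def
          additive_alt_sum[of "sv (1 / 2 ^ m)", OF V.scale_right_distrib])
  next
    case False
    then show ?thesis
      by (simp add: sym_wedge_def tform_def sym_lift_zero[OF vn vv f])
  qed
  then show ?thesis by (simp add: transgression_def Let_def)
qed

text \<open>Evaluation at t is separated from the list of curves, as the Leibniz rule for
  multilinear maps takes a list of curves.\<close>

lemma pairs_path: "pairs (curv (interp t)) xs = map (\<lambda>g. g t) (pairs (\<lambda>x y t. curv (interp t) x y) xs)"
  by (induction "\<lambda>x y t. curv (interp t) x y" xs rule: pairs.induct) auto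

lemma f_pairs_path_deriv:
  assumes "multilin sn sv p f" "length xs = 2 * p"
  shows "poly_curve_deriv sv (\<lambda>t. f (pairs (curv (interp t)) xs))
    (\<lambda>t. \<Sum>i<p. f ((pairs (curv (interp t)) xs)[i := dcurv t (xs ! (2 * i)) (xs ! (2 * i + 1))]))"
proof -
  let ?gs = "pairs (\<lambda>x y t. curv (interp t) x y) xs" and ?gs' = "pairs (\<lambda>x y t. dcurv t x y) xs"
  have len: "length ?gs = p" "length ?gs' = p" using assms(2) by simp_all
  have "poly_curve_deriv sn (?gs ! i) (?gs' ! i)" if "i < p" for i
    using that assms(2) by (simp add: nth_pairs curv_path_deriv)
  then have "poly_curve_deriv sv (\<lambda>t. f (map (\<lambda>g. g t) ?gs)) (\<lambda>t. \<Sum>i<p. f ((map (\<lambda>g. g t) ?gs)[i := (?gs' ! i) t]))"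
    using poly_curve_deriv_multilin[OF vv, of sn ?gs f ?gs'] assms(1) len by simp
  moreover have "(\<Sum>i<p. f ((map (\<lambda>g. g t) ?gs)[i := (?gs' ! i) t])) =
     (\<Sum>i<p. f ((pairs (curv (interp t)) xs)[i := dcurv t (xs ! (2 * i)) (xs ! (2 * i + 1))]))" for t
    using assms(2) by (intro sum.cong refl) (simp add: nth_pairs pairs_path)
  ultimately show ?thesis by (simp add: pairs_path)
qed

text \<open>The integrand is a polynomial curve, so its weak integral exists, and the definite
  description behind the transgression denotes it.\<close>

lemma tform_weak_integral:
  assumes f: "f \<in> sym_maps sn sv (Suc m)"
  shows "weak_integral sv (\<lambda>t. tform m f t xs) (transgression E V (Suc m) f \<sigma>0 \<sigma>1 xs)"
proof -
  have "\<exists>v. weak_integral sv (\<lambda>t. tform m f t xs) v"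
  proof (cases "length xs = Suc (2 * m)")
    case True
    let ?D = "\<lambda>t ys. sv (1 / 2 ^ m) (\<Sum>i<m. f (\<alpha> (hd ys) # (pairs (curv (interp t)) (tl ys))[i := dcurv t (tl ys ! (2 * i)) (tl ys ! (2 * i + 1))]))"
    have "poly_curve_deriv sv (\<lambda>t. tform m f t xs) (\<lambda>t. alt_sum (?D t) xs)"
      unfolding tform_def if_P[OF True]
    proof (rule poly_curve_deriv_alt_sum[OF vv])
      fix ys :: "'g list" assume "length ys = length xs"
      then have "length (tl ys) = 2 * m" using True by simp
      from f_pairs_path_deriv[OF multilin_Cons[OF sym_maps_multilin[OF f]] this, of "\<alpha> (hd ys)"]
      show "poly_curve_deriv sv (\<lambda>t. uncons (\<lambda>z ys. sv (1 / 2 ^ m) (f (\<alpha> z # pairs (curv (interp t)) ys))) ys) (\<lambda>t. ?D t ys)"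
        unfolding uncons_def
        by (rule poly_curve_deriv_linear[rotated])
          (simp add: Vector_Spaces.linear_iff vv V.scale_right_distrib mult.commute)
    qed
    then show ?thesis by (rule poly_curve_weak_integrable)
  next
    case False
    then show ?thesis using weak_integral_zero[OF vv] by (auto simp: tform_def)
  qed
  then show ?thesis
    using integral01_eq[OF vv] by (auto simp: transgression_eq[OF f])
qed

text \<open>Multilinearity and alternation hold for the integrand at each t and pass to the integral
  by linearity and uniqueness of weak integrals.\<close>

lemma transgression_in_cochains:
  assumes f: "f \<in> sym_maps sn sv (Suc m)"
  shows "transgression E V (Suc m) f \<sigma>0 \<sigma>1 \<in> cochains (quo_alg E) V (Suc (2 * m))"
proof -
  let ?T = "transgression E V (Suc m) f \<sigma>0 \<sigma>1"
  note wi = tform_weak_integral[OF f] and uniq = weak_integral_unique[OF vv]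
  have tform: "tform m f t \<in> cochains (quo_alg E) V (Suc (2 * m))" for t
  proof (rule alt_maps_alt_sum[OF vg vv, where c = 1])
    show "multilin (lscale (quo_alg E)) sv (Suc (2 * m)) (uncons (\<lambda>z ys. (\<lambda>us. sv (1 / 2 ^ m) (f us)) (\<alpha> z # pairs (curv (interp t)) ys)))"
      by (rule multilin_Cons_pairs[OF curv_linear[OF path_section] curv_linear_right[OF path_section] \<alpha>_linear
          sym_maps_multilin[OF sym_maps_scale[OF f]]])
  qed (auto simp: tform_def intro: two_torsion)
  have zero: "?T xs = 0" if "\<And>t. tform m f t xs = 0" for xs
    using uniq[OF wi[of xs]] weak_integral_zero[OF vv] that by simp
  have add: "?T xs = ?T ys + ?T zs" if "\<And>t. tform m f t xs = tform m f t ys + tform m f t zs" for xs ys zs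
    using uniq[OF wi[of xs]] weak_integral_add[OF wi[of ys] wi[of zs]] that by simp
  have scale: "?T xs = sv c (?T ys)" if "\<And>t. tform m f t xs = sv c (tform m f t ys)" for xs ys c
  proof -
    have "Vector_Spaces.linear sv sv (sv c)"
      by (simp add: Vector_Spaces.linear_iff vv V.scale_right_distrib mult.commute)
    from uniq[OF wi[of xs]] weak_integral_linear[OF this wi[of ys]] show ?thesis using that by simp
  qed
  show ?thesis
    unfolding alt_maps_def multilinear_maps_def Vector_Spaces.linear_iff
  proof (intro CollectI conjI allI impI, goal_cases)
    case (1 xs) then show ?case by (intro zero) (simp add: tform_def)
  next
    case (4 xs i x y) then show ?case
      using tform by (intro add) (simp add: alt_maps_def multilinear_maps_def Vector_Spaces.linear_iff)
  next
    case (5 xs i c x) then show ?case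
      using tform by (intro scale) (simp add: alt_maps_def multilinear_maps_def Vector_Spaces.linear_iff)
  next
    case (6 xs) then show ?case
      using tform by (intro zero) (simp add: alt_maps_def)
  qed (rule vg vv)+
qed

text \<open>On fixed arguments the differential is a finite sum of linear maps applied to values of
  the cochain, so it commutes with the integral.\<close>

lemma weak_integral_ce_diff:
  assumes "\<And>ys. weak_integral sv (\<lambda>t. \<omega> t ys) (I ys)"
  shows "weak_integral sv (\<lambda>t. ce_diff (quo_alg E) V (\<omega> t) xs) (ce_diff (quo_alg E) V I xs)"
proof -
  have lin: "Vector_Spaces.linear sv sv (sv c)" for c
    by (simp add: Vector_Spaces.linear_iff vv V.scale_right_distrib mult.commute)
  show ?thesis
    unfolding ce_diff_def case_prod_beta
    by (intro weak_integral_add weak_integral_sum[OF vv] weak_integral_linear[OF lin]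
        weak_integral_linear[OF lie_moduleD(4)[OF module]] assms)
qed

text \<open>Differentiation hits each of the p curvature blocks, and symmetry makes all p terms
  equal to \<open>?A t\<close>. Twice the differential of \<open>tform\<close> is 1/2^m times the
  same sum, so halving it produces the constant 1/2^p of the characteristic cochain.\<close>

lemma chern_cochain_path_deriv:
  assumes f0: "f \<in> sym_inv E V (Suc m) \<sigma>0" and f1: "f \<in> sym_inv E V (Suc m) \<sigma>1"
    and len: "length xs = 2 * Suc m"
  shows "poly_curve_deriv sv (\<lambda>t. chern_cochain E V (Suc m) f (interp t) xs)
    (\<lambda>t. sv (of_nat (Suc m)) (ce_diff (quo_alg E) V (tform m f t) xs))"
proof -
  let ?p = "Suc m"
  note fm = sym_invD[OF f0]
  let ?A = "\<lambda>t. alt_sum (uncons (\<lambda>a. uncons (\<lambda>b ys. f (dcurv t a b # pairs (curv (interp t)) ys)))) xs"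
  have lin: "Vector_Spaces.linear sv sv (sv c)" for c
    by (simp add: Vector_Spaces.linear_iff vv V.scale_right_distrib mult.commute)
  have "poly_curve_deriv sv (\<lambda>t. chern_cochain E V ?p f (interp t) xs)
    (\<lambda>t. sv (1 / 2 ^ ?p) (alt_sum (\<lambda>ys. \<Sum>i<?p. f ((pairs (curv (interp t)) ys)[i := dcurv t (ys ! (2 * i)) (ys ! (2 * i + 1))])) xs))"
    unfolding chern_cochain_eq[OF fm] if_P[OF len]
    by (intro poly_curve_deriv_linear[OF lin] poly_curve_deriv_alt_sum[OF vv] f_pairs_path_deriv[OF sym_maps_multilin[OF fm]])
      (simp add: len)
  moreover have "sv (1 / 2 ^ ?p) (alt_sum (\<lambda>ys. \<Sum>i<?p. f ((pairs (curv (interp t)) ys)[i := dcurv t (ys ! (2 * i)) (ys ! (2 * i + 1))])) xs) =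
     sv (of_nat ?p) (ce_diff (quo_alg E) V (tform m f t) xs)" for t
  proof -
    let ?f = "\<lambda>us. sv (1 / 2 ^ m) (f us)"
    interpret C: equivariant_curvature "quo_alg E" V "curv (interp t)" "dact (interp t)" ?p ?f
      by (rule sym_inv_equivariant_curvature[OF path_section sym_inv_scale[OF sym_inv_path[OF f0 f1]]])
    have "alt_sum (\<lambda>ys. \<Sum>i<?p. f ((pairs (curv (interp t)) ys)[i := dcurv t (ys ! (2 * i)) (ys ! (2 * i + 1))])) xs = (\<Sum>i<?p. ?A t)"
      unfolding alt_sum_sum using len
      by (intro sum.cong refl alt_sum_pairs_block sym_map_mset[OF vn vv fm]) auto
    also have "\<dots> = sv (of_nat ?p) (?A t)" by (simp only: V.sum_constant_scale card_lessThan)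
    finally have 1: "alt_sum (\<lambda>ys. \<Sum>i<?p. f ((pairs (curv (interp t)) ys)[i := dcurv t (ys ! (2 * i)) (ys ! (2 * i + 1))])) xs = sv (of_nat ?p) (?A t)" .
    let ?d = "ce_diff (quo_alg E) V (tform m f t) xs"
    have "?d + ?d = alt_sum (uncons (\<lambda>a. uncons (\<lambda>b ys. ?f (dcurv t a b # pairs (curv (interp t)) ys)))) xs"
      unfolding dcurv_def by (rule C.ce_diff_Cons_pairs[where \<alpha> = \<alpha> and m = m, OF refl len \<alpha>_neg]) (simp add: tform_def)
    also have "\<dots> = sv (1 / 2 ^ m) (?A t)"
      by (subst additive_alt_sum[of "sv (1 / 2 ^ m)", OF V.scale_right_distrib]) (simp add: uncons_def[abs_def])
    finally have "sv (1 / 2 ^ m) (?A t) = sv 2 ?d"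
      by (metis V.scale_left_distrib V.scale_one one_add_one)
    then have "sv (1 / 2) (sv (1 / 2 ^ m) (?A t)) = sv (1 / 2) (sv 2 ?d)" by (simp only:)
    then have "?d = sv (1 / 2 ^ ?p) (?A t)" by simp
    then show ?thesis unfolding 1 by simp
  qed
  ultimately show ?thesis by simp
qed

theorem transgression_formula:
  assumes f0: "f \<in> sym_inv E V p \<sigma>0" and f1: "f \<in> sym_inv E V p \<sigma>1"
  shows "sv (of_nat p) (ce_diff (quo_alg E) V (transgression E V p f \<sigma>0 \<sigma>1) xs) =
    chern_cochain E V p f \<sigma>1 xs - chern_cochain E V p f \<sigma>0 xs"
proof (cases p)
  \<comment> \<open>No curvature enters in degree 0: both characteristic cochains have the value
    \<open>f []\<close> on the empty list.\<close>
  case 0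
  with sym_invD[OF f0] show ?thesis by (auto simp: chern_cochain_eq)
next
  case (Suc m)
  note fm = sym_invD[OF f0[unfolded Suc]]
  let ?T = "transgression E V (Suc m) f \<sigma>0 \<sigma>1"
  show ?thesis
  proof (cases "length xs = 2 * Suc m")
    case True
    have lin: "Vector_Spaces.linear sv sv (sv c)" for c
      by (simp add: Vector_Spaces.linear_iff vv V.scale_right_distrib mult.commute)
    \<comment> \<open>The same curve is integrated in two ways: by pulling the differential out, and
      as a derivative. Uniqueness of the weak integral equates the results.\<close>
    have "weak_integral sv (\<lambda>t. sv (of_nat (Suc m)) (ce_diff (quo_alg E) V (tform m f t) xs))
      (sv (of_nat (Suc m)) (ce_diff (quo_alg E) V ?T xs))"
      by (intro weak_integral_linear[OF lin] weak_integral_ce_diff tform_weak_integral[OF fm])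
    from weak_integral_unique[OF vv this weak_integral_deriv[OF vv chern_cochain_path_deriv[OF f0[unfolded Suc] f1[unfolded Suc] True]]]
    show ?thesis by (simp only: Suc path_0 path_1)
  next
    case False
    have "?T xs = 0" if "length xs \<noteq> Suc (2 * m)" for xs
      using transgression_in_cochains[OF fm] that by (simp add: alt_maps_def multilinear_maps_def)
    then have "ce_diff (quo_alg E) V ?T xs = 0"
      using False by (intro ce_diff_length[of "Suc (2 * m)"]) auto
    with False show ?thesis by (simp add: Suc chern_cochain_eq[OF fm])
  qed
qed

lemma chern_class_eq:
  assumes f0: "f \<in> sym_inv E V p \<sigma>0" and f1: "f \<in> sym_inv E V p \<sigma>1"
  shows "chern_class E V p \<sigma>0 f = chern_class E V p \<sigma>1 f"
  unfolding chern_class_def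
proof (rule coh_class_eq[OF vg module, symmetric])
  have "(\<lambda>xs. chern_cochain E V p f \<sigma>1 xs - chern_cochain E V p f \<sigma>0 xs) \<in> coboundaries (quo_alg E) V (2 * p)"
    unfolding transgression_formula[OF assms, symmetric]
  proof (cases p)
    \<comment> \<open>In degree 0 the only coboundary is zero, and the factor
      \<open>of_nat 0\<close> makes the difference zero.\<close>
    case 0
    then show "(\<lambda>xs. sv (of_nat p) (ce_diff (quo_alg E) V (transgression E V p f \<sigma>0 \<sigma>1) xs)) \<in> coboundaries (quo_alg E) V (2 * p)"
      by (simp add: coboundaries_def)
  next
    case (Suc m)
    then show "(\<lambda>xs. sv (of_nat p) (ce_diff (quo_alg E) V (transgression E V p f \<sigma>0 \<sigma>1) xs)) \<in> coboundaries (quo_alg E) V (2 * p)"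
      using transgression_in_cochains sym_invD[OF f0]
      by (intro coboundaries_scale[OF vg module]) (auto simp: coboundaries_def)
  qed
  then show "(chern_cochain E V p f \<sigma>1, chern_cochain E V p f \<sigma>0) \<in> coh_rel (quo_alg E) V (2 * p)"
    by (simp add: coh_rel_def chern_cochain_cocycle[OF sec0 f0] chern_cochain_cocycle[OF sec1 f1])
qed

end

section \<open>The Chern-Weil homomorphism\<close>

context lie_extension_module
begin

lemma chern_class_independent:
  assumes "linear_section E \<sigma>" "linear_section E \<sigma>'" "f \<in> sym_inv E V p \<sigma>" "f \<in> sym_inv E V p \<sigma>'"
  shows "chern_class E V p \<sigma> f = chern_class E V p \<sigma>' f"
proof -
  interpret two_sections E V \<sigma> \<sigma>' by unfold_locales (fact assms)+
  show ?thesis by (rule chern_class_eq) fact+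
qed

text \<open>The given section witnesses that the choice in \<open>chern_weil\<close> is admissible;
  independence of the section then replaces the chosen one by \<sigma>.\<close>

lemma chern_weil_eq:
  assumes \<sigma>: "linear_section E \<sigma>" and f: "f \<in> sym_inv E V p \<sigma>"
  shows "chern_weil E V p f = coh_scale (quo_alg E) V (2 * p) (1 / of_nat (fact p)) (chern_class E V p \<sigma> f)"
    and "chern_weil E V p f = coh_class (quo_alg E) V (2 * p) (\<lambda>xs. sv (1 / of_nat (fact p)) (chern_cochain E V p f \<sigma> xs))"
proof -
  define \<sigma>' where "\<sigma>' = (SOME \<sigma>. linear_section E \<sigma> \<and> f \<in> sym_inv E V p \<sigma>)"
  have "linear_section E \<sigma>' \<and> f \<in> sym_inv E V p \<sigma>'"
    unfolding \<sigma>'_def by (rule someI[of _ \<sigma>]) (use assms in blast)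
  then have "chern_class E V p \<sigma>' f = chern_class E V p \<sigma> f"
    using assms by (intro chern_class_independent) auto
  then show *: "chern_weil E V p f = coh_scale (quo_alg E) V (2 * p) (1 / of_nat (fact p)) (chern_class E V p \<sigma> f)"
    by (simp add: chern_weil_def \<sigma>'_def Let_def)
  show "chern_weil E V p f = coh_class (quo_alg E) V (2 * p) (\<lambda>xs. sv (1 / of_nat (fact p)) (chern_cochain E V p f \<sigma> xs))"
    unfolding * chern_class_def by (rule coh_scale_class[OF vg module chern_cochain_cocycle[OF assms]])
qed

lemma chern_cochain_linear:
  assumes g: "g \<in> sym_maps sn sv p" and h: "h \<in> sym_maps sn sv p"
  shows "chern_cochain E V p (\<lambda>ys. sv a (g ys) + sv b (h ys)) \<sigma> xs =
    sv a (chern_cochain E V p g \<sigma> xs) + sv b (chern_cochain E V p h \<sigma> xs)"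
  using sym_maps_add[OF sym_maps_scale[OF g, of a] sym_maps_scale[OF h, of b]]
  by (simp add: chern_cochain_eq g h alt_sum_add V.scale_right_distrib mult.commute
      additive_alt_sum[of "sv a", OF V.scale_right_distrib, symmetric]
      additive_alt_sum[of "sv b", OF V.scale_right_distrib, symmetric])

text \<open>The section chosen inside \<open>chern_weil\<close> depends on the symmetric map and may
  differ among \<open>g\<close>, \<open>h\<close> and their combination; all three classes are
  therefore recomputed with the common \<sigma>.\<close>

lemma chern_weil_linear:
  assumes \<sigma>: "linear_section E \<sigma>" and g: "g \<in> sym_inv E V p \<sigma>" and h: "h \<in> sym_inv E V p \<sigma>"
  shows "chern_weil E V p (\<lambda>ys. sv a (g ys) + sv b (h ys)) =
    coh_add (quo_alg E) V (2 * p)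
      (coh_scale (quo_alg E) V (2 * p) a (chern_weil E V p g))
      (coh_scale (quo_alg E) V (2 * p) b (chern_weil E V p h))"
proof -
  have gh: "(\<lambda>ys. sv a (g ys) + sv b (h ys)) \<in> sym_inv E V p \<sigma>"
    by (intro sym_inv_add sym_inv_scale g h)
  let ?L = "quo_alg E" and ?c = "1 / of_nat (fact p) :: 'k"
  let ?g = "\<lambda>xs. sv ?c (chern_cochain E V p g \<sigma> xs)" and ?h = "\<lambda>xs. sv ?c (chern_cochain E V p h \<sigma> xs)"
  have c: "?g \<in> cocycles ?L V (2 * p)" "?h \<in> cocycles ?L V (2 * p)"
    by (intro cocycles_scale[OF vg module] chern_cochain_cocycle \<sigma> g h)+
  have "coh_add ?L V (2 * p) (coh_scale ?L V (2 * p) a (coh_class ?L V (2 * p) ?g))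
      (coh_scale ?L V (2 * p) b (coh_class ?L V (2 * p) ?h)) =
    coh_class ?L V (2 * p) (\<lambda>xs. sv a (?g xs) + sv b (?h xs))"
    unfolding coh_scale_class[OF vg module c(1)] coh_scale_class[OF vg module c(2)]
    by (intro coh_add_class[OF vg module] cocycles_scale[OF vg module] c)
  also have "(\<lambda>xs. sv a (?g xs) + sv b (?h xs)) =
    (\<lambda>xs. sv ?c (chern_cochain E V p (\<lambda>ys. sv a (g ys) + sv b (h ys)) \<sigma> xs))"
    by (simp add: chern_cochain_linear[OF sym_invD[OF g] sym_invD[OF h]] V.scale_right_distrib)
  finally show ?thesis
    unfolding chern_weil_eq(2)[OF \<sigma> g] chern_weil_eq(2)[OF \<sigma> h] chern_weil_eq(2)[OF \<sigma> gh] by (rule sym)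
qed

end

text \<open>The class of the characteristic cochain and Lecomte's class differ by the factor p!,
  which is invertible in the ground field; the conclusion records the conversion in both
  directions.\<close>

theorem corollary5p3:
  fixes E :: "('k::real_normed_field, 'n::ab_group_add, 'h::ab_group_add, 'g::ab_group_add) lie_ext"
    and V :: "('k, 'g, 'v::ab_group_add) lie_mod"
    and p :: nat
    and \<sigma>0 \<sigma>1 :: "'g \<Rightarrow> 'h"
    and f :: "'n list \<Rightarrow> 'v"
  assumes "lie_extension E"
    and "lie_module (quo_alg E) V"
    and "linear_section E \<sigma>0"
    and "linear_section E \<sigma>1"
    and "f \<in> sym_inv E V p \<sigma>0"
    and "f \<in> sym_inv E V p \<sigma>1"
  shows
    "(p \<ge> 1 \<longrightarrow> transgression E V p f \<sigma>0 \<sigma>1 \<in> cochains (quo_alg E) V (2 * p - 1)) \<and>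
     chern_cochain E V p f \<sigma>0 \<in> cocycles (quo_alg E) V (2 * p) \<and>
     chern_cochain E V p f \<sigma>1 \<in> cocycles (quo_alg E) V (2 * p) \<and>
     (\<lambda>xs. mscale V (of_nat p) (ce_diff (quo_alg E) V (transgression E V p f \<sigma>0 \<sigma>1) xs)) =
       (\<lambda>xs. chern_cochain E V p f \<sigma>1 xs - chern_cochain E V p f \<sigma>0 xs) \<and>
     chern_class E V p \<sigma>0 f = chern_class E V p \<sigma>1 f \<and>
     (\<forall>\<sigma> \<sigma>' g. linear_section E \<sigma> \<and> linear_section E \<sigma>' \<and>
        g \<in> sym_inv E V p \<sigma> \<inter> sym_inv E V p \<sigma>' \<longrightarrow>
          chern_class E V p \<sigma> g \<in> cohomology (quo_alg E) V (2 * p) \<and>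
          chern_class E V p \<sigma> g = chern_class E V p \<sigma>' g) \<and>
     (\<forall>\<sigma> g. linear_section E \<sigma> \<and> g \<in> sym_inv E V p \<sigma> \<longrightarrow>
        chern_weil E V p g \<in> cohomology (quo_alg E) V (2 * p) \<and>
        chern_weil E V p g =
          coh_scale (quo_alg E) V (2 * p) (1 / of_nat (fact p)) (chern_class E V p \<sigma> g) \<and>
        chern_class E V p \<sigma> g =
          coh_scale (quo_alg E) V (2 * p) (of_nat (fact p)) (chern_weil E V p g)) \<and>
     (\<forall>\<sigma> g h a b. linear_section E \<sigma> \<and> g \<in> sym_inv E V p \<sigma> \<and> h \<in> sym_inv E V p \<sigma> \<longrightarrow>
        chern_weil E V p (\<lambda>ys. mscale V a (g ys) + mscale V b (h ys)) =
          coh_add (quo_alg E) V (2 * p)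
            (coh_scale (quo_alg E) V (2 * p) a (chern_weil E V p g))
            (coh_scale (quo_alg E) V (2 * p) b (chern_weil E V p h)))"
proof -
  interpret two_sections E V \<sigma>0 \<sigma>1 by unfold_locales (fact assms)+
  note f0 = assms(5) and f1 = assms(6)
  have c1: "transgression E V p f \<sigma>0 \<sigma>1 \<in> cochains (quo_alg E) V (2 * p - 1)" if p1: "p \<ge> 1"
  proof -
    obtain m where "p = Suc m" using p1 by (cases p) auto
    then show ?thesis using transgression_in_cochains sym_invD[OF f0] by auto
  qed
  have c2: "(\<lambda>xs. sv (of_nat p) (ce_diff (quo_alg E) V (transgression E V p f \<sigma>0 \<sigma>1) xs)) =
      (\<lambda>xs. chern_cochain E V p f \<sigma>1 xs - chern_cochain E V p f \<sigma>0 xs)"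
    by (simp only: transgression_formula[OF f0 f1])
  have c3: "chern_class E V p \<sigma> g \<in> cohomology (quo_alg E) V (2 * p) \<and>
      chern_class E V p \<sigma> g = chern_class E V p \<sigma>' g"
    if "linear_section E \<sigma> \<and> linear_section E \<sigma>' \<and> g \<in> sym_inv E V p \<sigma> \<inter> sym_inv E V p \<sigma>'" for \<sigma> \<sigma>' g
  proof
    show "chern_class E V p \<sigma> g \<in> cohomology (quo_alg E) V (2 * p)"
      unfolding chern_class_def using that by (blast intro: coh_class_in_cohomology[OF vg module] chern_cochain_cocycle)
    show "chern_class E V p \<sigma> g = chern_class E V p \<sigma>' g"
      using that by (intro chern_class_independent) auto
  qed
  have c4: "chern_weil E V p g \<in> cohomology (quo_alg E) V (2 * p) \<and>
      chern_weil E V p g = coh_scale (quo_alg E) V (2 * p) (1 / of_nat (fact p)) (chern_class E V p \<sigma> g) \<and>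
      chern_class E V p \<sigma> g = coh_scale (quo_alg E) V (2 * p) (of_nat (fact p)) (chern_weil E V p g)"
    if "linear_section E \<sigma> \<and> g \<in> sym_inv E V p \<sigma>" for \<sigma> g
  proof (intro conjI)
    note g = conjunct1[OF that] conjunct2[OF that]
    show "chern_weil E V p g \<in> cohomology (quo_alg E) V (2 * p)"
      unfolding chern_weil_eq(2)[OF g]
      by (intro coh_class_in_cohomology vg module cocycles_scale chern_cochain_cocycle g)
    show "chern_weil E V p g = coh_scale (quo_alg E) V (2 * p) (1 / of_nat (fact p)) (chern_class E V p \<sigma> g)"
      by (rule chern_weil_eq(1)[OF g])
    show "chern_class E V p \<sigma> g = coh_scale (quo_alg E) V (2 * p) (of_nat (fact p)) (chern_weil E V p g)"
      unfolding chern_weil_eq(2)[OF g] chern_class_def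
      by (subst coh_scale_class[OF vg module])
        (simp_all add: cocycles_scale[OF vg module] chern_cochain_cocycle[OF g])
  qed
  have c5: "chern_weil E V p (\<lambda>ys. sv a (g ys) + sv b (h ys)) =
      coh_add (quo_alg E) V (2 * p)
        (coh_scale (quo_alg E) V (2 * p) a (chern_weil E V p g))
        (coh_scale (quo_alg E) V (2 * p) b (chern_weil E V p h))"
    if "linear_section E \<sigma> \<and> g \<in> sym_inv E V p \<sigma> \<and> h \<in> sym_inv E V p \<sigma>" for \<sigma> g h a b
    by (rule chern_weil_linear[OF conjunct1[OF that] conjunct1[OF conjunct2[OF that]] conjunct2[OF conjunct2[OF that]]])
  show ?thesis
    by (intro conjI; (intro allI impI)?;
      (rule c2 chern_cochain_cocycle[OF sec0 f0] chern_cochain_cocycle[OF sec1 f1] chern_class_eq[OF f0 f1] | erule c1 c3 c4 c5))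
qed

end
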